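(* (1) The space $\Lambda^\circ$ decomposes (algebraically) into a direct sum of eigenspaces of $A_{z,z'}$, and this decomposition is orthogonal with respect to the inner product $(f,g)_{z,z'}=\int_\Omega f(\omega)g(\omega)P_{z,z'}(d\omega)$. (2) The set of eigenvalues (spectrum) of $A_{z,z'}$ is $\{0\}\cup\{-\sigma_m:m=2,3,\dots\}$, where $\sigma_m=m(m-1+zz')$. (3) The eigenvalue $0$ is simple, and the multiplicity of $-\sigma_m$ equals the number of partitions of $m$ without parts equal to $1$.
   Context: Young diagrams: $\mathbb Y_n$ is the set of Young diagrams with $n$ boxes; $\mu\nearrow\lambda$ means $\mu\subset\lambda$, $|\lambda|=|\mu|+1$; $(z)_\theta=\prod_{(i,j)\in\theta}(z+j-i)$ for a (skew) diagram $\theta$ ($(i,j)$ = row $i$, column $j$), $(z)_n=z(z+1)\cdots(z+n-1)$; $\dim\lambda$ = number of standard Young tableaux of shape $\lambda$. Modified Frobenius coordinates $\lambda=(a_1,\dots,a_d\mid b_1,\dots,b_d)$: $d$ the number of diagonal boxes, $a_i=\lambda_i-i+\frac12$, $b_i=\lambda'_i-i+\frac12$. $(z,z')$ is fixed in the principal series ($z\notin\mathbb R$, $z'=\bar z$) or complementary series ($z,z'\in(N,N+1)$, $N\in\mathbb Z$); then $zz'>0$. The z-measure on $\mathbb Y_n$ is $M_n(\lambda)=\frac{(z)_\lambda(z')_\lambda}{(zz')_n}\frac{(\dim\lambda)^2}{n!}$. Thoma simplex $\Omega$: pairs $\omega=(\alpha,\beta)$ of nonincreasing sequences of nonnegative reals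 with $\sum_i(\alpha_i+\beta_i)\le1$ (compact in the product topology); $\iota_n:\mathbb Y_n\to\Omega$, $\alpha_i=a_i/n$, $\beta_i=b_i/n$ ($i\le d$), 0 otherwise. The boundary z-measure $P_{z,z'}$ is the weak limit (which exists) of the push-forwards $\iota_n(M_n)$. $\Lambda=\mathbb R[p_1,p_2,\dots]$ is the algebra of symmetric functions with Schur functions $s_\mu$; $\Lambda^\circ=\Lambda/(p_1-1)$, realized as functions on $\Omega$ via $p_1^\circ=1$, $p_k^\circ(\omega)=\sum_i\alpha_i^k+(-1)^{k-1}\sum_i\beta_i^k$ ($k\ge2$). $A_{z,z'}:\Lambda^\circ\to\Lambda^\circ$ is the linear operator $A_{z,z'}s^\circ_\mu=-m(m-1+zz')s^\circ_\mu+\sum_{\mu_\bullet\nearrow\mu}(z)_{\mu/\mu_\bullet}(z')_{\mu/\mu_\bullet}s^\circ_{\mu_\bullet}$, $m=|\mu|$ (the pre-generator of the limit of the up–down Markov chains). *)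

theory Defs
  imports "HOL-Probability.Probability" "HOL-Library.Function_Algebras"
begin

definition is_partition :: "nat list \<Rightarrow> bool" where
  "is_partition l \<longleftrightarrow> sorted_wrt (\<ge>) l \<and> 0 \<notin> set l"

definition YD :: "nat \<Rightarrow> nat list set" where
  "YD n = {l. is_partition l \<and> sum_list l = n}"

text \<open>Boxes (i,j), 0-based row i and column j (the content j - i is the same as
  in the 1-based convention).\<close>
definition boxes :: "nat list \<Rightarrow> (nat \<times> nat) set" where
  "boxes l = {(i, j). i < length l \<and> j < l ! i}"

definition covered_by :: "nat list \<Rightarrow> nat list \<Rightarrow> bool" where
  "covered_by mu lam \<longleftrightarrow> is_partition mu \<and> is_partition lam \<and>
     boxes mu \<subseteq> boxes lam \<and> card (boxes lam) = card (boxes mu) + 1"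

definition gpoch :: "complex \<Rightarrow> (nat \<times> nat) set \<Rightarrow> complex" where
  "gpoch z th = (\<Prod>(i, j)\<in>th. z + of_int (int j - int i))"

definition SYT :: "nat list \<Rightarrow> ((nat \<times> nat) \<Rightarrow> nat) set" where
  "SYT lam = {T. T \<in> boxes lam \<rightarrow>\<^sub>E {1..sum_list lam} \<and>
       bij_betw T (boxes lam) {1..sum_list lam} \<and>
       (\<forall>i j. (i, j + 1) \<in> boxes lam \<longrightarrow> T (i, j) < T (i, j + 1)) \<and>
       (\<forall>i j. (i + 1, j) \<in> boxes lam \<longrightarrow> T (i, j) < T (i + 1, j))}"

definition dimY :: "nat list \<Rightarrow> nat" where
  "dimY lam = card (SYT lam)"

definition zmeasure :: "complex \<Rightarrow> complex \<Rightarrow> nat \<Rightarrow> nat list \<Rightarrow> real" where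
  "zmeasure z z' n lam =
     Re (gpoch z (boxes lam) * gpoch z' (boxes lam) / pochhammer (z * z') n)
       * real (dimY lam) ^ 2 / fact n"

definition admissible :: "complex \<Rightarrow> complex \<Rightarrow> bool" where
  "admissible z z' \<longleftrightarrow>
     (z \<notin> \<real> \<and> z' = cnj z) \<or>
     (\<exists>N::int. z \<in> \<real> \<and> z' \<in> \<real> \<and> of_int N < Re z \<and> Re z < of_int N + 1
                \<and> of_int N < Re z' \<and> Re z' < of_int N + 1)"

type_synonym thoma = "(nat \<Rightarrow> real) \<times> (nat \<Rightarrow> real)"

definition Thoma :: "thoma set" where
  "Thoma = {(a, b). (\<forall>i. a (Suc i) \<le> a i \<and> b (Suc i) \<le> b i \<and> 0 \<le> a i \<and> 0 \<le> b i) \<and>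
                     (\<forall>n. (\<Sum>i<n. a i + b i) \<le> 1)}"

text \<open>Modified Frobenius coordinates (0-based index i corresponds to i+1).\<close>
definition diag_len :: "nat list \<Rightarrow> nat" where
  "diag_len lam = card {i. i < length lam \<and> i < lam ! i}"

definition conj_part :: "nat list \<Rightarrow> nat \<Rightarrow> nat" where
  "conj_part lam j = card {i. i < length lam \<and> j < lam ! i}"

definition frob_a :: "nat list \<Rightarrow> nat \<Rightarrow> real" where
  "frob_a lam i = real (lam ! i) - real i - 1/2"

definition frob_b :: "nat list \<Rightarrow> nat \<Rightarrow> real" where
  "frob_b lam i = real (conj_part lam i) - real i - 1/2"

definition embed :: "nat \<Rightarrow> nat list \<Rightarrow> thoma" where
  "embed n lam =
     ((\<lambda>i. if i < diag_len lam then frob_a lam i / real n else 0),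
      (\<lambda>i. if i < diag_len lam then frob_b lam i / real n else 0))"

definition is_boundary_zmeasure :: "complex \<Rightarrow> complex \<Rightarrow> thoma measure \<Rightarrow> bool" where
  "is_boundary_zmeasure z z' P \<longleftrightarrow> prob_space P \<and> sets P = sets borel \<and>
     (\<forall>f :: thoma \<Rightarrow> real. continuous_on UNIV f \<and> bounded (range f) \<longrightarrow>
        (\<lambda>n. \<Sum>lam\<in>YD n. zmeasure z z' n lam * f (embed n lam))
          \<longlonglongrightarrow> integral\<^sup>L P f)"

section \<open>The algebra Lambda-circ realised as functions on the Thoma simplex\<close>

definition pcirc :: "nat \<Rightarrow> thoma \<Rightarrow> real" where
  "pcirc k w = (if k = 1 then 1
     else (\<Sum>i. fst w i ^ k) + (-1) ^ (k - 1) * (\<Sum>i. snd w i ^ k))"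

definition zcent :: "nat list \<Rightarrow> real" where
  "zcent rho = (\<Prod>i\<in>set rho. real i ^ count_list rho i * fact (count_list rho i))"

text \<open>Complete homogeneous h_n = sum_{rho |- n} p_rho / z_rho, specialised.\<close>
definition hcirc :: "nat \<Rightarrow> thoma \<Rightarrow> real" where
  "hcirc n w = (\<Sum>rho\<in>YD n. (\<Prod>k\<leftarrow>rho. pcirc k w) / zcent rho)"

definition hcirc_int :: "int \<Rightarrow> thoma \<Rightarrow> real" where
  "hcirc_int k w = (if k < 0 then 0 else hcirc (nat k) w)"

text \<open>Schur function via Jacobi-Trudi, s_mu = det [h_(mu_i - i + j)], as a function on the
  Thoma simplex (zero outside).\<close>
definition scirc :: "nat list \<Rightarrow> thoma \<Rightarrow> real" where
  "scirc mu w = (if w \<in> Thoma then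
     (\<Sum>s | s permutes {..<length mu}. of_int (sign s) *
        (\<Prod>i<length mu. hcirc_int (int (mu ! i) - int i + int (s i)) w))
   else 0)"

definition LamC :: "(thoma \<Rightarrow> real) set" where
  "LamC = {f. \<exists>S c. finite S \<and> (\<forall>mu\<in>S. is_partition mu) \<and>
              f = (\<lambda>w. \<Sum>mu\<in>S. c mu * scirc mu w)}"

definition fscale :: "real \<Rightarrow> (thoma \<Rightarrow> real) \<Rightarrow> (thoma \<Rightarrow> real)" where
  "fscale c f = (\<lambda>w. c * f w)"

definition eigenspace :: "((thoma \<Rightarrow> real) \<Rightarrow> (thoma \<Rightarrow> real)) \<Rightarrow> real \<Rightarrow> (thoma \<Rightarrow> real) set" where
  "eigenspace A c = {f \<in> LamC. A f = fscale c f}"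

definition sigma :: "complex \<Rightarrow> complex \<Rightarrow> nat \<Rightarrow> real" where
  "sigma z z' m = real m * (real m - 1 + Re (z * z'))"

definition is_Aop :: "complex \<Rightarrow> complex \<Rightarrow> ((thoma \<Rightarrow> real) \<Rightarrow> (thoma \<Rightarrow> real)) \<Rightarrow> bool" where
  "is_Aop z z' A \<longleftrightarrow>
     (\<forall>f\<in>LamC. \<forall>g\<in>LamC. \<forall>a b. A (\<lambda>w. a * f w + b * g w) = (\<lambda>w. a * A f w + b * A g w)) \<and>
     (\<forall>mu. is_partition mu \<longrightarrow>
        A (scirc mu) = (\<lambda>w. - sigma z z' (sum_list mu) * scirc mu w +
          (\<Sum>nu\<in>{nu. covered_by nu mu}.
             Re (gpoch z (boxes mu - boxes nu) * gpoch z' (boxes mu - boxes nu)) * scirc nu w)))"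

definition partitions_no_ones :: "nat \<Rightarrow> nat" where
  "partitions_no_ones m = card {l \<in> YD m. 1 \<notin> set l}"

end

theory Submission
  imports Defs
    "Jordan_Normal_Form.Determinant"
    "HOL-Computational_Algebra.Polynomial_FPS"
    "HOL-Real_Asymp.Real_Asymp"
begin

text \<open>
  Let \<open>g\<^sub>\<mu>(\<lambda>) = dim(\<mu>, \<lambda>) / dim \<lambda>\<close> on diagrams with \<open>n\<close> boxes. The up-down chain is reversible with
  respect to the z-measure, and \<open>(n + 1)(n + zz')\<close> times its generator acts on the \<open>g\<^sub>\<mu>\<close> exactly as
  \<open>A\<close> acts on the Schur functions \<open>s\<^sub>\<mu>\<close>. Both facts follow termwise from Aitken's determinant
  \<open>dim(\<mu>, \<lambda>) = (n - m)! det [1 / (\<lambda>\<^sub>i - i - \<mu>\<^sub>j + j)!]\<close>: with \<open>w(c) = (z + c)(z' + c)\<close> the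
  difference \<open>w(x) - w(y)\<close> is \<open>x - y\<close> times \<open>z + z' + x + y\<close>, whose sum over the factors of a term
  does not depend on the permutation. The same determinant, multiplied by a Vandermonde-like matrix
  independent of \<open>\<mu>\<close>, becomes a Jacobi-Trudi determinant up to lower order terms, so \<open>g\<^sub>\<mu>\<close> is uniformly
  close to \<open>s\<^sub>\<mu>\<close> at the rescaled Frobenius coordinates. Passing to the weak limit, \<open>A\<close> is symmetric,
  hence its eigenspaces are orthogonal.

  The power sums \<open>p\<^sub>2, p\<^sub>3, ...\<close> are algebraically independent functions on the Thoma simplex, and the
  Schur functions of degree at most \<open>k\<close> span the same space as the monomials in them of degree at
  most \<open>k\<close>. On this filtration \<open>A + \<sigma>\<^sub>k\<close> lowers the degree, and the \<open>\<sigma>\<^sub>k\<close> are distinct, which gives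
  the spectrum and the multiplicities.
\<close>

section \<open>Young diagrams and standard tableaux\<close>

text \<open>On the simplex the Schur functions are linearly dependent: p_1 = 1 already identifies
  the function of the one-box diagram with that of the empty one. Hence symmetry of A is proved on
  the spanning family of Schur functions, dimensions are counted with monomials in p_2, p_3, ...,
  and the two families are matched only as filtrations.

  The chain enters through a single identity: the z-weighted sum over level n of (A + (n + 1)(n +
  zz')) g_a times g_b equals a sum over level n + 1 that is symmetric in a and b.

  Aitken's determinant needs a size N exceeding the number of rows of every diagram involved,
  including those one level up. So rows are padded by zeros, and level n uses N = n + 2.

  The half-integer shift in the modified Frobenius coordinates makes the power sums of an embedded
  diagram exactly computable from the numbers lambda_i - i + 1/2, so the discrepancy between g_mu
  and s_mu comes only from explicit factors that tend to 1 after rescaling.\<close>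

definition rowlen :: "nat list \<Rightarrow> nat \<Rightarrow> nat" where
  "rowlen l i = (if i < length l then l ! i else 0)"

lemma rowlen_antimono: "is_partition l \<Longrightarrow> i \<le> j \<Longrightarrow> rowlen l j \<le> rowlen l i"
  unfolding is_partition_def rowlen_def sorted_wrt_iff_nth_less
  by (cases "i = j") auto

lemma rowlen_pos_iff: "is_partition l \<Longrightarrow> 0 < rowlen l i \<longleftrightarrow> i < length l"
  unfolding is_partition_def rowlen_def by (auto, metis gr0I nth_mem)

lemma rowlen_eq_0: "length l \<le> i \<Longrightarrow> rowlen l i = 0"
  by (simp add: rowlen_def)

lemma rowlen_inj:
  assumes "is_partition l" "is_partition l'" "rowlen l = rowlen l'"
  shows "l = l'"
proof -
  have "i < length l \<longleftrightarrow> i < length l'" for i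
    using assms rowlen_pos_iff by metis
  hence "length l = length l'" by (metis linorder_neqE_nat less_irrefl)
  thus ?thesis using assms(3) by (intro nth_equalityI) (auto simp: rowlen_def fun_eq_iff, metis)
qed

lemma mem_boxes: "(i, j) \<in> boxes l \<longleftrightarrow> j < rowlen l i"
  by (auto simp: boxes_def rowlen_def)

lemma sum_rowlen:
  assumes "length l \<le> N" shows "(\<Sum>i<N. rowlen l i) = sum_list l"
proof -
  have "(\<Sum>i<N. rowlen l i) = (\<Sum>i<length l. rowlen l i)"
    using assms by (intro sum.mono_neutral_right) (auto simp: rowlen_def)
  thus ?thesis by (simp add: rowlen_def sum_list_sum_nth atLeast0LessThan)
qed

lemma boxes_Sigma: "boxes l = (SIGMA i:{..<length l}. {..<rowlen l i})"
  by (auto simp: boxes_def rowlen_def)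

lemma finite_boxes [simp]: "finite (boxes l)"
  by (simp add: boxes_Sigma)

lemma card_boxes: "card (boxes l) = sum_list l"
  by (simp add: boxes_Sigma sum_rowlen)

lemma ex_partition_rowlen:
  assumes "\<And>i. f (Suc i) \<le> f i" "f N = 0"
  shows "\<exists>l. is_partition l \<and> rowlen l = f"
proof -
  have anti: "f j \<le> f i" if "i \<le> j" for i j
    using assms(1) that by (rule lift_Suc_antimono_le)
  define L where "L = (LEAST n. f n = 0)"
  have L: "f L = 0" unfolding L_def by (rule LeastI[of _ N]) fact
  have pos: "f i > 0" if "i < L" for i
    using not_less_Least[OF that[unfolded L_def]] by simp
  have "is_partition (map f [0..<L])"
    unfolding is_partition_def using pos anti
    by (force simp: sorted_wrt_iff_nth_less)
  moreover have "rowlen (map f [0..<L]) = f"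
    using anti[of L] L by (auto simp: rowlen_def fun_eq_iff not_less)
  ultimately show ?thesis by blast
qed

definition of_rows :: "(nat \<Rightarrow> nat) \<Rightarrow> nat list" where
  "of_rows f = (THE l. is_partition l \<and> rowlen l = f)"

lemma of_rows_rowlen: "is_partition l \<Longrightarrow> of_rows (rowlen l) = l"
  unfolding of_rows_def by (rule the_equality) (auto intro: rowlen_inj)

lemma
  assumes "\<And>i. f (Suc i) \<le> f i" "f N = 0"
  shows is_partition_of_rows: "is_partition (of_rows f)"
    and rowlen_of_rows: "rowlen (of_rows f) = f"
proof -
  obtain l where "is_partition l" "rowlen l = f"
    using ex_partition_rowlen[of f N] assms by blast
  thus "is_partition (of_rows f)" "rowlen (of_rows f) = f"
    using of_rows_rowlen by auto
qed

text \<open>Nested diagrams that differ by one box differ in a single row, so a neighbour is encoded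
  by a row index. This is what turns sums over neighbours into sums over rows or columns of a
  determinant.\<close>

lemma covered_by_iff:
  "covered_by k l \<longleftrightarrow> is_partition k \<and> is_partition l \<and>
     (\<exists>i. rowlen l = (rowlen k)(i := Suc (rowlen k i)))"
proof (intro iffI conjI; (elim conjE exE)?)
  assume c: "covered_by k l"
  thus "is_partition k" "is_partition l" by (auto simp: covered_by_def)
  from c have sub: "boxes k \<subseteq> boxes l" and cd: "card (boxes l - boxes k) = 1"
    by (auto simp: covered_by_def card_Diff_subset)
  then obtain i j where ij: "boxes l - boxes k = {(i, j)}"
    by (metis card_1_singletonE surj_pair)
  have mem: "j' < rowlen l i' \<longleftrightarrow> j' < rowlen k i' \<or> (i' = i \<and> j' = j)" for i' j'
    using ij sub unfolding mem_boxes[symmetric] by blast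
  have "rowlen l i' = rowlen k i'" if "i' \<noteq> i" for i'
    using mem[of _ i'] that by (metis linorder_neqE_nat less_irrefl)
  moreover have jk: "\<not> j < rowlen k i" using ij by (auto simp flip: mem_boxes)
  moreover have "rowlen l i = Suc (rowlen k i)"
  proof -
    have "j < rowlen l i" using mem by blast
    hence "rowlen k i = j" using mem[of "rowlen k i" i] jk by fastforce
    moreover have "\<not> Suc j < rowlen l i" using mem[of "Suc j" i] jk by auto
    ultimately show ?thesis using \<open>j < rowlen l i\<close> by simp
  qed
  ultimately show "\<exists>i. rowlen l = (rowlen k)(i := Suc (rowlen k i))" by (intro exI[of _ i]) auto
next
  fix i assume k: "is_partition k" and l: "is_partition l"
    and r: "rowlen l = (rowlen k)(i := Suc (rowlen k i))"
  have "boxes l = insert (i, rowlen k i) (boxes k)"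
    by (auto simp: mem_boxes r split: if_splits)
  moreover have "(i, rowlen k i) \<notin> boxes k" by (simp add: mem_boxes)
  ultimately show "covered_by k l" using k l by (auto simp: covered_by_def)
qed

lemma boxes_diff_upd:
  assumes "rowlen l = (rowlen k)(i := Suc (rowlen k i))"
  shows "boxes l = insert (i, rowlen k i) (boxes k)" "(i, rowlen k i) \<notin> boxes k"
    "boxes l - boxes k = {(i, rowlen k i)}"
  by (auto simp: mem_boxes assms split: if_splits)

lemma sum_list_covered: "covered_by k l \<Longrightarrow> sum_list l = Suc (sum_list k)"
  by (simp add: covered_by_def card_boxes)

lemma of_rows_dec:
  assumes l: "is_partition l" and i: "rowlen l (Suc i) < rowlen l i"
  shows "is_partition (of_rows ((rowlen l)(i := rowlen l i - 1)))"
    "rowlen (of_rows ((rowlen l)(i := rowlen l i - 1))) = (rowlen l)(i := rowlen l i - 1)"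
proof -
  let ?f = "(rowlen l)(i := rowlen l i - 1)"
  have "?f (Suc j) \<le> ?f j" for j
    using i rowlen_antimono[OF l, of j "Suc j"] by auto
  moreover have "?f (length l) = 0" by (auto simp: rowlen_eq_0)
  ultimately show "is_partition (of_rows ?f)" "rowlen (of_rows ?f) = ?f"
    using is_partition_of_rows rowlen_of_rows by blast+
qed

lemma of_rows_inc:
  assumes l: "is_partition l" and i: "i = 0 \<or> rowlen l i < rowlen l (i - 1)"
  shows "is_partition (of_rows ((rowlen l)(i := rowlen l i + 1)))"
    "rowlen (of_rows ((rowlen l)(i := rowlen l i + 1))) = (rowlen l)(i := rowlen l i + 1)"
proof -
  let ?f = "(rowlen l)(i := rowlen l i + 1)"
  have "?f (Suc j) \<le> ?f j" for j
    using i rowlen_antimono[OF l, of j "Suc j"] by auto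
  moreover have "?f (length l + i + 1) = 0" by (auto simp: rowlen_eq_0)
  ultimately show "is_partition (of_rows ?f)" "rowlen (of_rows ?f) = ?f"
    using is_partition_of_rows rowlen_of_rows by blast+
qed

text \<open>Removable corners are the strict descents of the row lengths. For determinantal summands
  the forbidden rows will contribute zero, so the restriction on \<open>i\<close> can later be
  dropped.\<close>

lemma sum_covered_down:
  assumes l: "is_partition l" and N: "length l \<le> N"
  shows "(\<Sum>k | covered_by k l. F k) =
    (\<Sum>i | i < N \<and> rowlen l (Suc i) < rowlen l i. F (of_rows ((rowlen l)(i := rowlen l i - 1))))"
proof (rule sym, rule sum.reindex_bij_betw)
  let ?I = "{i. i < N \<and> rowlen l (Suc i) < rowlen l i}"
  let ?f = "\<lambda>i. (rowlen l)(i := rowlen l i - 1)"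
  have p: "is_partition (of_rows (?f i))" "rowlen (of_rows (?f i)) = ?f i" if "i \<in> ?I" for i
    using that of_rows_dec[OF l, of i] by blast+
  show "bij_betw (\<lambda>i. of_rows (?f i)) ?I {k. covered_by k l}"
    unfolding bij_betw_def
  proof (intro conjI equalityI subsetI)
    show "inj_on (\<lambda>i. of_rows (?f i)) ?I"
    proof (rule inj_onI)
      fix i j assume ij: "i \<in> ?I" "j \<in> ?I" "of_rows (?f i) = of_rows (?f j)"
      hence "?f i = ?f j" using p(2) by metis
      hence "?f i i = ?f j i" by simp
      thus "i = j" using ij(1) by (auto split: if_splits)
    qed
  next
    fix k assume "k \<in> (\<lambda>i. of_rows (?f i)) ` ?I"
    then obtain i where i: "i \<in> ?I" "k = of_rows (?f i)" by blast
    thus "k \<in> {k. covered_by k l}"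
      using p[OF i(1)] l unfolding mem_Collect_eq covered_by_iff
      by (auto intro!: exI[of _ i])
  next
    fix k assume "k \<in> {k. covered_by k l}"
    then obtain i where k: "is_partition k" and i: "rowlen l = (rowlen k)(i := Suc (rowlen k i))"
      by (auto simp: covered_by_iff)
    have "rowlen k = ?f i" by (auto simp: i)
    hence kf: "k = of_rows (?f i)" using of_rows_rowlen[OF k] by simp
    have "rowlen l (Suc i) < rowlen l i"
      using rowlen_antimono[OF k, of i "Suc i"] by (simp add: i)
    moreover have "i < N" using i N by (metis fun_upd_same not_less rowlen_eq_0 le_trans nat.simps(3))
    ultimately show "k \<in> (\<lambda>i. of_rows (?f i)) ` ?I" using kf by blast
  qed
qed

text \<open>The strict bound \<open>length l < N\<close> leaves room for a box in the first empty
  row.\<close>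

lemma sum_covered_up:
  assumes l: "is_partition l" and N: "length l < N"
  shows "(\<Sum>k | covered_by l k. F k) =
    (\<Sum>i | i < N \<and> (i = 0 \<or> rowlen l i < rowlen l (i - 1)). F (of_rows ((rowlen l)(i := rowlen l i + 1))))"
proof (rule sym, rule sum.reindex_bij_betw)
  let ?I = "{i. i < N \<and> (i = 0 \<or> rowlen l i < rowlen l (i - 1))}"
  let ?f = "\<lambda>i. (rowlen l)(i := rowlen l i + 1)"
  have p: "is_partition (of_rows (?f i))" "rowlen (of_rows (?f i)) = ?f i" if "i \<in> ?I" for i
    using that of_rows_inc[OF l, of i] by blast+
  show "bij_betw (\<lambda>i. of_rows (?f i)) ?I {k. covered_by l k}"
    unfolding bij_betw_def
  proof (intro conjI equalityI subsetI)
    show "inj_on (\<lambda>i. of_rows (?f i)) ?I"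
    proof (rule inj_onI)
      fix i j assume ij: "i \<in> ?I" "j \<in> ?I" "of_rows (?f i) = of_rows (?f j)"
      hence "?f i = ?f j" using p(2) by metis
      hence "?f i i = ?f j i" by simp
      thus "i = j" using ij(1) by (auto split: if_splits)
    qed
  next
    fix k assume "k \<in> (\<lambda>i. of_rows (?f i)) ` ?I"
    then obtain i where i: "i \<in> ?I" "k = of_rows (?f i)" by blast
    thus "k \<in> {k. covered_by l k}"
      using p[OF i(1)] l unfolding mem_Collect_eq covered_by_iff
      by (auto intro!: exI[of _ i])
  next
    fix k assume "k \<in> {k. covered_by l k}"
    then obtain i where k: "is_partition k" and i: "rowlen k = (rowlen l)(i := Suc (rowlen l i))"
      by (auto simp: covered_by_iff)
    hence kf: "k = of_rows (?f i)" using of_rows_rowlen[OF k] by simp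
    have c: "i = 0 \<or> rowlen l i < rowlen l (i - 1)"
      using rowlen_antimono[OF k, of "i - 1" "i"] by (cases i) (auto simp: i)
    moreover have "i < N"
    proof (rule ccontr)
      assume "\<not> i < N"
      hence "rowlen l (i - 1) = 0" "i \<noteq> 0" using N by (auto simp: rowlen_eq_0)
      thus False using c by simp
    qed
    ultimately show "k \<in> (\<lambda>i. of_rows (?f i)) ` ?I" using kf by blast
  qed
qed

lemma length_le_sum_list: "is_partition l \<Longrightarrow> length l \<le> sum_list l"
  using sum_list_mono[of l "\<lambda>_. 1" "\<lambda>x. x"]
  by (auto simp: is_partition_def sum_list_triv Suc_le_eq intro!: gr0I)

lemma finite_YD [simp]: "finite (YD n)"
proof (rule finite_subset)
  show "YD n \<subseteq> {xs. set xs \<subseteq> {..n} \<and> length xs \<le> n}"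
    using length_le_sum_list by (auto simp: YD_def intro: member_le_sum_list)
  show "finite {xs. set xs \<subseteq> {..n} \<and> length xs \<le> n}"
    by (rule finite_lists_length_le) simp
qed

lemma finite_covered_down [simp]: "finite {k. covered_by k l}"
proof (rule finite_subset)
  show "{k. covered_by k l} \<subseteq> YD (sum_list l - 1)"
    by (auto simp: YD_def sum_list_covered) (simp add: covered_by_def)
qed simp

lemma finite_covered_up [simp]: "finite {k. covered_by l k}"
proof (rule finite_subset)
  show "{k. covered_by l k} \<subseteq> YD (Suc (sum_list l))"
    by (auto simp: YD_def sum_list_covered) (simp add: covered_by_def)
qed simp

section \<open>Standard Young tableaux and the branching rule\<close>

lemma SYT_remove_max_bij:
  assumes bl: "boxes l = insert b (boxes k)" and b: "b \<notin> boxes k"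
    and n: "sum_list l = Suc (sum_list k)" and k: "is_partition k" and l: "is_partition l"
  \<comment> \<open>Tableaux are extensional functions on the boxes, so deleting the box
    \<open>b\<close> means resetting its value to \<open>undefined\<close>.\<close>
  shows "bij_betw (\<lambda>T. T(b := undefined)) {T \<in> SYT l. T b = sum_list l} (SYT k)"
proof (rule bij_betw_byWitness[where f' = "\<lambda>T. T(b := sum_list l)"])
  let ?n = "sum_list l"
  have left: "(i, j) \<in> boxes k" if "(i, j + 1) \<in> boxes k" for i j
    using that by (simp add: mem_boxes)
  have up: "(i, j) \<in> boxes k" if "(i + 1, j) \<in> boxes k" for i j
    using that rowlen_antimono[OF k, of i "i + 1"] by (simp add: mem_boxes)
  show "\<forall>T\<in>{T \<in> SYT l. T b = ?n}. (T(b := undefined))(b := ?n) = T" by auto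
  show "\<forall>T\<in>SYT k. (T(b := ?n))(b := undefined) = T"
    using b by (auto simp: SYT_def fun_eq_iff PiE_def extensional_def)
  show "(\<lambda>T. T(b := undefined)) ` {T \<in> SYT l. T b = ?n} \<subseteq> SYT k"
  proof clarify
    fix T assume T: "T \<in> SYT l" "T b = ?n"
    let ?T = "T(b := undefined)"
    have bij: "bij_betw T (boxes l) {1..?n}" using T by (simp add: SYT_def)
    have "bij_betw T (boxes l - {b}) ({1..?n} - {?n})"
      using bij T(2) bl by (intro bij_betw_DiffI) (auto simp: bij_betw_def)
    also have "boxes l - {b} = boxes k" using bl b by auto
    also have "{1..?n} - {?n} = {1..sum_list k}" using n by auto
    finally have bij': "bij_betw T (boxes k) {1..sum_list k}" .
    hence bij'': "bij_betw ?T (boxes k) {1..sum_list k}"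
      using b by (subst bij_betw_cong[of _ _ T]) auto
    have "?T \<in> boxes k \<rightarrow>\<^sub>E {1..sum_list k}"
      using bij_betw_apply[OF bij''] T bl
      by (fastforce simp: SYT_def PiE_def extensional_def)
    moreover have "?T (i, j) < ?T (i, j + 1)" if "(i, j + 1) \<in> boxes k" for i j
      using left[OF that] that b T bl by (auto simp: SYT_def)
    moreover have "?T (i, j) < ?T (i + 1, j)" if "(i + 1, j) \<in> boxes k" for i j
      using up[OF that] that b T bl by (auto simp: SYT_def)
    ultimately show "?T \<in> SYT k" using bij'' by (simp add: SYT_def)
  qed
  show "(\<lambda>T. T(b := ?n)) ` SYT k \<subseteq> {T \<in> SYT l. T b = ?n}"
  proof clarify
    fix T assume T: "T \<in> SYT k"
    let ?T = "T(b := ?n)"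
    have Tle: "T c \<le> sum_list k" if "c \<in> boxes k" for c
      using T that by (auto simp: SYT_def PiE_def)
    have "bij_betw T (boxes k) {1..sum_list k}" using T by (simp add: SYT_def)
    hence "bij_betw ?T (boxes k) {1..sum_list k}"
      using b by (subst bij_betw_cong[of _ _ T]) auto
    hence "bij_betw ?T (boxes k \<union> {b}) ({1..sum_list k} \<union> {?n})"
      by (intro bij_betw_combine) (auto simp: n)
    moreover have "boxes k \<union> {b} = boxes l" "{1..sum_list k} \<union> {?n} = {1..?n}"
      using bl n by auto
    ultimately have bij: "bij_betw ?T (boxes l) {1..?n}" by simp
    have "?T \<in> boxes l \<rightarrow>\<^sub>E {1..?n}"
      using bij_betw_apply[OF bij] T bl
      by (fastforce simp: SYT_def PiE_def extensional_def)
    moreover have "?T (i, j) < ?T (i, j + 1)" if m: "(i, j + 1) \<in> boxes l" for i j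
    proof (cases "(i, j + 1) = b")
      case True
      have "(i, j) \<in> boxes l" using m by (simp add: mem_boxes)
      hence "(i, j) \<in> boxes k" using bl True by auto
      thus ?thesis using True Tle[of "(i, j)"] n by auto
    next
      case False
      hence "(i, j + 1) \<in> boxes k" using bl m by auto
      moreover from left[OF this] have "(i, j) \<noteq> b" using b by auto
      ultimately show ?thesis using T False by (auto simp: SYT_def)
    qed
    moreover have "?T (i, j) < ?T (i + 1, j)" if m: "(i + 1, j) \<in> boxes l" for i j
    proof (cases "(i + 1, j) = b")
      case True
      have "(i, j) \<in> boxes l"
        using m rowlen_antimono[OF l, of i "i + 1"] by (simp add: mem_boxes)
      hence "(i, j) \<in> boxes k" using bl True by auto
      thus ?thesis using True Tle[of "(i, j)"] n by auto
    next
      case False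
      hence "(i + 1, j) \<in> boxes k" using bl m by auto
      moreover from up[OF this] have "(i, j) \<noteq> b" using b by auto
      ultimately show ?thesis using T False by (auto simp: SYT_def)
    qed
    ultimately show "?T \<in> SYT l \<and> ?T b = ?n" using bij by (simp add: SYT_def)
  qed
qed


lemma finite_SYT [simp]: "finite (SYT l)"
  by (rule finite_subset[of _ "boxes l \<rightarrow>\<^sub>E {1..sum_list l}"])
    (auto simp: SYT_def intro: finite_PiE)

lemma dimY_Nil [simp]: "dimY [] = 1"
proof -
  have "boxes [] = {}" by (auto simp: boxes_def)
  hence "SYT [] = {\<lambda>_. undefined}"
    by (auto simp: SYT_def bij_betw_def)
  thus ?thesis by (simp add: dimY_def)
qed

text \<open>Branching rule: the largest entry sits in a removable corner, and deleting it leaves a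
  tableau of a diagram covered by \<open>l\<close>.\<close>

lemma dimY_rec:
  assumes l: "is_partition l" and ne: "l \<noteq> []"
  shows "dimY l = (\<Sum>k | covered_by k l. dimY k)"
proof -
  define bx where "bx k = (SOME b. boxes l = insert b (boxes k) \<and> b \<notin> boxes k)" for k
  have bx: "boxes l = insert (bx k) (boxes k) \<and> bx k \<notin> boxes k" if "covered_by k l" for k
  proof -
    obtain i where "rowlen l = (rowlen k)(i := Suc (rowlen k i))"
      using \<open>covered_by k l\<close> by (auto simp: covered_by_iff)
    from boxes_diff_upd(1,2)[OF this] show ?thesis
      unfolding bx_def by (intro someI[where P = "\<lambda>b. boxes l = insert b (boxes k) \<and> b \<notin> boxes k"] conjI)
  qed
  define S where "S k = {T \<in> SYT l. T (bx k) = sum_list l}" for k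
  have n: "sum_list l \<ge> 1"
    using length_le_sum_list[OF l] ne by (cases l) auto
  have SU: "SYT l = (\<Union>k\<in>{k. covered_by k l}. S k)"
  proof (intro equalityI subsetI)
    fix T assume T: "T \<in> SYT l"
    hence bij: "bij_betw T (boxes l) {1..sum_list l}" by (simp add: SYT_def)
    have "sum_list l \<in> T ` boxes l" using bij n by (auto simp: bij_betw_def)
    then obtain i j where ij: "(i, j) \<in> boxes l" "T (i, j) = sum_list l" by auto
    have le: "T c \<le> sum_list l" if "c \<in> boxes l" for c
      using bij_betw_apply[OF bij that] by auto
    have "(i, j + 1) \<notin> boxes l"
    proof
      assume "(i, j + 1) \<in> boxes l"
      hence "T (i, j) < T (i, j + 1)" "T (i, j + 1) \<le> sum_list l"
        using T le by (auto simp: SYT_def)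
      thus False using ij by simp
    qed
    moreover have "(i + 1, j) \<notin> boxes l"
    proof
      assume "(i + 1, j) \<in> boxes l"
      hence "T (i, j) < T (i + 1, j)" "T (i + 1, j) \<le> sum_list l"
        using T le by (auto simp: SYT_def)
      thus False using ij by simp
    qed
    ultimately have r: "rowlen l i = j + 1" "rowlen l (Suc i) \<le> j"
      using ij(1) by (auto simp: mem_boxes)
    define k where "k = of_rows ((rowlen l)(i := rowlen l i - 1))"
    have k: "is_partition k" "rowlen k = (rowlen l)(i := rowlen l i - 1)"
      unfolding k_def using of_rows_dec[OF l, of i] r by auto
    have lk: "rowlen l = (rowlen k)(i := Suc (rowlen k i))" using k r by auto
    have cov: "covered_by k l" using k l lk by (auto simp: covered_by_iff)
    have "boxes l = insert (i, j) (boxes k)" "(i, j) \<notin> boxes k"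
      using boxes_diff_upd(1,2)[OF lk] k r by auto
    hence "bx k = (i, j)" using bx[OF cov] by blast
    hence "T \<in> S k" using T ij by (simp add: S_def)
    thus "T \<in> (\<Union>k\<in>{k. covered_by k l}. S k)" using cov by blast
  qed (auto simp: S_def)
  have "card (SYT l) = (\<Sum>k | covered_by k l. card (S k))"
    unfolding SU
  proof (rule card_UN_disjoint)
    show "\<forall>i\<in>{k. covered_by k l}. \<forall>j\<in>{k. covered_by k l}. i \<noteq> j \<longrightarrow> S i \<inter> S j = {}"
    proof (intro ballI impI, rule ccontr)
      fix k k' assume k: "k \<in> {k. covered_by k l}" "k' \<in> {k. covered_by k l}" "k \<noteq> k'"
        and "S k \<inter> S k' \<noteq> {}"
      then obtain T where "T \<in> S k" "T \<in> S k'" by blast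
      hence T: "T \<in> SYT l" "T (bx k) = T (bx k')" by (auto simp: S_def)
      have "inj_on T (boxes l)" using T by (auto simp: SYT_def bij_betw_def)
      moreover have "bx k \<in> boxes l" "bx k' \<in> boxes l" using bx k by blast+
      ultimately have "bx k = bx k'" using T(2) by (auto dest: inj_onD)
      moreover have "boxes k = boxes l - {bx k}" "boxes k' = boxes l - {bx k'}" using bx k by blast+
      ultimately have "boxes k = boxes k'" by simp
      hence "rowlen k = rowlen k'"
        by (metis (no_types, opaque_lifting) ext linorder_neqE_nat mem_boxes less_irrefl)
      thus False using k rowlen_inj by (auto simp: covered_by_def)
    qed
  qed (auto simp: S_def)
  also have "\<dots> = (\<Sum>k | covered_by k l. card (SYT k))"
  proof (rule sum.cong)
    fix k assume "k \<in> {k. covered_by k l}"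
    hence c: "covered_by k l" by simp
    have "bij_betw (\<lambda>T. T(bx k := undefined)) (S k) (SYT k)"
      unfolding S_def using bx[OF c] sum_list_covered[OF c] c l
      by (intro SYT_remove_max_bij) (auto simp: covered_by_def)
    thus "card (S k) = card (SYT k)" by (rule bij_betw_same_card)
  qed simp
  finally show ?thesis by (simp add: dimY_def)
qed

lemma dimY_pos: "is_partition l \<Longrightarrow> dimY l > 0"
proof (induction "sum_list l" arbitrary: l rule: less_induct)
  case less
  show ?case
  proof (cases "l = []")
    case False
    define i where "i = length l - 1"
    have "rowlen l (Suc i) < rowlen l i"
      using False less.prems rowlen_pos_iff[of l i] by (auto simp: i_def rowlen_eq_0)
    note d = of_rows_dec[OF less.prems this]
    define k where "k = of_rows ((rowlen l)(i := rowlen l i - 1))"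
    have c: "covered_by k l"
      using d less.prems \<open>rowlen l (Suc i) < rowlen l i\<close>
      unfolding k_def covered_by_iff by (auto intro!: exI[of _ i])
    have "dimY k > 0"
      using less.hyps[of k] c by (auto simp: sum_list_covered covered_by_def)
    moreover have "dimY k \<le> dimY l"
      unfolding dimY_rec[OF less.prems False] using c
      by (intro member_le_sum) auto
    ultimately show ?thesis by simp
  qed simp
qed

section \<open>Aitken's determinant and the up-down commutation relation\<close>

text \<open>The values of 1/Gamma(k + 1) at integers. The value 0 at negative \<open>k\<close> makes
  the recursion \<open>ifact_pred\<close> valid for every integer, so determinants can be
  manipulated without positivity conditions.\<close>

definition ifact :: "int \<Rightarrow> real" where
  "ifact k = (if k < 0 then 0 else 1 / fact (nat k))"

lemma ifact_pred: "ifact (k - 1) = of_int k * ifact k"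
proof (cases "k > 0")
  case True
  hence "nat k = Suc (nat (k - 1))" by simp
  hence "fact (nat k) = real_of_int k * fact (nat (k - 1))"
    using True by (simp add: fact_Suc)
  thus ?thesis using True by (simp add: ifact_def field_simps)
qed (auto simp: ifact_def)

text \<open>Leibniz form, because the two shift identities below hold separately for each
  permutation. The arguments are arbitrary integer vectors, since shifting one entry need not give a
  diagram.\<close>

definition fdet :: "nat \<Rightarrow> (nat \<Rightarrow> int) \<Rightarrow> (nat \<Rightarrow> int) \<Rightarrow> real" where
  "fdet N x y = (\<Sum>p | p permutes {..<N}. of_int (sign p) * (\<Prod>i<N. ifact (x i - y (p i))))"

lemma fdet_eq_det:
  "fdet N x y = Determinant.det (Matrix.mat N N (\<lambda>(i, j). ifact (x i - y j)))"
proof -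
  have "(\<Prod>i<N. Matrix.mat N N (\<lambda>(i, j). ifact (x i - y j)) $$ (i, p i)) =
        (\<Prod>i<N. ifact (x i - y (p i)))" if "p permutes {..<N}" for p
    using permutes_in_image[OF that] by (intro prod.cong) auto
  thus ?thesis
    by (subst det_def'[of _ N]) (auto simp: fdet_def atLeast0LessThan)
qed

lemma prod_upd_factor:
  fixes f :: "nat \<Rightarrow> 'a :: comm_semiring_1"
  assumes "i < N"
  shows "(\<Prod>k<N. if k = i then c * f k else f k) = c * (\<Prod>k<N. f k)"
proof -
  have "(\<Prod>k<N. if k = i then c * f k else f k) = (\<Prod>k<N. (if k = i then c else 1) * f k)"
    by (intro prod.cong) auto
  thus ?thesis using assms by (simp add: prod.distrib)
qed

text \<open>In the term of a permutation \<open>p\<close>, lowering \<open>x i\<close> multiplies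
  the product by \<open>x i - y (p i)\<close>; the sum of these factors over \<open>i\<close> is
  independent of \<open>p\<close>.\<close>

lemma fdet_lower_sum:
  "(\<Sum>i<N. fdet N (x(i := x i - 1)) y) = of_int ((\<Sum>i<N. x i) - (\<Sum>i<N. y i)) * fdet N x y"
proof -
  have *: "(\<Sum>i<N. \<Prod>k<N. ifact ((x(i := x i - 1)) k - y (p k))) =
        of_int ((\<Sum>i<N. x i) - (\<Sum>i<N. y i)) * (\<Prod>k<N. ifact (x k - y (p k)))"
    if p: "p permutes {..<N}" for p
  proof -
    have "(\<Sum>i<N. \<Prod>k<N. ifact ((x(i := x i - 1)) k - y (p k))) =
          (\<Sum>i<N. of_int (x i - y (p i)) * (\<Prod>k<N. ifact (x k - y (p k))))"
    proof (rule sum.cong)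
      fix i assume i: "i \<in> {..<N}"
      have "(\<Prod>k<N. ifact ((x(i := x i - 1)) k - y (p k))) =
          (\<Prod>k<N. if k = i then of_int (x i - y (p i)) * ifact (x k - y (p k)) else ifact (x k - y (p k)))"
        using ifact_pred[of "x i - y (p i)"]
        by (intro prod.cong) (auto simp: algebra_simps)
      also have "\<dots> = of_int (x i - y (p i)) * (\<Prod>k<N. ifact (x k - y (p k)))"
        using i by (intro prod_upd_factor) auto
      finally show "(\<Prod>k<N. ifact ((x(i := x i - 1)) k - y (p k))) =
          of_int (x i - y (p i)) * (\<Prod>k<N. ifact (x k - y (p k)))" .
    qed simp
    also have "\<dots> = of_int (\<Sum>i<N. x i - y (p i)) * (\<Prod>k<N. ifact (x k - y (p k)))"
      by (simp add: sum_distrib_right)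
    also have "(\<Sum>i<N. x i - y (p i)) = (\<Sum>i<N. x i) - (\<Sum>i<N. y i)"
      using sum.permute[OF p, of y] by (simp add: sum_subtractf o_def)
    finally show ?thesis .
  qed
  have "(\<Sum>i<N. fdet N (x(i := x i - 1)) y) =
      (\<Sum>p | p permutes {..<N}. of_int (sign p) * (\<Sum>i<N. \<Prod>k<N. ifact ((x(i := x i - 1)) k - y (p k))))"
    unfolding fdet_def by (subst sum.swap) (simp add: sum_distrib_left)
  also have "\<dots> = (\<Sum>p | p permutes {..<N}. of_int (sign p) *
       (of_int ((\<Sum>i<N. x i) - (\<Sum>i<N. y i)) * (\<Prod>k<N. ifact (x k - y (p k)))))"
    by (intro sum.cong refl) (simp only: mem_Collect_eq *)
  also have "\<dots> = of_int ((\<Sum>i<N. x i) - (\<Sum>i<N. y i)) * fdet N x y"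
    by (simp only: fdet_def sum_distrib_left mult.left_commute)
  finally show ?thesis .
qed

text \<open>Equals (z + c)(z' + c) for \<open>u\<close> = z + z' and \<open>t\<close> = zz'; both
  coefficients are real, which keeps the algebra real.\<close>

definition wt :: "real \<Rightarrow> real \<Rightarrow> real \<Rightarrow> real" where
  "wt u t c = c\<^sup>2 + u * c + t"

lemma fdet_raise_lower:
  "(\<Sum>i<N. wt u t (of_int (x i)) * fdet N (x(i := x i + 1)) y)
   - (\<Sum>j<N. wt u t (of_int (y j - 1)) * fdet N x (y(j := y j - 1))) =
   ((\<Sum>i<N. of_int (x i)) + (\<Sum>i<N. of_int (y i)) + real N * (u - 1)) * fdet N x y"
proof -
  let ?C = "(\<Sum>i<N. real_of_int (x i)) + (\<Sum>i<N. real_of_int (y i)) + real N * (u - 1)"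
  have *: "(\<Sum>i<N. wt u t (of_int (x i)) * (\<Prod>k<N. ifact ((x(i := x i + 1)) k - y (p k))))
     - (\<Sum>j<N. wt u t (of_int (y j - 1)) * (\<Prod>k<N. ifact (x k - (y(j := y j - 1)) (p k)))) =
     ?C * (\<Prod>k<N. ifact (x k - y (p k)))"
    if p: "p permutes {..<N}" for p
  proof -
    let ?Q = "\<lambda>i. \<Prod>k<N. if k = i then ifact (x i - y (p i) + 1) else ifact (x k - y (p k))"
    have inj: "p i = p j \<longleftrightarrow> i = j" for i j
      using permutes_inj[OF p] by (auto dest: injD)
    have A: "(\<Prod>k<N. ifact ((x(i := x i + 1)) k - y (p k))) = ?Q i" for i
      by (intro prod.cong) (auto simp: algebra_simps)
    have B: "(\<Prod>k<N. ifact (x k - (y(p i := y (p i) - 1)) (p k))) = ?Q i" for i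
      by (intro prod.cong) (auto simp: algebra_simps inj)
    \<comment> \<open>Running through the columns along \<open>p\<close> pairs column
      \<open>p i\<close> with row \<open>i\<close>: lowering that column and raising that row
      produce the same product \<open>?Q i\<close>.\<close>
    have "(\<Sum>j<N. wt u t (of_int (y j - 1)) * (\<Prod>k<N. ifact (x k - (y(j := y j - 1)) (p k)))) =
       (\<Sum>i<N. wt u t (of_int (y (p i) - 1)) * (\<Prod>k<N. ifact (x k - (y(p i := y (p i) - 1)) (p k))))"
      by (subst sum.permute[OF p]) (simp add: o_def del: fun_upd_apply)
    also have "\<dots> = (\<Sum>i<N. wt u t (of_int (y (p i) - 1)) * ?Q i)"
      by (simp only: B)
    finally have "(\<Sum>i<N. wt u t (of_int (x i)) * (\<Prod>k<N. ifact ((x(i := x i + 1)) k - y (p k))))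
     - (\<Sum>j<N. wt u t (of_int (y j - 1)) * (\<Prod>k<N. ifact (x k - (y(j := y j - 1)) (p k)))) =
      (\<Sum>i<N. (wt u t (of_int (x i)) - wt u t (of_int (y (p i) - 1))) * ?Q i)"
      by (simp only: A sum_subtractf left_diff_distrib)
    also have "\<dots> = (\<Sum>i<N. (of_int (x i) + of_int (y (p i)) + (u - 1)) * (\<Prod>k<N. ifact (x k - y (p k))))"
    proof (rule sum.cong)
      fix i assume i: "i \<in> {..<N}"
      have "(\<Prod>k<N. ifact (x k - y (p k))) =
         (\<Prod>k<N. if k = i then of_int (x i - y (p i) + 1) * (if k = i then ifact (x i - y (p i) + 1) else ifact (x k - y (p k)))
               else (if k = i then ifact (x i - y (p i) + 1) else ifact (x k - y (p k))))"
        using ifact_pred[of "x i - y (p i) + 1"] by (intro prod.cong) auto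
      also have "\<dots> = of_int (x i - y (p i) + 1) * ?Q i"
        using i by (intro prod_upd_factor) auto
      finally have Q: "(\<Prod>k<N. ifact (x k - y (p k))) = of_int (x i - y (p i) + 1) * ?Q i" .
      \<comment> \<open>The factor \<open>x i - y (p i) + 1\<close> of this difference is absorbed
        by \<open>Q\<close>, which restores the unshifted product.\<close>
      have w: "wt u t (of_int (x i)) - wt u t (of_int (y (p i) - 1)) =
         (of_int (x i) + of_int (y (p i)) + (u - 1)) * of_int (x i - y (p i) + 1)"
        by (simp add: wt_def power2_eq_square algebra_simps)
      show "(wt u t (of_int (x i)) - wt u t (of_int (y (p i) - 1))) * ?Q i =
         (of_int (x i) + of_int (y (p i)) + (u - 1)) * (\<Prod>k<N. ifact (x k - y (p k)))"
        by (simp only: w Q mult.assoc)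
    qed simp
    also have "\<dots> = (\<Sum>i<N. of_int (x i) + of_int (y (p i)) + (u - 1)) * (\<Prod>k<N. ifact (x k - y (p k)))"
      by (simp add: sum_distrib_right)
    also have "(\<Sum>i<N. of_int (x i) + of_int (y (p i)) + (u - 1)) = ?C"
      using sum.permute[OF p, of "\<lambda>i. real_of_int (y i)"] by (simp add: sum.distrib o_def)
    finally show ?thesis .
  qed
  have "(\<Sum>i<N. wt u t (of_int (x i)) * fdet N (x(i := x i + 1)) y)
   - (\<Sum>j<N. wt u t (of_int (y j - 1)) * fdet N x (y(j := y j - 1))) =
     (\<Sum>p | p permutes {..<N}. of_int (sign p) *
       ((\<Sum>i<N. wt u t (of_int (x i)) * (\<Prod>k<N. ifact ((x(i := x i + 1)) k - y (p k))))
     - (\<Sum>j<N. wt u t (of_int (y j - 1)) * (\<Prod>k<N. ifact (x k - (y(j := y j - 1)) (p k))))))"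
  proof -
    have sw: "(\<Sum>i<N. c i * (\<Sum>p | p permutes {..<N}. of_int (sign p) * f i p)) =
      (\<Sum>p | p permutes {..<N}. of_int (sign p) * (\<Sum>i<N. c i * f i p))" for c and f :: "nat \<Rightarrow> _ \<Rightarrow> real"
      unfolding sum_distrib_left by (subst sum.swap) (simp only: mult.left_commute)
    show ?thesis
      unfolding fdet_def sw by (simp only: sum_subtractf right_diff_distrib)
  qed
  also have "\<dots> = (\<Sum>p | p permutes {..<N}. of_int (sign p) * (?C * (\<Prod>k<N. ifact (x k - y (p k)))))"
    by (intro sum.cong refl) (simp only: mem_Collect_eq *)
  also have "\<dots> = ?C * fdet N x y"
    by (simp only: fdet_def sum_distrib_left mult.left_commute)
  finally show ?thesis .
qed

lemma fdet_eq_rows: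
  assumes "i < N" "k < N" "i \<noteq> k" "x i = x k"
  shows "fdet N x y = 0"
  unfolding fdet_eq_det
  by (rule det_identical_rows[of _ N i k]) (use assms in auto)

lemma fdet_eq_cols:
  assumes "i < N" "k < N" "i \<noteq> k" "y i = y k"
  shows "fdet N x y = 0"
  unfolding fdet_eq_det
  by (rule det_identical_columns[of _ N i k]) (use assms in auto)

lemma fdet_zero_row:
  assumes "i < N" "\<And>j. j < N \<Longrightarrow> x i < y j"
  shows "fdet N x y = 0"
  unfolding fdet_def
proof (intro sum.neutral ballI)
  fix p assume "p \<in> {p. p permutes {..<N}}"
  hence "p i < N" using assms(1) permutes_in_image by fastforce
  hence "ifact (x i - y (p i)) = 0" using assms(2) by (auto simp: ifact_def)
  hence "(\<Prod>i<N. ifact (x i - y (p i))) = 0" using assms(1) by auto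
  thus "of_int (sign p) * (\<Prod>i<N. ifact (x i - y (p i))) = 0" by simp
qed

text \<open>Only the corner entry of the last row contributes, and it is 1/0! before the change and
  1/1! after it.\<close>

lemma fdet_lower_last:
  assumes "x N = y N" "\<And>j. j < N \<Longrightarrow> x N < y j"
  shows "fdet (Suc N) x (y(N := y N - 1)) = fdet (Suc N) x y"
  unfolding fdet_def
proof (intro sum.cong refl, goal_cases)
  case (1 p)
  hence p: "p permutes {..<Suc N}" by simp
  have "(\<Prod>i<Suc N. ifact (x i - (y(N := y N - 1)) (p i))) = (\<Prod>i<Suc N. ifact (x i - y (p i)))"
  proof (cases "p N = N")
    case True
    hence "p i \<noteq> N" if "i < N" for i
      using that permutes_inj[OF p] by (metis injD less_irrefl)
    hence "(\<Prod>i<N. ifact (x i - (y(N := y N - 1)) (p i))) = (\<Prod>i<N. ifact (x i - y (p i)))"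
      by (intro prod.cong) auto
    moreover have "ifact (x N - (y(N := y N - 1)) (p N)) = ifact (x N - y (p N))"
      using True assms(1) by (simp add: ifact_def)
    ultimately show ?thesis by (simp only: prod.lessThan_Suc)
  next
    case False
    hence "p N < N" using p permutes_in_image[OF p, of N] by auto
    hence "ifact (x N - y (p N)) = 0" using assms(2) by (auto simp: ifact_def)
    thus ?thesis using False by simp
  qed
  thus ?case by simp
qed

lemma fdet_triangular:
  assumes "\<And>i. i < N \<Longrightarrow> x i = y i" "\<And>i j. j < i \<Longrightarrow> i < N \<Longrightarrow> x i < y j"
  shows "fdet N x y = 1"
proof -
  have "Determinant.det (Matrix.mat N N (\<lambda>(i, j). ifact (x i - y j))) =
     prod_list (diag_mat (Matrix.mat N N (\<lambda>(i, j). ifact (x i - y j))))"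
    using assms(2) by (intro det_upper_triangular[of _ N]) (auto simp: ifact_def)
  also have "\<dots> = 1"
    unfolding prod_list_diag_prod
    by (rule prod.neutral) (auto simp: ifact_def assms(1))
  finally show ?thesis by (simp add: fdet_eq_det)
qed

definition xs :: "nat list \<Rightarrow> nat \<Rightarrow> int" where
  "xs l i = int (rowlen l i) - int i"

lemma sum_xs: "length l \<le> N \<Longrightarrow> (\<Sum>i<N. xs l i) = int (sum_list l) - (\<Sum>i<N. int i)"
  by (simp add: xs_def sum_subtractf flip: sum_rowlen[of l N])

lemma xs_ge: "- int i \<le> xs l i"
  by (simp add: xs_def)

text \<open>A row that cannot be shortened gives determinant zero: lowered, it coincides with the
  next row, or, if it is the last row, which is empty by \<open>length l < N\<close>, it drops below
  every column.\<close>

lemma sum_fdet_covered: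
  assumes l: "is_partition l" and N: "length l < N"
  shows "(\<Sum>k | covered_by k l. fdet N (xs k) (xs m)) =
     (\<Sum>i<N. fdet N ((xs l)(i := xs l i - 1)) (xs m))"
proof -
  let ?I = "{i. i < N \<and> rowlen l (Suc i) < rowlen l i}"
  have "(\<Sum>k | covered_by k l. fdet N (xs k) (xs m)) =
     (\<Sum>i\<in>?I. fdet N (xs (of_rows ((rowlen l)(i := rowlen l i - 1)))) (xs m))"
    using N by (intro sum_covered_down[OF l]) simp
  also have "\<dots> = (\<Sum>i\<in>?I. fdet N ((xs l)(i := xs l i - 1)) (xs m))"
  proof (rule sum.cong)
    fix i assume i: "i \<in> ?I"
    hence "xs (of_rows ((rowlen l)(i := rowlen l i - 1))) = (xs l)(i := xs l i - 1)"
      using of_rows_dec(2)[OF l, of i] by (auto simp: xs_def fun_eq_iff)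
    thus "fdet N (xs (of_rows ((rowlen l)(i := rowlen l i - 1)))) (xs m) =
        fdet N ((xs l)(i := xs l i - 1)) (xs m)" by simp
  qed simp
  also have "\<dots> = (\<Sum>i<N. fdet N ((xs l)(i := xs l i - 1)) (xs m))"
  proof (rule sum.mono_neutral_left)
    show "\<forall>i\<in>{..<N} - ?I. fdet N ((xs l)(i := xs l i - 1)) (xs m) = 0"
    proof
      fix i assume "i \<in> {..<N} - ?I"
      hence i: "i < N" "rowlen l (Suc i) = rowlen l i"
        using rowlen_antimono[OF l, of i "Suc i"] by auto
      show "fdet N ((xs l)(i := xs l i - 1)) (xs m) = 0"
      proof (cases "Suc i < N")
        case True
        show ?thesis
          by (rule fdet_eq_rows[of i _ "Suc i"]) (use i True in \<open>auto simp: xs_def\<close>)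
      next
        case False
        hence "N = Suc i" using i by simp
        hence "rowlen l i = 0" using N by (auto simp: rowlen_eq_0)
        thus ?thesis
        proof (intro fdet_zero_row[of i])
          fix j assume "j < N"
          thus "((xs l)(i := xs l i - 1)) i < xs m j"
            using xs_ge[of j m] \<open>rowlen l i = 0\<close> \<open>N = Suc i\<close> by (simp add: xs_def)
        qed (use i in simp)
      qed
    qed
  qed auto
  finally show ?thesis .
qed

lemma sum_fdet_down:
  assumes l: "is_partition l" and N: "length l < N" "length m \<le> N"
  shows "(\<Sum>k | covered_by k l. fdet N (xs k) (xs m)) =
     (real (sum_list l) - real (sum_list m)) * fdet N (xs l) (xs m)"
proof -
  have "real_of_int ((\<Sum>i<N. xs l i) - (\<Sum>i<N. xs m i)) = real (sum_list l) - real (sum_list m)"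
    using sum_xs[of l N] sum_xs[of m N] N by simp
  thus ?thesis unfolding sum_fdet_covered[OF l N(1)] fdet_lower_sum by simp
qed

lemma covered_by_length: "covered_by k l \<Longrightarrow> length k \<le> length l"
proof (rule ccontr)
  assume c: "covered_by k l" and "\<not> length k \<le> length l"
  hence "rowlen k (length l) > 0" "rowlen l (length l) = 0"
    using rowlen_pos_iff[of k] by (auto simp: covered_by_def rowlen_eq_0)
  moreover have "rowlen k (length l) \<le> rowlen l (length l)"
    using c by (auto simp: covered_by_iff)
  ultimately show False by simp
qed

text \<open>Both sides satisfy the branching recursion and agree at the empty diagram.\<close>

lemma dimY_eq_fdet:
  assumes "is_partition l" "length l < N"
  shows "real (dimY l) = fact (sum_list l) * fdet N (xs l) (xs [])"
  using assms
proof (induction "sum_list l" arbitrary: l rule: less_induct)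
  case less
  show ?case
  proof (cases "l = []")
    case True
    thus ?thesis by (simp add: fdet_triangular xs_def rowlen_def)
  next
    case False
    have n: "sum_list l \<ge> 1"
      using length_le_sum_list[OF less.prems(1)] False by (cases l) auto
    have "real (dimY l) = (\<Sum>k | covered_by k l. real (dimY k))"
      using dimY_rec[OF less.prems(1) False] by simp
    also have "\<dots> = (\<Sum>k | covered_by k l. fact (sum_list l - 1) * fdet N (xs k) (xs []))"
    proof (rule sum.cong)
      fix k assume "k \<in> {k. covered_by k l}"
      hence k: "covered_by k l" by simp
      thus "real (dimY k) = fact (sum_list l - 1) * fdet N (xs k) (xs [])"
        using less.hyps[of k] less.prems covered_by_length[OF k]
        by (auto simp: sum_list_covered covered_by_def)
    qed simp
    also have "\<dots> = fact (sum_list l - 1) * (real (sum_list l) * fdet N (xs l) (xs []))"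
      using sum_fdet_down[of l N "[]"] less.prems by (simp flip: sum_distrib_left)
    also have "\<dots> = fact (sum_list l) * fdet N (xs l) (xs [])"
      using n by (simp add: fact_reduce[of "sum_list l"])
    finally show ?thesis .
  qed
qed

text \<open>The product of (z)_B and (z')_B in real form.\<close>

definition bw :: "real \<Rightarrow> real \<Rightarrow> (nat \<times> nat) set \<Rightarrow> real" where
  "bw u t B = (\<Prod>(i, j)\<in>B. wt u t (real j - real i))"

lemma bw_covered: "covered_by k l \<Longrightarrow> bw u t (boxes l) = bw u t (boxes k) * bw u t (boxes l - boxes k)"
  unfolding bw_def covered_by_def
  by (subst prod.subset_diff[of "boxes k"]) (auto simp: mult.commute)

text \<open>A forbidden row has \<open>xs l i + 1 = xs l (i - 1)\<close>, so raising it produces two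
  equal rows.\<close>

lemma sum_fdet_up:
  assumes l: "is_partition l" and N: "length l < N" 
  shows "(\<Sum>k | covered_by l k. bw u t (boxes k - boxes l) * fdet N (xs k) (xs m)) =
     (\<Sum>i<N. wt u t (of_int (xs l i)) * fdet N ((xs l)(i := xs l i + 1)) (xs m))"
proof -
  let ?I = "{i. i < N \<and> (i = 0 \<or> rowlen l i < rowlen l (i - 1))}"
  let ?f = "\<lambda>i. of_rows ((rowlen l)(i := rowlen l i + 1))"
  have "(\<Sum>k | covered_by l k. bw u t (boxes k - boxes l) * fdet N (xs k) (xs m)) =
     (\<Sum>i\<in>?I. bw u t (boxes (?f i) - boxes l) * fdet N (xs (?f i)) (xs m))"
    by (rule sum_covered_up[OF l N])
  also have "\<dots> = (\<Sum>i\<in>?I. wt u t (of_int (xs l i)) * fdet N ((xs l)(i := xs l i + 1)) (xs m))"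
  proof (rule sum.cong)
    fix i assume i: "i \<in> ?I"
    hence r: "rowlen (?f i) = (rowlen l)(i := rowlen l i + 1)"
      using of_rows_inc(2)[OF l, of i] by blast
    hence "xs (?f i) = (xs l)(i := xs l i + 1)"
      by (auto simp: xs_def fun_eq_iff)
    moreover have "boxes (?f i) - boxes l = {(i, rowlen l i)}"
      using r by (intro boxes_diff_upd(3)) simp
    ultimately show "bw u t (boxes (?f i) - boxes l) * fdet N (xs (?f i)) (xs m) =
       wt u t (of_int (xs l i)) * fdet N ((xs l)(i := xs l i + 1)) (xs m)"
      by (simp add: bw_def xs_def)
  qed simp
  also have "\<dots> = (\<Sum>i<N. wt u t (of_int (xs l i)) * fdet N ((xs l)(i := xs l i + 1)) (xs m))"
  proof (rule sum.mono_neutral_left)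
    show "\<forall>i\<in>{..<N} - ?I. wt u t (of_int (xs l i)) * fdet N ((xs l)(i := xs l i + 1)) (xs m) = 0"
    proof
      fix i assume "i \<in> {..<N} - ?I"
      then obtain j where i: "i = Suc j" "Suc j < N" and r: "rowlen l (Suc j) = rowlen l j"
        using rowlen_antimono[OF l, of "i - 1" "i"] by (cases i) auto
      have "fdet N ((xs l)(i := xs l i + 1)) (xs m) = 0"
        by (rule fdet_eq_rows[of i _ j]) (use i r in \<open>auto simp: xs_def\<close>)
      thus "wt u t (of_int (xs l i)) * fdet N ((xs l)(i := xs l i + 1)) (xs m) = 0" by simp
    qed
  qed auto
  finally show ?thesis .
qed

text \<open>A forbidden lowering in one of the first \<open>N\<close> columns makes that column
  coincide with the next one, which exists because the determinant has size
  \<open>Suc N\<close>.\<close>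

lemma sum_fdet_down_second:
  assumes m: "is_partition m" and N: "length l \<le> N" "length m \<le> N" 
  shows "(\<Sum>k | covered_by k m. bw u t (boxes m - boxes k) * fdet (Suc N) (xs l) (xs k)) =
     (\<Sum>j<N. wt u t (of_int (xs m j - 1)) * fdet (Suc N) (xs l) ((xs m)(j := xs m j - 1)))"
proof -
  let ?I = "{i. i < N \<and> rowlen m (Suc i) < rowlen m i}"
  let ?f = "\<lambda>i. of_rows ((rowlen m)(i := rowlen m i - 1))"
  have "(\<Sum>k | covered_by k m. bw u t (boxes m - boxes k) * fdet (Suc N) (xs l) (xs k)) =
     (\<Sum>i\<in>?I. bw u t (boxes m - boxes (?f i)) * fdet (Suc N) (xs l) (xs (?f i)))"
    by (rule sum_covered_down[OF m N(2)])
  also have "\<dots> = (\<Sum>j\<in>?I. wt u t (of_int (xs m j - 1)) * fdet (Suc N) (xs l) ((xs m)(j := xs m j - 1)))"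
  proof (rule sum.cong)
    fix i assume i: "i \<in> ?I"
    hence r: "rowlen (?f i) = (rowlen m)(i := rowlen m i - 1)"
      using of_rows_dec(2)[OF m, of i] by blast
    hence "xs (?f i) = (xs m)(i := xs m i - 1)"
      using i by (auto simp: xs_def fun_eq_iff)
    moreover have "boxes m - boxes (?f i) = {(i, rowlen m i - 1)}"
      using r i boxes_diff_upd(3)[of m "?f i" i] by auto
    ultimately show "bw u t (boxes m - boxes (?f i)) * fdet (Suc N) (xs l) (xs (?f i)) =
       wt u t (of_int (xs m i - 1)) * fdet (Suc N) (xs l) ((xs m)(i := xs m i - 1))"
      using i by (auto simp: bw_def xs_def of_nat_diff algebra_simps)
  qed simp
  also have "\<dots> = (\<Sum>j<N. wt u t (of_int (xs m j - 1)) * fdet (Suc N) (xs l) ((xs m)(j := xs m j - 1)))"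
  proof (rule sum.mono_neutral_left)
    show "\<forall>i\<in>{..<N} - ?I. wt u t (of_int (xs m i - 1)) * fdet (Suc N) (xs l) ((xs m)(i := xs m i - 1)) = 0"
    proof
      fix i assume "i \<in> {..<N} - ?I"
      hence i: "i < N" "rowlen m (Suc i) = rowlen m i"
        using rowlen_antimono[OF m, of i "Suc i"] by auto
      have "fdet (Suc N) (xs l) ((xs m)(i := xs m i - 1)) = 0"
        by (rule fdet_eq_cols[of i _ "Suc i"]) (use i in \<open>auto simp: xs_def\<close>)
      thus "wt u t (of_int (xs m i - 1)) * fdet (Suc N) (xs l) ((xs m)(i := xs m i - 1)) = 0" by simp
    qed
  qed auto
  finally show ?thesis .
qed

lemma sum_of_nat_lessThan: "(\<Sum>i<N. real i) = real N * (real N - 1) / 2"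
  by (induction N) (auto simp: field_simps)

text \<open>Lowering the last, empty row of \<open>m\<close> is the one forbidden move that does not vanish; it
  contributes the weight of the content \<open>-N - 1\<close>.\<close>
lemma sum_fdet_commutation:
  assumes l: "is_partition l" and m: "is_partition m" and N: "length l \<le> N" "length m \<le> N" 
  shows "(\<Sum>k | covered_by l k. bw u t (boxes k - boxes l) * fdet (Suc N) (xs k) (xs m)) =
     (\<Sum>k | covered_by k m. bw u t (boxes m - boxes k) * fdet (Suc N) (xs l) (xs k)) +
     (real (sum_list l) + real (sum_list m) + t) * fdet (Suc N) (xs l) (xs m)"
proof -
  have e: "xs l N = - int N" "xs m N = - int N" using N by (auto simp: xs_def rowlen_eq_0)
  have "fdet (Suc N) (xs l) ((xs m)(N := xs m N - 1)) = fdet (Suc N) (xs l) (xs m)"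
  proof (rule fdet_lower_last)
    fix j assume "j < N"
    thus "xs l N < xs m j" using e xs_ge[of j m] by simp
  qed (simp add: e)
  hence last: "(\<Sum>j<Suc N. wt u t (of_int (xs m j - 1)) * fdet (Suc N) (xs l) ((xs m)(j := xs m j - 1))) =
     (\<Sum>k | covered_by k m. bw u t (boxes m - boxes k) * fdet (Suc N) (xs l) (xs k)) +
     wt u t (- real N - 1) * fdet (Suc N) (xs l) (xs m)"
    unfolding sum_fdet_down_second[OF m N] by (simp add: e)
  have s: "(\<Sum>i<Suc N. real_of_int (xs k i)) = real (sum_list k) - (real N + 1) * real N / 2"
    if "length k \<le> N" for k
  proof -
    have "(\<Sum>i<Suc N. real_of_int (xs k i)) = real_of_int (\<Sum>i<Suc N. xs k i)" by simp
    also have "(\<Sum>i<Suc N. xs k i) = int (sum_list k) - (\<Sum>i<Suc N. int i)"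
      using that by (intro sum_xs) simp
    also have "real_of_int \<dots> = real (sum_list k) - (\<Sum>i<Suc N. real i)" by simp
    finally show ?thesis by (simp only: sum_of_nat_lessThan) simp
  qed
  have "(\<Sum>k | covered_by l k. bw u t (boxes k - boxes l) * fdet (Suc N) (xs k) (xs m)) =
     (\<Sum>i<Suc N. wt u t (of_int (xs l i)) * fdet (Suc N) ((xs l)(i := xs l i + 1)) (xs m))"
    using N by (intro sum_fdet_up[OF l]) simp
  also have "\<dots> = (\<Sum>j<Suc N. wt u t (of_int (xs m j - 1)) * fdet (Suc N) (xs l) ((xs m)(j := xs m j - 1))) +
     ((\<Sum>i<Suc N. of_int (xs l i)) + (\<Sum>i<Suc N. of_int (xs m i)) + real (Suc N) * (u - 1)) * fdet (Suc N) (xs l) (xs m)"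
    using fdet_raise_lower[of u t "xs l" "Suc N" "xs m"] by linarith
  also have "\<dots> = (\<Sum>k | covered_by k m. bw u t (boxes m - boxes k) * fdet (Suc N) (xs l) (xs k)) +
     (real (sum_list l) + real (sum_list m) + t) * fdet (Suc N) (xs l) (xs m)"
  proof -
    \<comment> \<open>The dependence on \<open>N\<close> cancels: (N + 1)^2 - N (N + 1) - (N + 1) =
      0, and the terms with \<open>u\<close> cancel as well.\<close>
    have "wt u t (- real N - 1) + (real (sum_list l) - (real N + 1) * real N / 2 +
       (real (sum_list m) - (real N + 1) * real N / 2) + real (Suc N) * (u - 1)) =
       real (sum_list l) + real (sum_list m) + t"
      by (simp add: wt_def power2_eq_square algebra_simps)
    thus ?thesis
      unfolding last s[OF N(1)] s[OF N(2)] by (simp only: add.assoc flip: distrib_right)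
  qed
  finally show ?thesis .
qed

text \<open>\<open>rdim N m l\<close> is the relative dimension \<open>dim(m, l) / dim l\<close>, with the number of standard
  tableaux of skew shape \<open>l/m\<close> given by Aitken's determinant.\<close>
definition rdim :: "nat \<Rightarrow> nat list \<Rightarrow> nat list \<Rightarrow> real" where
  "rdim N m l = fact (sum_list l - sum_list m) * fdet N (xs l) (xs m) / real (dimY l)"

text \<open>The formula for A on the Schur functions, read with \<open>rdim\<close> in their
  place.\<close>

definition Ardim :: "real \<Rightarrow> real \<Rightarrow> nat \<Rightarrow> nat list \<Rightarrow> nat list \<Rightarrow> real" where
  "Ardim u t N m l = - (real (sum_list m) * (real (sum_list m) - 1 + t)) * rdim N m l +
     (\<Sum>k | covered_by k m. bw u t (boxes m - boxes k) * rdim N k l)"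

lemma rdim_mult_dimY: "is_partition l \<Longrightarrow>
   real (dimY l) * rdim N m l = fact (sum_list l - sum_list m) * fdet N (xs l) (xs m)"
  using dimY_pos[of l] by (simp add: rdim_def)

text \<open>Relative dimensions are invariant under the down step, whose transition probability from
  \<open>k\<close> to \<open>l\<close> is dim l / dim k. The strict inequality of sizes keeps the
  truncated subtraction in the factorials harmless.\<close>

lemma rdim_down:
  assumes k: "is_partition k" and N: "length k < N" "length m \<le> N"
    and n: "sum_list m < sum_list k"
  shows "(\<Sum>l | covered_by l k. real (dimY l) * rdim N m l) = real (dimY k) * rdim N m k"
proof -
  have "(\<Sum>l | covered_by l k. real (dimY l) * rdim N m l) =
     (\<Sum>l | covered_by l k. fact (sum_list k - 1 - sum_list m) * fdet N (xs l) (xs m))"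
    by (intro sum.cong) (auto simp: rdim_mult_dimY sum_list_covered covered_by_def)
  also have "\<dots> = fact (sum_list k - 1 - sum_list m) * ((real (sum_list k) - real (sum_list m)) * fdet N (xs k) (xs m))"
    using sum_fdet_down[OF k N] by (simp flip: sum_distrib_left)
  also have "\<dots> = fact (sum_list k - sum_list m) * fdet N (xs k) (xs m)"
    using n fact_reduce[of "sum_list k - sum_list m", where 'a = real] by (simp add: of_nat_diff)
  finally show ?thesis by (simp add: rdim_mult_dimY[OF k])
qed

text \<open>With n the size of \<open>l\<close> and c the content of the added box, the up step goes
  from \<open>l\<close> to \<open>k\<close> with probability w(c) dim k / ((n + 1)(n + t) dim l).
  Combined with \<open>rdim_down\<close>, this says that (n + 1)(n + t) times the up-down generator
  acts on relative dimensions by \<open>Ardim\<close>.\<close>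

lemma rdim_up:
  assumes l: "is_partition l" and m: "is_partition m" and N: "length l \<le> N" "length m \<le> N"
    and n: "sum_list m \<le> sum_list l"
  shows "(\<Sum>k | covered_by l k. bw u t (boxes k - boxes l) * (real (dimY k) * rdim (Suc N) m k)) =
    real (dimY l) * (Ardim u t (Suc N) m l + (real (sum_list l) + 1) * (real (sum_list l) + t) * rdim (Suc N) m l)"
proof -
  let ?a = "sum_list l" and ?b = "sum_list m"
  have f: "fact (Suc ?a - ?b) = (real ?a + 1 - real ?b) * fact (?a - ?b)"
    using n by (simp add: Suc_diff_le of_nat_diff)
  have "(\<Sum>k | covered_by l k. bw u t (boxes k - boxes l) * (real (dimY k) * rdim (Suc N) m k)) =
     (\<Sum>k | covered_by l k. fact (Suc ?a - ?b) * (bw u t (boxes k - boxes l) * fdet (Suc N) (xs k) (xs m)))"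
    by (intro sum.cong) (auto simp: rdim_mult_dimY sum_list_covered covered_by_def)
  also have "\<dots> = fact (Suc ?a - ?b) * ((\<Sum>k | covered_by k m. bw u t (boxes m - boxes k) * fdet (Suc N) (xs l) (xs k)) +
     (real ?a + real ?b + t) * fdet (Suc N) (xs l) (xs m))"
    using sum_fdet_commutation[OF l m N] by (simp flip: sum_distrib_left)
  also have "\<dots> = (\<Sum>k | covered_by k m. bw u t (boxes m - boxes k) * (fact (Suc ?a - ?b) * fdet (Suc N) (xs l) (xs k))) +
     (real ?a + 1 - real ?b) * (real ?a + real ?b + t) * (fact (?a - ?b) * fdet (Suc N) (xs l) (xs m))"
    by (subst distrib_left) (simp add: sum_distrib_left f mult_ac)
  also have "(\<Sum>k | covered_by k m. bw u t (boxes m - boxes k) * (fact (Suc ?a - ?b) * fdet (Suc N) (xs l) (xs k))) =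
     (\<Sum>k | covered_by k m. bw u t (boxes m - boxes k) * (real (dimY l) * rdim (Suc N) k l))"
    using n by (intro sum.cong) (auto simp: rdim_mult_dimY[OF l] sum_list_covered)
  also have "\<dots> = real (dimY l) * (\<Sum>k | covered_by k m. bw u t (boxes m - boxes k) * rdim (Suc N) k l)"
    by (simp add: sum_distrib_left mult_ac)
  \<comment> \<open>With n and m the sizes of the two diagrams, the coefficients match because (n +
    1 - m)(n + m + t) = (n + 1)(n + t) - m (m - 1 + t).\<close>
  finally show ?thesis
    by (simp add: Ardim_def rdim_mult_dimY[OF l, symmetric] algebra_simps)
qed

lemma rdim_symmetric:
  assumes a: "is_partition a" "sum_list a \<le> n" and b: "is_partition b" "sum_list b \<le> n"
    and N: "n + 1 < N"
  shows "(\<Sum>l\<in>YD n. bw u t (boxes l) * real (dimY l) ^ 2 * (Ardim u t N a l * rdim N b l)) =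
         (\<Sum>l\<in>YD n. bw u t (boxes l) * real (dimY l) ^ 2 * (Ardim u t N b l * rdim N a l))"
proof -
  let ?c = "(real n + 1) * (real n + t)"
  obtain N' where N': "N = Suc N'" "n + 1 \<le> N'" using N by (cases N) auto
  \<comment> \<open>Reversibility in summed form: pairing with the up operator on level
    \<open>n\<close> gives a weighted sum over level \<open>n + 1\<close> that is visibly symmetric
    in \<open>a\<close> and \<open>b\<close>.\<close>
  have key: "(\<Sum>l\<in>YD n. bw u t (boxes l) * real (dimY l) ^ 2 * ((Ardim u t N a l + ?c * rdim N a l) * rdim N b l)) =
     (\<Sum>k\<in>YD (Suc n). bw u t (boxes k) * real (dimY k) ^ 2 * (rdim N a k * rdim N b k))"
    if a: "is_partition a" "sum_list a \<le> n" and b: "is_partition b" "sum_list b \<le> n" for a b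
  proof -
    have len: "length a \<le> N'" "length b \<le> N'"
      using length_le_sum_list a b N' by (meson le_trans le_add1)+
    have "(\<Sum>l\<in>YD n. bw u t (boxes l) * real (dimY l) ^ 2 * ((Ardim u t N a l + ?c * rdim N a l) * rdim N b l)) =
      (\<Sum>l\<in>YD n. \<Sum>k | k \<in> YD (Suc n) \<and> covered_by l k. bw u t (boxes k) * real (dimY k) * rdim N a k * (real (dimY l) * rdim N b l))"
    proof (rule sum.cong)
      fix l assume "l \<in> YD n"
      hence l: "is_partition l" "sum_list l = n" by (auto simp: YD_def)
      have ll: "length l \<le> N'" using length_le_sum_list[OF l(1)] l N' by simp
      have eq: "{k. k \<in> YD (Suc n) \<and> covered_by l k} = {k. covered_by l k}"
        using l by (auto simp: YD_def sum_list_covered) (auto simp: covered_by_def)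
      have "real (dimY l) * (Ardim u t N a l + ?c * rdim N a l) =
        (\<Sum>k | covered_by l k. bw u t (boxes k - boxes l) * (real (dimY k) * rdim N a k))"
        using rdim_up[OF l(1) a(1) ll len(1)] a l N' by simp
      hence "bw u t (boxes l) * real (dimY l) ^ 2 * ((Ardim u t N a l + ?c * rdim N a l) * rdim N b l) =
         bw u t (boxes l) * real (dimY l) * rdim N b l * (\<Sum>k | covered_by l k. bw u t (boxes k - boxes l) * (real (dimY k) * rdim N a k))"
        by (simp add: power2_eq_square mult_ac)
      also have "\<dots> = (\<Sum>k | covered_by l k. bw u t (boxes k) * real (dimY k) * rdim N a k * (real (dimY l) * rdim N b l))"
        unfolding sum_distrib_left by (intro sum.cong) (auto simp: bw_covered)
      finally show "bw u t (boxes l) * real (dimY l) ^ 2 * ((Ardim u t N a l + ?c * rdim N a l) * rdim N b l) =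
         (\<Sum>k | k \<in> YD (Suc n) \<and> covered_by l k. bw u t (boxes k) * real (dimY k) * rdim N a k * (real (dimY l) * rdim N b l))"
        by (simp only: eq)
    qed simp
    \<comment> \<open>After the exchange of sums the inner sum over \<open>l\<close> is evaluated by
      \<open>rdim_down\<close> for \<open>b\<close>.\<close>
    also have "\<dots> = (\<Sum>k\<in>YD (Suc n). \<Sum>l | l \<in> YD n \<and> covered_by l k. bw u t (boxes k) * real (dimY k) * rdim N a k * (real (dimY l) * rdim N b l))"
      by (rule sum.swap_restrict) auto
    also have "\<dots> = (\<Sum>k\<in>YD (Suc n). bw u t (boxes k) * real (dimY k) ^ 2 * (rdim N a k * rdim N b k))"
    proof (rule sum.cong)
      fix k assume "k \<in> YD (Suc n)"
      hence k: "is_partition k" "sum_list k = Suc n" by (auto simp: YD_def)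
      have kl: "length k < N" using length_le_sum_list[OF k(1)] k N' by simp
      have eq: "{l. l \<in> YD n \<and> covered_by l k} = {l. covered_by l k}"
        using k by (auto simp: YD_def sum_list_covered) (auto simp: covered_by_def)
      have "(\<Sum>l | covered_by l k. real (dimY l) * rdim N b l) = real (dimY k) * rdim N b k"
        using k kl len N' b by (intro rdim_down) auto
      hence "(\<Sum>l | covered_by l k. bw u t (boxes k) * real (dimY k) * rdim N a k * (real (dimY l) * rdim N b l)) =
         bw u t (boxes k) * real (dimY k) * rdim N a k * (real (dimY k) * rdim N b k)"
        by (simp only: flip: sum_distrib_left)
      thus "(\<Sum>l | l \<in> YD n \<and> covered_by l k. bw u t (boxes k) * real (dimY k) * rdim N a k * (real (dimY l) * rdim N b l)) =
         bw u t (boxes k) * real (dimY k) ^ 2 * (rdim N a k * rdim N b k)"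
        by (simp add: eq power2_eq_square mult_ac)
    qed simp
    finally show ?thesis .
  qed
  have "(\<Sum>l\<in>YD n. bw u t (boxes l) * real (dimY l) ^ 2 * ((Ardim u t N a l + ?c * rdim N a l) * rdim N b l)) =
     (\<Sum>l\<in>YD n. bw u t (boxes l) * real (dimY l) ^ 2 * ((Ardim u t N b l + ?c * rdim N b l) * rdim N a l))"
    unfolding key[OF a b] key[OF b a] by (simp add: mult_ac)
  moreover have sp: "(\<Sum>l\<in>YD n. bw u t (boxes l) * real (dimY l) ^ 2 * ((Ardim u t N a l + ?c * rdim N a l) * rdim N b l)) =
     (\<Sum>l\<in>YD n. bw u t (boxes l) * real (dimY l) ^ 2 * (Ardim u t N a l * rdim N b l)) +
     (\<Sum>l\<in>YD n. bw u t (boxes l) * real (dimY l) ^ 2 * (?c * (rdim N a l * rdim N b l)))" for a b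
    by (simp only: distrib_right distrib_left sum.distrib mult.assoc)
  moreover have "(\<Sum>l\<in>YD n. bw u t (boxes l) * real (dimY l) ^ 2 * (?c * (rdim N a l * rdim N b l))) =
     (\<Sum>l\<in>YD n. bw u t (boxes l) * real (dimY l) ^ 2 * (?c * (rdim N b l * rdim N a l)))"
    by (simp only: mult.commute[of "rdim N a _" "rdim N b _"])
  ultimately show ?thesis using sp[of a b] sp[of b a] by linarith
qed

section \<open>Complete symmetric functions and Frobenius coordinates\<close>

text \<open>Partitions as multisets of parts, so that adding multisets corresponds to multiplying
  monomials.\<close>

definition MP :: "nat \<Rightarrow> nat multiset set" where
  "MP r = {M. 0 \<notin># M \<and> sum_mset M = r}"

lemma bij_betw_mset_YD: "bij_betw mset (YD r) (MP r)"
proof (rule bij_betw_byWitness[where f' = "\<lambda>M. rev (sorted_list_of_multiset M)"])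
  have "rev (sorted_list_of_multiset (mset l)) = l" if "is_partition l" for l
  proof -
    have "sorted (rev l)" using that by (simp add: is_partition_def sorted_wrt_rev)
    hence "sort l = rev l" by (intro properties_for_sort) auto
    thus ?thesis by (simp add: sorted_list_of_multiset_mset)
  qed
  thus "\<forall>l\<in>YD r. rev (sorted_list_of_multiset (mset l)) = l" by (auto simp: YD_def)
  show "\<forall>M\<in>MP r. mset (rev (sorted_list_of_multiset M)) = M" by simp
  show "mset ` YD r \<subseteq> MP r"
    by (auto simp: YD_def MP_def is_partition_def sum_mset_sum_list)
  show "(\<lambda>M. rev (sorted_list_of_multiset M)) ` MP r \<subseteq> YD r"
  proof clarify
    fix M assume M: "M \<in> MP r"
    have "sum_list (rev (sorted_list_of_multiset M)) = sum_mset (mset (rev (sorted_list_of_multiset M)))"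
      by (simp only: sum_mset_sum_list)
    hence "sum_list (rev (sorted_list_of_multiset M)) = r" using M by (simp add: MP_def)
    moreover have "sorted_wrt (\<ge>) (rev (sorted_list_of_multiset M))"
      by (simp add: sorted_wrt_rev)
    ultimately show "rev (sorted_list_of_multiset M) \<in> YD r"
      using M by (simp add: YD_def is_partition_def MP_def)
  qed
qed

lemma finite_MP [simp]: "finite (MP r)"
  using bij_betw_finite[OF bij_betw_mset_YD] finite_YD by blast

definition zM :: "nat multiset \<Rightarrow> real" where
  "zM M = (\<Prod>i\<in>set_mset M. real i ^ count M i * fact (count M i))"

lemma zM_superset:
  assumes "finite S" "set_mset M \<subseteq> S"
  shows "zM M = (\<Prod>i\<in>S. real i ^ count M i * fact (count M i))"
  unfolding zM_def using assms
  by (intro prod.mono_neutral_left) (auto simp: not_in_iff)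

lemma zcent_eq_zM: "zcent l = zM (mset l)"
  unfolding zcent_def zM_def by (simp add: count_mset)

lemma zM_add: "zM (add_mset k M) = real k * (real (count M k) + 1) * zM M"
proof -
  let ?S = "insert k (set_mset M)"
  let ?f = "\<lambda>M i. real i ^ count M i * fact (count M i)"
  have "zM (add_mset k M) = (\<Prod>i\<in>?S. ?f (add_mset k M) i)"
    by (rule zM_superset) auto
  also have "\<dots> = ?f (add_mset k M) k * (\<Prod>i\<in>?S - {k}. ?f (add_mset k M) i)"
    by (rule prod.remove) auto
  also have "(\<Prod>i\<in>?S - {k}. ?f (add_mset k M) i) = (\<Prod>i\<in>?S - {k}. ?f M i)"
    by (intro prod.cong) auto
  also have "?f (add_mset k M) k = real k * (real (count M k) + 1) * ?f M k"
    by (simp add: algebra_simps)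
  also have "\<dots> * (\<Prod>i\<in>?S - {k}. ?f M i) = real k * (real (count M k) + 1) * (?f M k * (\<Prod>i\<in>?S - {k}. ?f M i))"
    by (simp only: mult.assoc)
  also have "?f M k * (\<Prod>i\<in>?S - {k}. ?f M i) = (\<Prod>i\<in>?S. ?f M i)"
    by (rule prod.remove[symmetric]) auto
  also have "\<dots> = zM M" by (rule zM_superset[symmetric]) auto
  finally show ?thesis .
qed

lemma zM_pos: "0 \<notin># M \<Longrightarrow> zM M > 0"
  unfolding zM_def by (intro prod_pos) (auto intro!: mult_pos_pos zero_less_power gr0I)

text \<open>The complete homogeneous function as a polynomial in abstract power sum values
  \<open>p\<close>, to be evaluated both on the simplex and at integer row data.\<close>

definition hpow :: "(nat \<Rightarrow> real) \<Rightarrow> nat \<Rightarrow> real" where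
  "hpow p r = (\<Sum>M\<in>MP r. (\<Prod>k\<in>#M. p k) / zM M)"

lemma hcirc_eq_hpow: "hcirc n w = hpow (\<lambda>k. pcirc k w) n"
proof -
  have "hcirc n w = (\<Sum>l\<in>YD n. (\<Prod>k\<in>#mset l. pcirc k w) / zM (mset l))"
    unfolding hcirc_def zcent_eq_zM
    by (simp only: mset_map[symmetric] prod_mset_prod_list)
  also have "\<dots> = hpow (\<lambda>k. pcirc k w) n"
    unfolding hpow_def by (rule sum.reindex_bij_betw[OF bij_betw_mset_YD])
  finally show ?thesis .
qed

lemma hpow_0 [simp]: "hpow p 0 = 1"
proof -
  have "M = {#}" if "0 \<notin># M" "sum_mset M = 0" for M :: "nat multiset"
    using that by (cases M) auto
  hence "MP 0 = {{#}}" by (auto simp: MP_def)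
  thus ?thesis by (simp add: hpow_def zM_def)
qed

text \<open>Newton's identity by marking a part: \<open>r\<close> is the sum of k times the
  multiplicity of k over the distinct parts k, and this is exactly the factor that \<open>zM\<close>
  loses when one part k is removed.\<close>

lemma hpow_newton: "real r * hpow p r = (\<Sum>k=1..r. p k * hpow p (r - k))"
proof -
  let ?P = "\<lambda>M. \<Prod>k\<in>#M. p k"
  have elem: "k \<in> {1..r}" if "M \<in> MP r" "k \<in># M" for M k
    using that by (auto simp: MP_def Suc_le_eq sum_mset.remove intro: gr0I)
  have "real r * hpow p r = (\<Sum>M\<in>MP r. \<Sum>k | k \<in> {1..r} \<and> k \<in># M. real k * real (count M k) * ?P M / zM M)"
    unfolding hpow_def sum_distrib_left
  proof (rule sum.cong)
    fix M assume M: "M \<in> MP r"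
    have "real r = real (sum_mset M)" using M by (simp add: MP_def)
    also have "sum_mset M = (\<Sum>k\<in>set_mset M. count M k * k)"
    proof -
      obtain xs where xs: "M = mset xs" using ex_mset by metis
      show ?thesis
        using sum_list_map_eq_sum_count[of "\<lambda>x. x" xs] by (simp add: xs sum_mset_sum_list count_mset)
    qed
    also have "set_mset M = {k. k \<in> {1..r} \<and> k \<in># M}" using elem[OF M] by auto
    finally have e: "real r = (\<Sum>k | k \<in> {1..r} \<and> k \<in># M. real k * real (count M k))"
      by (simp add: mult.commute)
    show "real r * (?P M / zM M) = (\<Sum>k | k \<in> {1..r} \<and> k \<in># M. real k * real (count M k) * ?P M / zM M)"
      by (subst e) (simp only: sum_distrib_right times_divide_eq_right sum_divide_distrib)
  qed simp
  also have "\<dots> = (\<Sum>k=1..r. \<Sum>M | M \<in> MP r \<and> k \<in># M. real k * real (count M k) * ?P M / zM M)"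
    by (rule sum.swap_restrict) auto
  also have "\<dots> = (\<Sum>k=1..r. p k * hpow p (r - k))"
  proof (rule sum.cong)
    fix k assume k: "k \<in> {1..r}"
    have bij: "bij_betw (add_mset k) (MP (r - k)) {M. M \<in> MP r \<and> k \<in># M}"
    proof (rule bij_betw_byWitness[where f' = "\<lambda>M. M - {#k#}"])
      show "(\<lambda>M. M - {#k#}) ` {M. M \<in> MP r \<and> k \<in># M} \<subseteq> MP (r - k)"
        by (auto simp: MP_def sum_mset.remove dest: in_diffD)
    qed (use k in \<open>auto simp: MP_def\<close>)
    have "(\<Sum>M | M \<in> MP r \<and> k \<in># M. real k * real (count M k) * ?P M / zM M) =
       (\<Sum>M\<in>MP (r - k). real k * real (count (add_mset k M) k) * ?P (add_mset k M) / zM (add_mset k M))"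
      by (rule sum.reindex_bij_betw[OF bij, symmetric])
    also have "\<dots> = (\<Sum>M\<in>MP (r - k). p k * (?P M / zM M))"
    proof (rule sum.cong)
      fix M
      have nz: "real k * (real (count M k) + 1) \<noteq> 0"
        using k of_nat_0_le_iff[of "count M k", where 'a = real] by auto
      have "real k * real (count (add_mset k M) k) * ?P (add_mset k M) / zM (add_mset k M) =
          real k * (real (count M k) + 1) * (p k * ?P M) / (real k * (real (count M k) + 1) * zM M)"
        by (simp add: zM_add add.commute)
      also have "\<dots> = p k * ?P M / zM M" by (rule mult_divide_mult_cancel_left[OF nz])
      finally show "real k * real (count (add_mset k M) k) * ?P (add_mset k M) / zM (add_mset k M) = p k * (?P M / zM M)"
        by simp
    qed simp
    finally show "(\<Sum>M | M \<in> MP r \<and> k \<in># M. real k * real (count M k) * ?P M / zM M) = p k * hpow p (r - k)"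
      by (simp add: hpow_def sum_distrib_left)
  qed simp
  finally show ?thesis .
qed

lemma hpow_unique:
  assumes "F 0 = 1" "\<And>r. real r * F r = (\<Sum>k=1..r. p k * F (r - k))"
  shows "F r = hpow p r"
proof (induction r rule: less_induct)
  case (less r)
  show ?case
  proof (cases "r = 0")
    case False
    have "real r * F r = real r * hpow p r"
      unfolding assms(2) hpow_newton using less by (intro sum.cong) auto
    thus ?thesis using False by simp
  qed (simp add: assms)
qed

lemma hpow_cong: "(\<And>k. k \<ge> 1 \<Longrightarrow> p k = q k) \<Longrightarrow> hpow p r = hpow q r"
  by (rule hpow_unique) (auto simp: hpow_newton)

lemma hpow_scale: "hpow (\<lambda>k. c ^ k * p k) r = c ^ r * hpow p r"
proof -
  have "c ^ r * hpow p r = hpow (\<lambda>k. c ^ k * p k) r"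
  proof (rule hpow_unique)
    fix r
    have "real r * (c ^ r * hpow p r) = c ^ r * (real r * hpow p r)" by simp
    also have "\<dots> = (\<Sum>k=1..r. c ^ r * (p k * hpow p (r - k)))"
      unfolding hpow_newton sum_distrib_left ..
    also have "\<dots> = (\<Sum>k=1..r. c ^ k * p k * (c ^ (r - k) * hpow p (r - k)))"
      by (intro sum.cong) (auto simp: mult_ac simp flip: power_add)
    finally show "real r * (c ^ r * hpow p r) = \<dots>" .
  qed simp
  thus ?thesis by simp
qed

text \<open>Expresses F = exp(sum of p_k X^k / k) through the logarithmic derivative. In this form
  products and inverses of series become sums and negatives of power sums, and the coefficients are
  governed by Newton's identity.\<close>

definition newton_fps :: "real fps \<Rightarrow> (nat \<Rightarrow> real) \<Rightarrow> bool" where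
  "newton_fps F p \<longleftrightarrow> fps_nth F 0 = 1 \<and> fps_X * fps_deriv F = F * Abs_fps (\<lambda>k. if k = 0 then 0 else p k)"

lemma newton_fps_nth:
  assumes "newton_fps F p" shows "fps_nth F r = hpow p r"
proof (rule hpow_unique)
  fix r
  have "real r * fps_nth F r = fps_nth (fps_X * fps_deriv F) r" by (cases r) auto
  also have "\<dots> = (\<Sum>k=0..r. (if k = 0 then 0 else p k) * fps_nth F (r - k))"
    using assms unfolding newton_fps_def by (simp add: mult.commute[of F] fps_mult_nth)
  also have "\<dots> = (\<Sum>k=1..r. p k * fps_nth F (r - k))"
    by (rule sum.mono_neutral_cong_right) auto
  finally show "real r * fps_nth F r = (\<Sum>k=1..r. p k * fps_nth F (r - k))" .
qed (use assms in \<open>simp add: newton_fps_def\<close>)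

lemma newton_fps_mult:
  assumes "newton_fps F p" "newton_fps G q"
  shows "newton_fps (F * G) (\<lambda>k. p k + q k)"
proof -
  have "Abs_fps (\<lambda>k. if k = 0 then 0 else p k + q k) =
     Abs_fps (\<lambda>k. if k = 0 then 0 else p k) + Abs_fps (\<lambda>k. if k = 0 then 0 else q k)"
    by (rule fps_ext) simp
  moreover have "fps_X * fps_deriv (F * G) = (fps_X * fps_deriv F) * G + F * (fps_X * fps_deriv G)"
    by (simp add: algebra_simps)
  ultimately show ?thesis
    using assms unfolding newton_fps_def by (simp add: algebra_simps)
qed

lemma newton_fps_inverse:
  assumes "newton_fps F p" shows "newton_fps (inverse F) (\<lambda>k. - p k)"
proof -
  have F0: "fps_nth F 0 = 1" using assms by (simp add: newton_fps_def)
  have "fps_X * fps_deriv (inverse F) = - (inverse F ^ 2 * (fps_X * fps_deriv F))"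
    using F0 by (simp add: fps_inverse_deriv power2_eq_square mult_ac)
  also have "\<dots> = - (inverse F * (inverse F * F) * Abs_fps (\<lambda>k. if k = 0 then 0 else p k))"
    using assms by (simp add: newton_fps_def power2_eq_square mult_ac)
  also have "inverse F * F = 1" using F0 by (intro inverse_mult_eq_1) simp
  also have "- (inverse F * 1 * Abs_fps (\<lambda>k. if k = 0 then 0 else p k)) =
      inverse F * Abs_fps (\<lambda>k. if k = 0 then 0 else - p k)"
  proof -
    have "Abs_fps (\<lambda>k. if k = 0 then 0 else - p k) = - Abs_fps (\<lambda>k. if k = 0 then 0 else p k)"
      by (rule fps_ext) simp
    thus ?thesis by simp
  qed
  finally show ?thesis using F0 by (simp add: newton_fps_def)
qed

lemma newton_fps_linear: "newton_fps (1 - fps_const c * fps_X) (\<lambda>k. - (c ^ k))"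
proof -
  have "(1 - fps_const c * fps_X) * Abs_fps (\<lambda>k. if k = 0 then 0 else - (c ^ k)) = - (fps_const c * fps_X)"
  proof (rule fps_ext)
    fix n
    show "fps_nth ((1 - fps_const c * fps_X) * Abs_fps (\<lambda>k. if k = 0 then 0 else - (c ^ k))) n = fps_nth (- (fps_const c * fps_X)) n"
      by (cases n) (auto simp: left_diff_distrib mult.assoc split: nat.splits)
  qed
  thus ?thesis by (simp add: newton_fps_def mult.commute)
qed

lemma newton_fps_prod:
  assumes "\<And>i. i \<in> I \<Longrightarrow> newton_fps (F i) (p i)"
  shows "newton_fps (\<Prod>i\<in>I. F i) (\<lambda>k. \<Sum>i\<in>I. p i k)"
proof -
  have one: "newton_fps 1 (\<lambda>k. 0)"
    unfolding newton_fps_def by (auto intro!: fps_ext simp: fps_mult_nth intro: sum.neutral)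
  show ?thesis using assms
  proof (induction I rule: infinite_finite_induct)
    case (insert i I)
    thus ?case using newton_fps_mult[of "F i" "p i" "\<Prod>i\<in>I. F i"] by simp
  qed (simp_all add: one)
qed

section \<open>Power sums in modified Frobenius coordinates\<close>

definition yy :: "nat list \<Rightarrow> nat \<Rightarrow> real" where
  "yy l i = real (rowlen l i) - real i - 1/2"

text \<open>Generating function of the complete functions in the modified Frobenius coordinates. The
  first product comes from the empty diagram, whose row coordinates are \<open>- i - 1/2\<close>;
  against it the empty rows of \<open>l\<close> cancel, so \<open>N\<close> does not matter once all
  rows are included.\<close>

definition Hfps :: "nat \<Rightarrow> nat list \<Rightarrow> real fps" where
  "Hfps N l = (\<Prod>i<N. 1 + fps_const (real i + 1/2) * fps_X) *
     inverse (\<Prod>i<N. 1 - fps_const (yy l i) * fps_X)"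

lemma newton_Hfps: "newton_fps (Hfps N l) (\<lambda>k. \<Sum>i<N. yy l i ^ k - (- real i - 1/2) ^ k)"
proof -
  have "1 + fps_const (real i + 1/2) * fps_X = 1 - fps_const (- real i - 1/2) * fps_X" for i
  proof -
    have "fps_const (- real i - 1/2) = - fps_const (real i + 1/2)"
      by (simp add: algebra_simps flip: fps_const_neg)
    thus ?thesis by simp
  qed
  hence "newton_fps (\<Prod>i<N. 1 + fps_const (real i + 1/2) * fps_X) (\<lambda>k. \<Sum>i<N. - ((- real i - 1/2) ^ k))"
    by (intro newton_fps_prod) (simp only: newton_fps_linear)
  moreover have "newton_fps (inverse (\<Prod>i<N. 1 - fps_const (yy l i) * fps_X)) (\<lambda>k. - (\<Sum>i<N. - (yy l i ^ k)))"
    by (intro newton_fps_inverse newton_fps_prod newton_fps_linear)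
  ultimately have "newton_fps (Hfps N l) (\<lambda>k. (\<Sum>i<N. - ((- real i - 1/2) ^ k)) + - (\<Sum>i<N. - (yy l i ^ k)))"
    unfolding Hfps_def by (rule newton_fps_mult)
  moreover have "(\<lambda>k. (\<Sum>i<N. - ((- real i - 1/2) ^ k)) + - (\<Sum>i<N. - (yy l i ^ k))) =
      (\<lambda>k. \<Sum>i<N. yy l i ^ k - (- real i - 1/2) ^ k)"
    by (simp add: sum_negf sum_subtractf fun_eq_iff)
  ultimately show ?thesis by simp
qed

lemma down_closed_eq_lessThan:
  fixes S :: "nat set"
  assumes "finite S" "\<And>i j. i \<in> S \<Longrightarrow> j \<le> i \<Longrightarrow> j \<in> S"
  shows "S = {..<card S}"
proof -
  obtain n where n: "n \<notin> S" using assms(1) infinite_UNIV_nat by (metis UNIV_eq_I)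
  define m where "m = (LEAST n. n \<notin> S)"
  have "m \<notin> S" unfolding m_def by (rule LeastI) (rule n)
  moreover have "i \<in> S" if "i < m" for i
    using not_less_Least[OF that[unfolded m_def]] by simp
  ultimately have "S = {..<m}" using assms(2) by (auto simp: not_less) (meson not_less)
  thus ?thesis by simp
qed

lemma conj_part_iff:
  assumes l: "is_partition l"
  shows "i < conj_part l j \<longleftrightarrow> j < rowlen l i"
proof -
  let ?S = "{i. i < length l \<and> j < l ! i}"
  have S: "?S = {i. j < rowlen l i}" by (auto simp: rowlen_def)
  have "?S = {..<card ?S}"
  proof (rule down_closed_eq_lessThan)
    fix i i' assume "i \<in> ?S" "i' \<le> i"
    thus "i' \<in> ?S" using rowlen_antimono[OF l, of i' i] unfolding S by auto
  qed simp
  thus ?thesis unfolding conj_part_def S by auto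
qed

lemma diag_len_iff:
  assumes l: "is_partition l"
  shows "i < diag_len l \<longleftrightarrow> i < rowlen l i"
proof -
  let ?S = "{i. i < length l \<and> i < l ! i}"
  have S: "?S = {i. i < rowlen l i}" by (auto simp: rowlen_def)
  have "?S = {..<card ?S}"
  proof (rule down_closed_eq_lessThan)
    fix i i' assume "i \<in> ?S" "i' \<le> i"
    thus "i' \<in> ?S" using rowlen_antimono[OF l, of i' i] unfolding S by auto
  qed simp
  thus ?thesis unfolding diag_len_def S by auto
qed

text \<open>With \<open>c\<close> the content of a box, this telescopes both along rows and along
  diagonal hooks. Comparing the two evaluations expresses the power sums of Frobenius coordinates by
  row lengths.\<close>

definition cdiff :: "nat \<Rightarrow> real \<Rightarrow> real" where
  "cdiff k c = (c + 1/2) ^ k - (c - 1/2) ^ k"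

lemma sum_boxes_rows:
  assumes "length l \<le> N"
  shows "(\<Sum>(i, j)\<in>boxes l. cdiff k (real j - real i)) = (\<Sum>i<N. yy l i ^ k - (- real i - 1/2) ^ k)"
proof -
  have tel: "(\<Sum>j<r. cdiff k (real j - real i)) = (real r - real i - 1/2) ^ k - (- real i - 1/2) ^ k" for r i
    by (induction r) (auto simp: cdiff_def algebra_simps)
  have "(\<Sum>(i, j)\<in>boxes l. cdiff k (real j - real i)) = (\<Sum>i<length l. \<Sum>j<rowlen l i. cdiff k (real j - real i))"
    unfolding boxes_Sigma by (subst sum.Sigma) auto
  also have "\<dots> = (\<Sum>i<length l. yy l i ^ k - (- real i - 1/2) ^ k)"
    by (simp only: tel yy_def)
  also have "\<dots> = (\<Sum>i<N. yy l i ^ k - (- real i - 1/2) ^ k)"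
    using assms by (intro sum.mono_neutral_left) (auto simp: yy_def rowlen_eq_0)
  finally show ?thesis .
qed

text \<open>Boxes are grouped by their smaller coordinate, that is, into diagonal hooks. The arm
  telescopes from -1/2 to a_q, the leg from -b_q to -1/2, and the two meet at -1/2.\<close>

lemma sum_boxes_hooks:
  assumes l: "is_partition l"
  shows "(\<Sum>(i, j)\<in>boxes l. cdiff k (real j - real i)) =
     (\<Sum>q<diag_len l. frob_a l q ^ k - (- frob_b l q) ^ k)"
proof -
  let ?g = "\<lambda>(i, j). cdiff k (real j - real i)"
  let ?m = "\<lambda>(i, j). min i (j::nat)"
  have "(\<Sum>x\<in>boxes l. ?g x) = (\<Sum>q<diag_len l. \<Sum>x | x \<in> boxes l \<and> ?m x = q. ?g x)"
  proof (rule sum.group[symmetric])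
    show "?m ` boxes l \<subseteq> {..<diag_len l}"
    proof clarsimp
      fix i j assume ij: "(i, j) \<in> boxes l"
      hence "j < rowlen l i" by (simp add: mem_boxes)
      hence "min i j < rowlen l (min i j)"
        using rowlen_antimono[OF l, of "min i j" i] by linarith
      thus "min i j < diag_len l" by (simp add: diag_len_iff[OF l])
    qed
  qed auto
  also have "\<dots> = (\<Sum>q<diag_len l. frob_a l q ^ k - (- frob_b l q) ^ k)"
  proof (rule sum.cong)
    fix q assume "q \<in> {..<diag_len l}"
    hence q: "q < rowlen l q" by (simp add: diag_len_iff[OF l])
    hence q': "q < conj_part l q" by (simp add: conj_part_iff[OF l])
    have tel1: "(\<Sum>j=q..<r. cdiff k (real j - real q)) = (real r - real q - 1/2) ^ k - (- (1/2)) ^ k"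
      if "q \<le> r" for r using that
      by (induction r rule: dec_induct) (auto simp: cdiff_def algebra_simps)
    have tel2: "(\<Sum>i=Suc q..<r. cdiff k (real q - real i)) = (- (1/2)) ^ k - (- (real r - real q - 1/2)) ^ k"
      if "Suc q \<le> r" for r using that
      by (induction r rule: dec_induct) (auto simp: cdiff_def algebra_simps)
    have eq: "{x. x \<in> boxes l \<and> ?m x = q} =
       (\<lambda>j. (q, j)) ` {q..<rowlen l q} \<union> (\<lambda>i. (i, q)) ` {Suc q..<conj_part l q}"
      by (auto simp: mem_boxes conj_part_iff[OF l] min_def image_iff split: if_splits)
    have "(\<Sum>x | x \<in> boxes l \<and> ?m x = q. ?g x) =
       (\<Sum>x\<in>(\<lambda>j. (q, j)) ` {q..<rowlen l q}. ?g x) + (\<Sum>x\<in>(\<lambda>i. (i, q)) ` {Suc q..<conj_part l q}. ?g x)"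
      unfolding eq by (rule sum.union_disjoint) auto
    also have "(\<Sum>x\<in>(\<lambda>j. (q, j)) ` {q..<rowlen l q}. ?g x) = (\<Sum>j=q..<rowlen l q. cdiff k (real j - real q))"
      by (subst sum.reindex) (auto simp: inj_on_def)
    also have "(\<Sum>x\<in>(\<lambda>i. (i, q)) ` {Suc q..<conj_part l q}. ?g x) = (\<Sum>i=Suc q..<conj_part l q. cdiff k (real q - real i))"
      by (subst sum.reindex) (auto simp: inj_on_def)
    also have "(\<Sum>j=q..<rowlen l q. cdiff k (real j - real q)) = (real (rowlen l q) - real q - 1/2) ^ k - (- (1/2)) ^ k"
      using q by (intro tel1) simp
    also have "(\<Sum>i=Suc q..<conj_part l q. cdiff k (real q - real i)) = (- (1/2)) ^ k - (- (real (conj_part l q) - real q - 1/2)) ^ k"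
      using q' by (intro tel2) simp
    also have "real (rowlen l q) - real q - 1/2 = frob_a l q"
      using q by (auto simp: frob_a_def rowlen_def split: if_splits)
    also have "real (conj_part l q) - real q - 1/2 = frob_b l q"
      by (simp add: frob_b_def)
    finally show "(\<Sum>x | x \<in> boxes l \<and> ?m x = q. ?g x) = frob_a l q ^ k - (- frob_b l q) ^ k"
      by simp
  qed simp
  finally show ?thesis .
qed

text \<open>The case k = 1 is separate because \<open>pcirc 1\<close> is set to 1; there the
  identity just counts the boxes.\<close>

lemma pcirc_embed:
  assumes l: "l \<in> YD n" and n: "n > 0" and N: "length l \<le> N" and k: "k \<ge> 1"
  shows "real n ^ k * pcirc k (embed n l) = (\<Sum>i<N. yy l i ^ k - (- real i - 1/2) ^ k)"
proof (cases "k = 1")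
  case True
  have "(\<Sum>i<N. yy l i ^ k - (- real i - 1/2) ^ k) = real (\<Sum>i<N. rowlen l i)"
    using True by (simp add: yy_def)
  also have "\<dots> = real n" unfolding sum_rowlen[OF N] using l by (simp add: YD_def)
  finally show ?thesis using True by (simp add: pcirc_def)
next
  case False
  have lp: "is_partition l" using l by (simp add: YD_def)
  let ?d = "diag_len l"
  have s1: "(\<Sum>i. fst (embed n l) i ^ k) = (\<Sum>i<?d. (frob_a l i / real n) ^ k)"
    using k by (subst suminf_finite[of "{..<?d}"]) (auto simp: embed_def)
  have s2: "(\<Sum>i. snd (embed n l) i ^ k) = (\<Sum>i<?d. (frob_b l i / real n) ^ k)"
    using k by (subst suminf_finite[of "{..<?d}"]) (auto simp: embed_def)
  have sg: "(-1::real) ^ (k - 1) * b ^ k = - ((- b) ^ k)" for b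
    using k by (cases k) (auto simp: power_minus[of b])
  have "real n ^ k * pcirc k (embed n l) =
     (\<Sum>i<?d. real n ^ k * (frob_a l i / real n) ^ k) + (-1) ^ (k - 1) * (\<Sum>i<?d. real n ^ k * (frob_b l i / real n) ^ k)"
    using False by (simp add: pcirc_def s1 s2 distrib_left sum_distrib_left mult.left_commute)
  also have "\<dots> = (\<Sum>i<?d. frob_a l i ^ k) + (-1) ^ (k - 1) * (\<Sum>i<?d. frob_b l i ^ k)"
    using n by (simp add: power_divide)
  also have "\<dots> = (\<Sum>i<?d. frob_a l i ^ k - (- frob_b l i) ^ k)"
    by (simp only: sum_distrib_left sg sum_negf sum_subtractf add_uminus_conv_diff)
  also have "\<dots> = (\<Sum>i<N. yy l i ^ k - (- real i - 1/2) ^ k)"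
    using sum_boxes_hooks[OF lp, of k] sum_boxes_rows[OF N, of k] by simp
  finally show ?thesis .
qed

lemma Hfps_nth:
  assumes "l \<in> YD n" "n > 0" "length l \<le> N"
  shows "fps_nth (Hfps N l) r = real n ^ r * hcirc r (embed n l)"
proof -
  have "fps_nth (Hfps N l) r = hpow (\<lambda>k. \<Sum>i<N. yy l i ^ k - (- real i - 1/2) ^ k) r"
    by (rule newton_fps_nth[OF newton_Hfps])
  also have "\<dots> = hpow (\<lambda>k. real n ^ k * pcirc k (embed n l)) r"
    by (rule hpow_cong) (simp add: pcirc_embed[OF assms])
  finally show ?thesis by (simp add: hpow_scale hcirc_eq_hpow)
qed

lemma embed_in_Thoma:
  assumes l: "l \<in> YD n" shows "embed n l \<in> Thoma"
proof -
  have lp: "is_partition l" and sl: "sum_list l = n" using l by (auto simp: YD_def)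
  let ?d = "diag_len l"
  have fa: "frob_a l i \<ge> 0" if "i < ?d" for i
    using that diag_len_iff[OF lp, of i] by (auto simp: frob_a_def rowlen_def split: if_splits)
  have fb: "frob_b l i \<ge> 0" if "i < ?d" for i
    using that diag_len_iff[OF lp, of i] conj_part_iff[OF lp, of i i] by (auto simp: frob_b_def)
  have fa': "frob_a l (Suc i) \<le> frob_a l i" if "Suc i < ?d" for i
    using that diag_len_iff[OF lp, of i] diag_len_iff[OF lp, of "Suc i"] rowlen_antimono[OF lp, of i "Suc i"]
    by (auto simp: frob_a_def rowlen_def split: if_splits)
  have fb': "frob_b l (Suc i) \<le> frob_b l i" for i
  proof -
    have "\<not> conj_part l i < conj_part l (Suc i)"
      using conj_part_iff[OF lp, of "conj_part l i" i] conj_part_iff[OF lp, of "conj_part l i" "Suc i"] by simp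
    thus ?thesis by (simp add: frob_b_def)
  qed
  \<comment> \<open>For exponent 1 every box contributes 1, so the hook sum counts the
    boxes.\<close>
  have tot: "(\<Sum>i<?d. frob_a l i + frob_b l i) = real n"
    using sum_boxes_hooks[OF lp, of 1] sl card_boxes[of l] by (simp add: cdiff_def case_prod_unfold)
  have "(\<Sum>i<m. fst (embed n l) i + snd (embed n l) i) \<le> 1" for m
  proof -
    have "(\<Sum>i<m. fst (embed n l) i + snd (embed n l) i) = (\<Sum>i\<in>{..<m} \<inter> {..<?d}. (frob_a l i + frob_b l i) / real n)"
      by (rule sum.mono_neutral_cong_right) (auto simp: embed_def add_divide_distrib)
    also have "\<dots> \<le> (\<Sum>i<?d. (frob_a l i + frob_b l i) / real n)"
      using fa fb by (intro sum_mono2) auto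
    also have "\<dots> = real n / real n" by (simp only: tot flip: sum_divide_distrib)
    also have "\<dots> \<le> 1" by simp
    finally show ?thesis .
  qed
  moreover have "0 \<le> fst (embed n l) i" "0 \<le> snd (embed n l) i" for i
    using fa fb by (auto simp: embed_def)
  moreover have "fst (embed n l) (Suc i) \<le> fst (embed n l) i" "snd (embed n l) (Suc i) \<le> snd (embed n l) i" for i
    using fa fb fa' fb' by (auto simp: embed_def intro: divide_right_mono)
  ultimately show ?thesis unfolding Thoma_def by (auto simp: case_prod_unfold)
qed

section \<open>Asymptotics of relative dimensions\<close>

lemma fps_prod_nth_0: "fps_nth (\<Prod>x\<in>A. f x) 0 = (\<Prod>x\<in>A. fps_nth (f x) 0)"
  by (induction A rule: infinite_finite_induct) auto

text \<open>The partial fraction formula; the right side is the complete function of degree r - N +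
  1 in the \<open>y i\<close>. It comes from Lagrange interpolation of X^(N - 1) at the points 1 / y
  i, which exist and are distinct by the assumptions.\<close>

lemma sum_powers_eq_fps_nth:
  fixes y :: "nat \<Rightarrow> real"
  assumes inj: "inj_on y {..<N}" and nz: "\<And>i. i < N \<Longrightarrow> y i \<noteq> 0" and N: "N > 0"
  shows "(\<Sum>i<N. y i ^ r / (\<Prod>q\<in>{..<N} - {i}. y i - y q)) =
    fps_nth (fps_X ^ (N - 1) * inverse (\<Prod>i<N. 1 - fps_const (y i) * fps_X)) r"
proof -
  let ?D = "\<lambda>i. \<Prod>q\<in>{..<N} - {i}. y i - y q"
  let ?L = "\<lambda>q. 1 - fps_const (y q) * fps_X :: real fps"
  let ?B = "\<Prod>i<N. ?L i"
  let ?P = "\<Sum>i<N. Polynomial.smult (1 / ?D i) (\<Prod>q\<in>{..<N} - {i}. [:1, - y q:])"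
  have D: "?D i \<noteq> 0" if "i < N" for i
    using that inj by (auto dest: inj_onD)
  have Peq: "?P = Polynomial.monom 1 (N - 1)"
  proof (rule poly_eqI_degree[where A = "(\<lambda>i. 1 / y i) ` {..<N}"])
    have "inj_on (\<lambda>i. 1 / y i) {..<N}" using inj nz by (auto simp: inj_on_def)
    hence c: "card ((\<lambda>i. 1 / y i) ` {..<N}) = N" by (simp add: card_image)
    have "Polynomial.degree (\<Prod>q\<in>{..<N} - {i}. [:1, - y q:]) \<le> N - 1" if "i < N" for i
    proof -
      have "Polynomial.degree (\<Prod>q\<in>{..<N} - {i}. [:1, - y q:]) \<le> sum (Polynomial.degree \<circ> (\<lambda>q. [:1, - y q:])) ({..<N} - {i})"
        by (rule degree_prod_sum_le) simp
      also have "\<dots> \<le> (\<Sum>q\<in>{..<N} - {i}. 1)" by (intro sum_mono) simp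
      also have "\<dots> = N - 1" using that by simp
      finally show ?thesis .
    qed
    hence "Polynomial.degree ?P \<le> N - 1"
      by (intro degree_sum_le) (auto intro: le_trans[OF degree_smult_le])
    thus "Polynomial.degree ?P < card ((\<lambda>i. 1 / y i) ` {..<N})" using N c by simp
    show "Polynomial.degree (Polynomial.monom 1 (N - 1) :: real poly) < card ((\<lambda>i. 1 / y i) ` {..<N})"
      using N c by (simp add: degree_monom_eq)
    fix x assume "x \<in> (\<lambda>i. 1 / y i) ` {..<N}"
    then obtain j where j: "j < N" "x = 1 / y j" by auto
    have z: "(\<Prod>q\<in>{..<N} - {i}. 1 - x * y q) = 0" if "i < N" "i \<noteq> j" for i
      using that j nz[of j] by (intro prod_zero) (auto intro!: bexI[of _ j])
    have "poly ?P x = (\<Sum>i<N. 1 / ?D i * (\<Prod>q\<in>{..<N} - {i}. 1 - x * y q))"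
      by (simp add: poly_sum poly_prod)
    also have "\<dots> = 1 / ?D j * (\<Prod>q\<in>{..<N} - {j}. 1 - x * y q)"
    proof -
      have "(\<Sum>i<N. 1 / ?D i * (\<Prod>q\<in>{..<N} - {i}. 1 - x * y q)) =
         1 / ?D j * (\<Prod>q\<in>{..<N} - {j}. 1 - x * y q) +
         (\<Sum>i\<in>{..<N} - {j}. 1 / ?D i * (\<Prod>q\<in>{..<N} - {i}. 1 - x * y q))"
        using j by (intro sum.remove) auto
      also have "(\<Sum>i\<in>{..<N} - {j}. 1 / ?D i * (\<Prod>q\<in>{..<N} - {i}. 1 - x * y q)) = 0"
      proof (rule sum.neutral, rule ballI)
        fix i assume "i \<in> {..<N} - {j}"
        hence "(\<Prod>q\<in>{..<N} - {i}. 1 - x * y q) = 0" by (intro z) auto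
        thus "1 / ?D i * (\<Prod>q\<in>{..<N} - {i}. 1 - x * y q) = 0" by (simp only: mult_zero_right)
      qed
      finally show ?thesis by (simp only: add_0_right)
    qed
    also have "(\<Prod>q\<in>{..<N} - {j}. 1 - x * y q) = (\<Prod>q\<in>{..<N} - {j}. (1 / y j) * (y j - y q))"
      using j nz[of j] by (intro prod.cong) (auto simp: field_simps)
    also have "\<dots> = (1 / y j) ^ (N - 1) * ?D j"
      unfolding prod.distrib using j by simp
    finally show "poly ?P x = poly (Polynomial.monom 1 (N - 1)) x"
      using D[of j] j by (simp add: poly_monom)
  qed
  have L: "fps_of_poly [:1, - y q:] = ?L q" for q
    by (simp add: fps_of_poly_linear' flip: fps_const_neg)
  have inv: "inverse ?B * (\<Prod>q\<in>{..<N} - {i}. ?L q) = inverse (?L i)" if "i < N" for i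
  proof -
    have "?B = ?L i * (\<Prod>q\<in>{..<N} - {i}. ?L q)" using that by (intro prod.remove) auto
    hence "inverse ?B * (\<Prod>q\<in>{..<N} - {i}. ?L q) =
        inverse (?L i) * (inverse (\<Prod>q\<in>{..<N} - {i}. ?L q) * (\<Prod>q\<in>{..<N} - {i}. ?L q))"
      by (simp add: fps_inverse_mult mult.assoc)
    also have "inverse (\<Prod>q\<in>{..<N} - {i}. ?L q) * (\<Prod>q\<in>{..<N} - {i}. ?L q) = 1"
      by (intro inverse_mult_eq_1) (simp add: fps_prod_nth_0)
    finally show ?thesis by simp
  qed
  have g: "fps_nth (inverse (?L i)) r = y i ^ r" for i
  proof -
    have "inverse (?L i) = Abs_fps (\<lambda>n. y i ^ n)"
    proof (rule fps_inverse_unique)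
      show "?L i * Abs_fps (\<lambda>n. y i ^ n) = 1"
      proof (rule fps_ext)
        fix n show "fps_nth (?L i * Abs_fps (\<lambda>n. y i ^ n)) n = fps_nth 1 n"
          by (cases n) (auto simp: left_diff_distrib mult.assoc)
      qed
    qed
    thus ?thesis by simp
  qed
  have "fps_X ^ (N - 1) = fps_of_poly ?P" by (simp add: Peq fps_of_poly_monom')
  also have "\<dots> = (\<Sum>i<N. fps_const (1 / ?D i) * (\<Prod>q\<in>{..<N} - {i}. ?L q))"
    by (simp only: fps_of_poly_sum fps_of_poly_smult fps_of_poly_prod L)
  finally have "fps_X ^ (N - 1) * inverse ?B =
     (\<Sum>i<N. fps_const (1 / ?D i) * (inverse ?B * (\<Prod>q\<in>{..<N} - {i}. ?L q)))"
    by (simp only: sum_distrib_left mult_ac)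
  also have "\<dots> = (\<Sum>i<N. fps_const (1 / ?D i) * inverse (?L i))"
    by (intro sum.cong) (auto simp: inv)
  finally show ?thesis by (simp add: fps_sum_nth g)
qed

text \<open>A factor y i + c in the summands becomes a factor 1 + c X of the generating function
  together with an index shift by one.\<close>

lemma sum_shifted_eq_fps_nth:
  fixes y c :: "nat \<Rightarrow> real"
  assumes "\<And>r. (\<Sum>i<N. y i ^ r / d i) = fps_nth G r"
  shows "(\<Sum>i<N. (\<Prod>s<M. y i + c s) * y i ^ k / d i) =
     fps_nth ((\<Prod>s<M. 1 + fps_const (c s) * fps_X) * G) (k + M)"
proof (induction M arbitrary: k)
  case (Suc M)
  let ?W = "\<Prod>s<M. 1 + fps_const (c s) * fps_X"
  have "(\<Sum>i<N. (\<Prod>s<Suc M. y i + c s) * y i ^ k / d i) =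
     (\<Sum>i<N. (\<Prod>s<M. y i + c s) * y i ^ Suc k / d i) + c M * (\<Sum>i<N. (\<Prod>s<M. y i + c s) * y i ^ k / d i)"
    by (simp add: sum_distrib_left algebra_simps add_divide_distrib flip: sum.distrib)
  also have "\<dots> = fps_nth (?W * G) (Suc k + M) + c M * fps_nth (?W * G) (k + M)"
    unfolding Suc ..
  also have "\<dots> = fps_nth ((1 + fps_const (c M) * fps_X) * (?W * G)) (k + Suc M)"
    by (simp add: distrib_right mult.assoc)
  finally show ?case by (simp add: mult_ac)
qed (use assms in simp)

text \<open>The quotient of the shifted factorial product of length M by the numerator of
  \<open>Hfps N\<close>; by \<open>falling_prod_split\<close> it depends only on c = M - N. It
  carries the lower order terms that separate Aitken's determinant from the Jacobi-Trudi
  determinant.\<close>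

definition Qfps :: "int \<Rightarrow> real fps" where
  "Qfps c = (if c \<ge> 0 then (\<Prod>s<nat c. 1 - fps_const (real s + 1/2) * fps_X)
     else inverse (\<Prod>s<nat (- c). 1 + fps_const (real s + 1/2) * fps_X))"

lemma Qfps_nth_0 [simp]: "fps_nth (Qfps c) 0 = 1"
  by (simp add: Qfps_def fps_prod_nth_0)

lemma falling_prod_split:
  "(\<Prod>s<M. 1 + fps_const (real N - 1/2 - real s) * fps_X) =
   (\<Prod>i<N. 1 + fps_const (real i + 1/2) * fps_X) * Qfps (int M - int N)"
proof -
  let ?W = "\<lambda>M. \<Prod>s<M. 1 + fps_const (real N - 1/2 - real s) * fps_X :: real fps"
  let ?R = "\<lambda>n. \<Prod>i<n. 1 + fps_const (real i + 1/2) * fps_X :: real fps"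
  have low: "?W M * ?R (N - M) = ?R N" if "M \<le> N" for M
    using that
  proof (induction M)
    case (Suc M)
    have e: "N - M = Suc (N - Suc M)" using Suc.prems by simp
    have "real (N - Suc M) + 1/2 = real N - 1/2 - real M" using Suc.prems by (simp add: of_nat_diff)
    hence "?R (N - M) = ?R (N - Suc M) * (1 + fps_const (real N - 1/2 - real M) * fps_X)"
      by (simp only: e prod.lessThan_Suc)
    hence "?W (Suc M) * ?R (N - Suc M) = ?W M * ?R (N - M)"
      by (simp only: prod.lessThan_Suc mult_ac)
    thus ?case using Suc by simp
  qed simp
  show ?thesis
  proof (cases "M \<ge> N")
    case True
    have "?W (N + d) = ?R N * (\<Prod>s<d. 1 - fps_const (real s + 1/2) * fps_X)" for d
    proof (induction d)
      case 0 thus ?case using low[of N] by simp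
    next
      case (Suc d)
      have "1 + fps_const (real N - 1/2 - real (N + d)) * fps_X = 1 - fps_const (real d + 1/2) * fps_X"
      proof -
        have "real N - 1/2 - real (N + d) = - (real d + 1/2)" by simp
        thus ?thesis by (simp only: fps_const_neg[symmetric]) simp
      qed
      thus ?case using Suc by (simp only: add_Suc_right prod.lessThan_Suc mult_ac)
    qed
    from this[of "M - N"] True show ?thesis by (simp add: Qfps_def nat_diff_distrib)
  next
    case False
    have "?R N * inverse (?R (N - M)) = ?W M * (inverse (?R (N - M)) * ?R (N - M))"
      using low[of M] False by (simp add: mult_ac)
    also have "inverse (?R (N - M)) * ?R (N - M) = 1"
      by (intro inverse_mult_eq_1) (simp add: fps_prod_nth_0)
    finally have "?W M = ?R N * inverse (?R (N - M))" by simp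
    moreover have "nat (- (int M - int N)) = N - M" using False by simp
    ultimately show ?thesis using False by (simp add: Qfps_def)
  qed
qed

text \<open>The falling factorial is a polynomial of degree \<open>M\<close> in \<open>L\<close>;
  for L < M it has a zero factor, in agreement with the convention for \<open>ifact\<close>.\<close>

lemma ifact_falling: "ifact (int L - int M) = (\<Prod>s<M. real L - real s) / fact L"
proof (induction M)
  case (Suc M)
  have "ifact (int L - int (Suc M)) = of_int (int L - int M) * ifact (int L - int M)"
    using ifact_pred[of "int L - int M"] by (simp add: algebra_simps)
  thus ?case by (simp add: Suc)
qed (simp add: ifact_def)

definition cint :: "real fps \<Rightarrow> int \<Rightarrow> real" where
  "cint F e = (if e < 0 then 0 else fps_nth F (nat e))"

lemma yy_inj:
  assumes l: "is_partition l" shows "inj_on (yy l) {..<N}"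
proof (rule linorder_inj_onI)
  fix i j :: nat assume "i < j"
  thus "yy l i \<noteq> yy l j" using rowlen_antimono[OF l, of i j] by (simp add: yy_def)
qed auto

lemma yy_nz: "yy l i \<noteq> 0"
proof
  assume "yy l i = 0"
  hence "real (2 * rowlen l i) = real (2 * i + 1)" by (simp add: yy_def)
  hence "2 * rowlen l i = 2 * i + 1" by (simp only: of_nat_eq_iff)
  thus False by presburger
qed

text \<open>The multiplier has entries L_i! y_i^k / prod (y_i - y_q), with L_i = lambda_i - i + N -
  1 for 0-based i. The factorial turns Aitken's entries into falling factorials, and the remaining
  factor extracts coefficients of the generating function. Its determinant is \<open>R\<close>, the
  same for all \<open>m\<close>.\<close>

lemma fdet_mult_det:
  assumes l: "is_partition l" and N: "N > 0"
  shows "\<exists>R. \<forall>m. fdet N (xs l) (xs m) * R =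
     Determinant.det (Matrix.mat N N (\<lambda>(j, k). cint (Qfps (xs m j - 1) * Hfps N l) (xs m j + int k)))"
proof -
  define d where "d i = (\<Prod>q\<in>{..<N} - {i}. yy l i - yy l q)" for i
  define L where "L i = nat (xs l i + int N - 1)" for i
  define Rm where "Rm = Matrix.mat N N (\<lambda>(i, k). fact (L i) * (yy l i ^ k / d i))"
  let ?E = "\<lambda>m. Matrix.mat N N (\<lambda>(j, k). cint (Qfps (xs m j - 1) * Hfps N l) (xs m j + int k))"
  let ?C = "\<lambda>m. Matrix.mat N N (\<lambda>(i, j). ifact (xs l i - xs m j))"
  have "fdet N (xs l) (xs m) * Determinant.det Rm = Determinant.det (?E m)" for m
  proof -
    have "transpose_mat (?C m) * Rm = ?E m"
    proof (rule eq_matI)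
      fix j k assume "j < dim_row (?E m)" "k < dim_col (?E m)"
      hence jk: "j < N" "k < N" by auto
      define M where "M = nat (xs m j + int N - 1)"
      have M: "int M = xs m j + int N - 1" using xs_ge[of j m] jk by (simp add: M_def)
      have Li: "int (L i) = xs l i + int N - 1" "real (L i) = yy l i + (real N - 1/2)" if "i < N" for i
      proof -
        show *: "int (L i) = xs l i + int N - 1" using xs_ge[of i l] that by (simp add: L_def)
        hence "real (L i) = real_of_int (xs l i + int N - 1)" by (metis of_int_of_nat_eq)
        thus "real (L i) = yy l i + (real N - 1/2)" by (simp add: xs_def yy_def)
      qed
      have "(transpose_mat (?C m) * Rm) $$ (j, k) = (\<Sum>i<N. ifact (xs l i - xs m j) * (fact (L i) * (yy l i ^ k / d i)))"
        using jk by (simp add: Rm_def scalar_prod_def atLeast0LessThan)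
      also have "\<dots> = (\<Sum>i<N. (\<Prod>s<M. yy l i + (real N - 1/2 - real s)) * yy l i ^ k / d i)"
      proof (rule sum.cong)
        fix i assume "i \<in> {..<N}"
        hence i: "i < N" by simp
        have "xs l i - xs m j = int (L i) - int M" using Li[OF i] M by simp
        hence "ifact (xs l i - xs m j) * fact (L i) = (\<Prod>s<M. real (L i) - real s)"
          by (simp add: ifact_falling)
        also have "\<dots> = (\<Prod>s<M. yy l i + (real N - 1/2 - real s))"
          unfolding Li(2)[OF i] by (simp add: algebra_simps)
        finally show "ifact (xs l i - xs m j) * (fact (L i) * (yy l i ^ k / d i)) =
            (\<Prod>s<M. yy l i + (real N - 1/2 - real s)) * yy l i ^ k / d i"
          by (simp only: mult.assoc[symmetric] times_divide_eq_right)
      qed simp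
      also have "\<dots> = fps_nth ((\<Prod>s<M. 1 + fps_const (real N - 1/2 - real s) * fps_X) *
          (fps_X ^ (N - 1) * inverse (\<Prod>i<N. 1 - fps_const (yy l i) * fps_X))) (k + M)"
        unfolding d_def
        by (rule sum_shifted_eq_fps_nth[OF sum_powers_eq_fps_nth]) (use yy_inj[OF l] yy_nz N in auto)
      also have "\<dots> = fps_nth (fps_X ^ (N - 1) * (Qfps (int M - int N) * Hfps N l)) (k + M)"
        unfolding falling_prod_split Hfps_def by (simp only: mult_ac)
      also have "\<dots> = (if k + M < N - 1 then 0 else fps_nth (Qfps (int M - int N) * Hfps N l) (k + M - (N - 1)))"
        by (simp add: fps_X_power_mult_nth)
      also have "\<dots> = cint (Qfps (xs m j - 1) * Hfps N l) (xs m j + int k)"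
      proof -
        have "int M - int N = xs m j - 1" using M by simp
        moreover have "k + M < N - 1 \<longleftrightarrow> xs m j + int k < 0" using M N by linarith
        moreover have "k + M - (N - 1) = nat (xs m j + int k)" using M N by linarith
        ultimately show ?thesis by (simp add: cint_def)
      qed
      finally show "(transpose_mat (?C m) * Rm) $$ (j, k) = ?E m $$ (j, k)" using jk by simp
    qed (auto simp: Rm_def)
    moreover have "Determinant.det (transpose_mat (?C m) * Rm) = Determinant.det (transpose_mat (?C m)) * Determinant.det Rm"
      by (rule det_mult[of _ N]) (auto simp: Rm_def)
    moreover have "Determinant.det (transpose_mat (?C m)) = fdet N (xs l) (xs m)"
      unfolding fdet_eq_det by (rule det_transpose[of _ N]) auto
    ultimately show ?thesis by simp
  qed
  thus ?thesis by blast
qed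

lemma cint_triangular:
  assumes "length m \<le> j" "fps_nth F 0 = 1"
  shows "k < j \<Longrightarrow> cint F (xs m j + int k) = 0" "cint F (xs m j + int j) = 1"
  using assms by (auto simp: cint_def xs_def rowlen_eq_0)

lemma Hfps_nth_0 [simp]: "fps_nth (Hfps N l) 0 = 1"
  by (simp add: Hfps_def fps_prod_nth_0)

text \<open>For empty \<open>m\<close> the right-hand matrix is unitriangular, so \<open>R\<close>
  is the inverse of \<open>fdet N (xs l) (xs [])\<close>. For general \<open>m\<close> the rows from
  \<open>length m\<close> on form a unitriangular block, which reduces the determinant to size
  \<open>length m\<close>.\<close>

lemma fdet_ratio:
  assumes l: "is_partition l" and N: "length m < N"
  shows "fdet N (xs l) (xs m) = fdet N (xs l) (xs []) *
    (\<Sum>p | p permutes {..<length m}. of_int (sign p) *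
       (\<Prod>j<length m. cint (Qfps (xs m j - 1) * Hfps N l) (xs m j + int (p j))))"
proof -
  let ?e = "\<lambda>m j k. cint (Qfps (xs m j - 1) * Hfps N l) (xs m j + int k)"
  let ?E = "\<lambda>m. Matrix.mat N N (\<lambda>(j, k). ?e m j k)"
  obtain R where R: "\<And>m. fdet N (xs l) (xs m) * R = Determinant.det (?E m)"
    using fdet_mult_det[OF l, of N] N by auto
  have tri: "Determinant.det (Matrix.mat (N - L) (N - L) (\<lambda>(j, k). ?e m (j + L) (k + L))) = 1"
    if "length m \<le> L" for L m
  proof -
    let ?A = "Matrix.mat (N - L) (N - L) (\<lambda>(j, k). ?e m (j + L) (k + L))"
    have "Determinant.det ?A = prod_list (diag_mat ?A)"
      using that cint_triangular(1)[of m] by (intro det_upper_triangular[of _ "N - L"]) (auto simp del: of_nat_add)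
    also have "\<dots> = 1"
      unfolding prod_list_diag_prod
      using that cint_triangular(2)[of m] by (intro prod.neutral) (auto simp del: of_nat_add)
    finally show ?thesis .
  qed
  have one: "fdet N (xs l) (xs []) * R = 1"
    using R[of "[]"] tri[of "[]" 0] by simp
  let ?L = "length m"
  let ?E11 = "Matrix.mat ?L ?L (\<lambda>(j, k). ?e m j k)"
  have "?E m = four_block_mat ?E11 (Matrix.mat ?L (N - ?L) (\<lambda>(j, k). ?e m j (k + ?L))) (0\<^sub>m (N - ?L) ?L)
     (Matrix.mat (N - ?L) (N - ?L) (\<lambda>(j, k). ?e m (j + ?L) (k + ?L)))"
    using N cint_triangular(1)[of m] by (intro eq_matI) (auto simp: not_less)
  hence "Determinant.det (?E m) = Determinant.det ?E11 * 1"
    using tri[of m ?L] by (simp add: det_four_block_mat_lower_left_zero[of _ ?L _ "N - ?L"])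
  hence "fdet N (xs l) (xs m) * R = Determinant.det ?E11" using R by simp
  hence "fdet N (xs l) (xs m) = fdet N (xs l) (xs []) * Determinant.det ?E11"
    using one by (metis mult.assoc mult.commute mult.left_neutral)
  also have "Determinant.det ?E11 = (\<Sum>p | p permutes {..<?L}. of_int (sign p) * (\<Prod>j<?L. ?e m j (p j)))"
  proof -
    have "(\<Prod>j<?L. ?E11 $$ (j, p j)) = (\<Prod>j<?L. ?e m j (p j))" if "p permutes {..<?L}" for p
      using permutes_in_image[OF that] by (intro prod.cong) auto
    thus ?thesis by (subst det_def'[of _ ?L]) (auto simp: atLeast0LessThan)
  qed
  finally show ?thesis .
qed

text \<open>The rescaled matrix entry. With \<open>\<tau>\<close> = 1/n it is h_e plus corrections
  of order 1/n weighted by the coefficients of \<open>Qfps c\<close>.\<close>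

definition theta :: "real \<Rightarrow> int \<Rightarrow> int \<Rightarrow> thoma \<Rightarrow> real" where
  "theta \<tau> c e w = (if e < 0 then 0 else
     (\<Sum>s\<le>nat e. fps_nth (Qfps c) s * \<tau> ^ s * hcirc (nat e - s) w))"

lemma cint_eq_theta:
  assumes "l \<in> YD n" "n > 0" "length l \<le> N"
  shows "cint (Qfps c * Hfps N l) e = real n ^ nat e * theta (1 / real n) c e (embed n l)"
proof (cases "e < 0")
  case False
  have "fps_nth (Qfps c * Hfps N l) (nat e) =
     (\<Sum>s\<le>nat e. fps_nth (Qfps c) s * (real n ^ (nat e - s) * hcirc (nat e - s) (embed n l)))"
    by (simp add: fps_mult_nth Hfps_nth[OF assms] atLeast0AtMost)
  also have "\<dots> = (\<Sum>s\<le>nat e. real n ^ nat e * (fps_nth (Qfps c) s * (1 / real n) ^ s * hcirc (nat e - s) (embed n l)))"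
    using assms(2) by (intro sum.cong) (auto simp: power_diff power_divide)
  finally show ?thesis using False by (simp add: cint_def theta_def sum_distrib_left)
qed (simp add: cint_def theta_def)

text \<open>A perturbed Jacobi-Trudi determinant: on the simplex, \<open>\<tau>\<close> = 0 gives
  \<open>scirc m\<close>.\<close>

definition approx_s :: "real \<Rightarrow> nat list \<Rightarrow> thoma \<Rightarrow> real" where
  "approx_s \<tau> m w = (\<Sum>p | p permutes {..<length m}. of_int (sign p) *
       (\<Prod>j<length m. theta \<tau> (xs m j - 1) (xs m j + int (p j)) w))"

lemma rdim_eq_approx:
  assumes l: "l \<in> YD n" and n: "n > 0" "sum_list m \<le> n" and N: "n < N" and m: "is_partition m"
  shows "rdim N m l = real n ^ sum_list m * fact (n - sum_list m) / fact n * approx_s (1 / real n) m (embed n l)"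
proof -
  let ?L = "length m"
  have lp: "is_partition l" "sum_list l = n" using l by (auto simp: YD_def)
  have ll: "length l < N" using length_le_sum_list[OF lp(1)] lp N by simp
  have ml: "length m < N" using length_le_sum_list[OF m] n N by simp
  have pr: "(\<Prod>j<?L. cint (Qfps (xs m j - 1) * Hfps N l) (xs m j + int (p j))) =
     real n ^ sum_list m * (\<Prod>j<?L. theta (1 / real n) (xs m j - 1) (xs m j + int (p j)) (embed n l))"
    if p: "p permutes {..<?L}" for p
  proof (cases "\<exists>j<?L. xs m j + int (p j) < 0")
    case True
    then obtain j where j: "j < ?L" "xs m j + int (p j) < 0" by blast
    have "(\<Prod>j<?L. cint (Qfps (xs m j - 1) * Hfps N l) (xs m j + int (p j))) = 0"
      using j by (intro prod_zero) (auto simp: cint_def)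
    moreover have "(\<Prod>j<?L. theta (1 / real n) (xs m j - 1) (xs m j + int (p j)) (embed n l)) = 0"
      using j by (intro prod_zero) (auto simp: theta_def)
    ultimately show ?thesis by (simp only: mult_zero_right)
  next
    case False
    have "int (\<Sum>j<?L. nat (xs m j + int (p j))) = (\<Sum>j<?L. xs m j + int (p j))"
      unfolding of_nat_sum using False by (intro sum.cong refl) (meson lessThan_iff nat_0_le not_less)
    also have "\<dots> = (\<Sum>j<?L. xs m j) + (\<Sum>j<?L. int (p j))" by (simp add: sum.distrib)
    also have "(\<Sum>j<?L. int (p j)) = (\<Sum>j<?L. int j)"
      using sum.permute[OF p, of int] by (simp add: o_def)
    also have "(\<Sum>j<?L. xs m j) = int (sum_list m) - (\<Sum>j<?L. int j)" by (rule sum_xs) simp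
    \<comment> \<open>Every surviving permutation has total degree |m|, so a common power of n
      factors out of the determinant.\<close>
    finally have e: "(\<Sum>j<?L. nat (xs m j + int (p j))) = sum_list m"
      by (simp only: diff_add_cancel of_nat_eq_iff)
    have "(\<Prod>j<?L. cint (Qfps (xs m j - 1) * Hfps N l) (xs m j + int (p j))) =
       (\<Prod>j<?L. real n ^ nat (xs m j + int (p j)) * theta (1 / real n) (xs m j - 1) (xs m j + int (p j)) (embed n l))"
      using cint_eq_theta[OF l n(1)] ll by simp
    also have "\<dots> = real n ^ sum_list m * (\<Prod>j<?L. theta (1 / real n) (xs m j - 1) (xs m j + int (p j)) (embed n l))"
      by (simp add: prod.distrib e flip: power_sum)
    finally show ?thesis .
  qed
  have "fdet N (xs l) (xs m) = fdet N (xs l) (xs []) * (real n ^ sum_list m * approx_s (1 / real n) m (embed n l))"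
    unfolding fdet_ratio[OF lp(1) ml] approx_s_def sum_distrib_left
    by (intro sum.cong) (auto simp: pr)
  moreover have "real (dimY l) = fact n * fdet N (xs l) (xs [])"
    using dimY_eq_fdet[OF lp(1) ll] lp by simp
  moreover have "real (dimY l) > 0" using dimY_pos[OF lp(1)] by simp
  ultimately show ?thesis using lp by (auto simp: rdim_def)
qed

section \<open>Bounds on the Thoma simplex and uniform approximation\<close>

lemma Thoma_summable:
  assumes "w \<in> Thoma"
  shows "summable (fst w)" "summable (snd w)" "suminf (fst w) + suminf (snd w) \<le> 1"
    "\<And>i. 0 \<le> fst w i" "\<And>i. 0 \<le> snd w i" "\<And>i. fst w i \<le> 1" "\<And>i. snd w i \<le> 1"
proof -
  have nn: "0 \<le> fst w i" "0 \<le> snd w i" and le: "(\<Sum>i<n. fst w i + snd w i) \<le> 1" for i n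
    using assms by (auto simp: Thoma_def)
  have s: "summable (\<lambda>i. fst w i + snd w i)"
    using nn le by (intro bounded_imp_summable[of _ 1]) (auto simp only: lessThan_Suc_atMost[symmetric] add_nonneg_nonneg)
  show sf: "summable (fst w)"
    by (rule summable_comparison_test_ev[OF _ s]) (auto simp: nn)
  show ss: "summable (snd w)"
    by (rule summable_comparison_test_ev[OF _ s]) (auto simp: nn)
  have "suminf (fst w) + suminf (snd w) = (\<Sum>i. fst w i + snd w i)"
    by (rule suminf_add[OF sf ss])
  also have "\<dots> \<le> 1" using s le by (rule suminf_le_const)
  finally show "suminf (fst w) + suminf (snd w) \<le> 1" .
  fix i
  show "0 \<le> fst w i" "0 \<le> snd w i" by (rule nn)+
  have "fst w i + snd w i \<le> (\<Sum>i<Suc i. fst w i + snd w i)"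
    using nn by (intro member_le_sum) auto
  also have "\<dots> \<le> 1" by (rule le)
  finally show "fst w i \<le> 1" "snd w i \<le> 1" using nn[of i] by auto
qed

lemma power_le_self: "0 \<le> (x::real) \<Longrightarrow> x \<le> 1 \<Longrightarrow> k \<ge> 1 \<Longrightarrow> x ^ k \<le> x"
  using power_decreasing[of 1 k x] by simp

lemma pcirc_bounded:
  assumes w: "w \<in> Thoma" and k: "k \<ge> 1"
  shows "\<bar>pcirc k w\<bar> \<le> 1"
proof (cases "k = 1")
  case False
  note T = Thoma_summable[OF w]
  have s: "summable (\<lambda>i. fst w i ^ k)" "summable (\<lambda>i. snd w i ^ k)"
    by (rule summable_comparison_test_ev[OF _ T(1)], use T k in \<open>auto intro!: always_eventually power_le_self\<close>)
      (rule summable_comparison_test_ev[OF _ T(2)], use T k in \<open>auto intro!: always_eventually power_le_self\<close>)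
  have "(\<Sum>i. fst w i ^ k) \<le> suminf (fst w)" "(\<Sum>i. snd w i ^ k) \<le> suminf (snd w)"
    using T k s by (auto intro!: suminf_le power_le_self)
  moreover have "0 \<le> (\<Sum>i. fst w i ^ k)" "0 \<le> (\<Sum>i. snd w i ^ k)"
    using T s by (auto intro!: suminf_nonneg)
  moreover have "\<bar>pcirc k w\<bar> \<le> \<bar>\<Sum>i. fst w i ^ k\<bar> + \<bar>(-1) ^ (k - 1) * (\<Sum>i. snd w i ^ k)\<bar>"
    using False unfolding pcirc_def by (simp add: abs_triangle_ineq)
  ultimately show ?thesis using T(3) by (simp add: abs_mult power_abs)
qed (simp add: pcirc_def)

lemma hcirc_bounded: "bounded (hcirc r ` Thoma)"
proof -
  have "\<bar>hcirc r w\<bar> \<le> (\<Sum>M\<in>MP r. 1 / zM M)" if w: "w \<in> Thoma" for w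
  proof -
    have "\<bar>\<Prod>k\<in>#M. pcirc k w\<bar> \<le> 1" if "0 \<notin># M" for M
      using that
    proof (induction M)
      case (add k M)
      hence "\<bar>pcirc k w\<bar> \<le> 1" by (intro pcirc_bounded[OF w]) auto
      hence "\<bar>pcirc k w\<bar> * \<bar>\<Prod>k\<in>#M. pcirc k w\<bar> \<le> 1 * 1"
        using add by (intro mult_mono) auto
      thus ?case by (simp add: abs_mult)
    qed simp
    hence "\<bar>\<Prod>k\<in>#M. pcirc k w\<bar> / zM M \<le> 1 / zM M" if "M \<in> MP r" for M
      using that zM_pos[of M] by (intro divide_right_mono) (auto simp: MP_def)
    moreover have "\<bar>(\<Prod>k\<in>#M. pcirc k w) / zM M\<bar> = \<bar>\<Prod>k\<in>#M. pcirc k w\<bar> / zM M" if "M \<in> MP r" for M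
      using zM_pos[of M] that by (simp only: abs_divide) (simp add: MP_def)
    ultimately show ?thesis
      unfolding hcirc_eq_hpow hpow_def
      by (intro order.trans[OF sum_abs] sum_mono) (simp only:)
  qed
  thus ?thesis unfolding bounded_iff by (metis imageE real_norm_def)
qed

text \<open>Boundedness of the limit is carried along because it makes uniform convergence stable
  under products.\<close>

definition ulb :: "(nat \<Rightarrow> thoma \<Rightarrow> real) \<Rightarrow> (thoma \<Rightarrow> real) \<Rightarrow> bool" where
  "ulb f g \<longleftrightarrow> uniform_limit Thoma f g sequentially \<and> bounded (g ` Thoma)"

lemma ulb_const: "c \<longlonglongrightarrow> d \<Longrightarrow> ulb (\<lambda>n w. c n) (\<lambda>w. d)"
  unfolding ulb_def
  by (auto simp: uniform_limit_iff tendsto_iff image_constant_conv elim!: eventually_mono)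

lemma ulb_fixed: "bounded (g ` Thoma) \<Longrightarrow> ulb (\<lambda>n. g) g"
  unfolding ulb_def by (auto intro: uniform_limit_const)

lemma ulb_add: "ulb f g \<Longrightarrow> ulb f' g' \<Longrightarrow> ulb (\<lambda>n w. f n w + f' n w) (\<lambda>w. g w + g' w)"
  unfolding ulb_def by (auto intro: uniform_limit_add bounded_plus_comp)

lemma ulb_mult: "ulb f g \<Longrightarrow> ulb f' g' \<Longrightarrow> ulb (\<lambda>n w. f n w * f' n w) (\<lambda>w. g w * g' w)"
  unfolding ulb_def
proof (elim conjE, intro conjI)
  assume b: "bounded (g ` Thoma)" "bounded (g' ` Thoma)"
    and u: "uniform_limit Thoma f g sequentially" "uniform_limit Thoma f' g' sequentially"
  show "uniform_limit Thoma (\<lambda>n w. f n w * f' n w) (\<lambda>w. g w * g' w) sequentially"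
    by (rule uniform_lim_mult[OF u b])
  obtain K K' where K: "\<forall>w\<in>Thoma. \<bar>g w\<bar> \<le> K" "\<forall>w\<in>Thoma. \<bar>g' w\<bar> \<le> K'"
    using b by (auto simp: bounded_iff)
  show "bounded ((\<lambda>w. g w * g' w) ` Thoma)"
    unfolding bounded_iff
  proof (intro exI[of _ "K * K'"] ballI, clarify)
    fix a b assume "(a, b) \<in> Thoma"
    thus "norm (g (a, b) * g' (a, b)) \<le> K * K'"
      using K by (auto simp: abs_mult intro!: mult_mono' order.trans[OF abs_ge_zero])
  qed
qed

lemma ulb_sum: "(\<And>i. i \<in> I \<Longrightarrow> ulb (f i) (g i)) \<Longrightarrow> ulb (\<lambda>n w. \<Sum>i\<in>I. f i n w) (\<lambda>w. \<Sum>i\<in>I. g i w)"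
  by (induction I rule: infinite_finite_induct) (auto intro: ulb_add ulb_const)

lemma ulb_prod: "(\<And>i. i \<in> I \<Longrightarrow> ulb (f i) (g i)) \<Longrightarrow> ulb (\<lambda>n w. \<Prod>i\<in>I. f i n w) (\<lambda>w. \<Prod>i\<in>I. g i w)"
  by (induction I rule: infinite_finite_induct) (auto intro: ulb_mult ulb_const)

lemma ulb_cong:
  assumes "ulb f g" "\<And>n w. w \<in> Thoma \<Longrightarrow> f n w = f' n w" "\<And>w. w \<in> Thoma \<Longrightarrow> g w = g' w"
  shows "ulb f' g'"
proof -
  have "g' ` Thoma = g ` Thoma" using assms(3) by (auto simp: image_iff) 
  thus ?thesis using assms uniform_limit_cong'[of Thoma f f' g g' sequentially] by (simp add: ulb_def)
qed

text \<open>Only the term s = 0 survives in the limit, and the constant coefficient of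
  \<open>Qfps c\<close> is 1.\<close>

lemma ulb_theta: "ulb (\<lambda>n. theta (1 / real n) c e) (hcirc_int e)"
proof (cases "e < 0")
  case True
  thus ?thesis using ulb_const[of "\<lambda>_. 0" 0] by (simp add: theta_def hcirc_int_def[abs_def] theta_def[abs_def])
next
  case False
  have lim: "(\<lambda>n. (1 / real n) ^ s) \<longlonglongrightarrow> (if s = 0 then 1 else 0)" for s
  proof -
    have "(\<lambda>n. (1 / real n) ^ s) \<longlonglongrightarrow> 0 ^ s"
      by (intro tendsto_power lim_1_over_n)
    thus ?thesis by (simp only: power_0_left)
  qed
  have "ulb (\<lambda>n w. \<Sum>s\<le>nat e. fps_nth (Qfps c) s * (1 / real n) ^ s * hcirc (nat e - s) w)
     (\<lambda>w. \<Sum>s\<le>nat e. fps_nth (Qfps c) s * (if s = 0 then 1 else 0) * hcirc (nat e - s) w)"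
    by (intro ulb_sum ulb_mult ulb_fixed[OF hcirc_bounded] ulb_const lim tendsto_const)
  thus ?thesis
  proof (rule ulb_cong)
    fix w
    have "(\<Sum>s\<le>nat e. fps_nth (Qfps c) s * (if s = 0 then 1 else 0) * hcirc (nat e - s) w) =
       (\<Sum>s\<le>nat e. if s = 0 then hcirc (nat e) w else 0)"
      by (intro sum.cong) auto
    thus "(\<Sum>s\<le>nat e. fps_nth (Qfps c) s * (if s = 0 then 1 else 0) * hcirc (nat e - s) w) = hcirc_int e w"
      using False by (simp add: hcirc_int_def)
  qed (use False in \<open>simp add: theta_def\<close>)
qed

lemma ulb_approx_s: "ulb (\<lambda>n. approx_s (1 / real n) m) (scirc m)"
proof -
  have "ulb (\<lambda>n w. \<Sum>p | p permutes {..<length m}. of_int (sign p) *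
       (\<Prod>j<length m. theta (1 / real n) (xs m j - 1) (xs m j + int (p j)) w))
     (\<lambda>w. \<Sum>p | p permutes {..<length m}. of_int (sign p) *
       (\<Prod>j<length m. hcirc_int (xs m j + int (p j)) w))"
    by (intro ulb_sum ulb_mult ulb_prod ulb_theta ulb_const tendsto_const)
  thus ?thesis
    by (rule ulb_cong) (auto simp: approx_s_def scirc_def xs_def rowlen_def)
qed

lemma falling_ratio_tendsto: "(\<lambda>n. real n ^ k * fact (n - k) / fact n) \<longlonglongrightarrow> 1"
proof (induction k)
  case 0
  have "(\<lambda>n. real n ^ 0 * fact (n - 0) / fact n) = (\<lambda>n::nat. 1::real)" by (simp add: fun_eq_iff)
  thus ?case by simp
next
  case (Suc k)
  have "(\<lambda>n. real n / (real n - real k)) \<longlonglongrightarrow> 1"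
    by real_asymp
  hence "(\<lambda>n. real n ^ k * fact (n - k) / fact n * (real n / (real n - real k))) \<longlonglongrightarrow> 1 * 1"
    by (intro tendsto_mult Suc)
  moreover have "eventually (\<lambda>n. real n ^ k * fact (n - k) / fact n * (real n / (real n - real k)) =
      real n ^ Suc k * fact (n - Suc k) / fact n) sequentially"
    using eventually_gt_at_top[of k]
  proof eventually_elim
    case (elim n)
    have "fact (n - k) = (real n - real k) * fact (n - Suc k)"
      using elim fact_reduce[of "n - k", where 'a = real] by (simp add: of_nat_diff)
    thus ?case using elim by simp
  qed
  ultimately show ?case by (simp add: tendsto_cong)
qed

text \<open>The size \<open>n + 2\<close> is the smallest that \<open>rdim_symmetric\<close> allows.
  The estimate is uniform over level n because it will be averaged over the z-measure.\<close>

lemma rdim_asymptotics: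
  assumes m: "is_partition m" and m': "is_partition m'" and e: "e > 0"
  shows "\<forall>\<^sub>F n in sequentially. \<forall>l\<in>YD n.
    \<bar>rdim (n + 2) m l * rdim (n + 2) m' l - scirc m (embed n l) * scirc m' (embed n l)\<bar> < e"
proof -
  let ?a = "\<lambda>m n w. (real n ^ sum_list m * fact (n - sum_list m) / fact n) * approx_s (1 / real n) m w"
  have "ulb (?a m) (\<lambda>w. 1 * scirc m w)" for m
    by (intro ulb_mult ulb_approx_s ulb_const falling_ratio_tendsto)
  hence "ulb (\<lambda>n w. ?a m n w * ?a m' n w) (\<lambda>w. scirc m w * scirc m' w)"
    using ulb_mult by fastforce
  hence "\<forall>\<^sub>F n in sequentially. \<forall>w\<in>Thoma. dist (?a m n w * ?a m' n w) (scirc m w * scirc m' w) < e"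
    using e unfolding ulb_def by (blast dest: uniform_limitD)
  thus ?thesis
    using eventually_gt_at_top[of 0] eventually_ge_at_top[of "sum_list m"] eventually_ge_at_top[of "sum_list m'"]
  proof eventually_elim
    case (elim n)
    show ?case
    proof
      fix l assume l: "l \<in> YD n"
      have "dist (?a m n (embed n l) * ?a m' n (embed n l)) (scirc m (embed n l) * scirc m' (embed n l)) < e"
        using elim(1) embed_in_Thoma[OF l] by blast
      thus "\<bar>rdim (n + 2) m l * rdim (n + 2) m' l - scirc m (embed n l) * scirc m' (embed n l)\<bar> < e"
        using elim rdim_eq_approx[OF l, of m "n + 2"] rdim_eq_approx[OF l, of m' "n + 2"] m m'
        by (simp add: dist_real_def)
    qed
  qed
qed

section \<open>The boundary z-measure\<close>

lemma continuous_on_thoma_coord: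
  "continuous_on S (\<lambda>w::thoma. fst w i)" "continuous_on S (\<lambda>w::thoma. snd w i)"
  by (rule continuous_on_compose2[OF continuous_on_product_coordinates]; auto intro: continuous_intros)+

lemma closed_Thoma: "closed Thoma"
proof -
  have eq: "Thoma = (\<Inter>i. {w. fst w (Suc i) \<le> fst w i} \<inter> {w. snd w (Suc i) \<le> snd w i} \<inter>
       {w. 0 \<le> fst w i} \<inter> {w. 0 \<le> snd w i}) \<inter> (\<Inter>n. {w. (\<Sum>i<n. fst w i + snd w i) \<le> 1})"
    by (auto simp: Thoma_def)
  show ?thesis unfolding eq
    by (intro closed_Int closed_INT ballI closed_Collect_le continuous_on_sum continuous_on_add
        continuous_on_thoma_coord continuous_on_const)
qed

text \<open>In a nonincreasing sequence the first n + 1 terms are at least the last of them, and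
  together they sum to at most 1.\<close>

lemma Thoma_coord_le:
  assumes w: "w \<in> Thoma"
  shows "fst w n \<le> inverse (real (Suc n))" "snd w n \<le> inverse (real (Suc n))"
proof -
  note T = Thoma_summable[OF w]
  have d: "fst w j \<le> fst w i" "snd w j \<le> snd w i" if "i \<le> j" for i j
  proof -
    have "fst w (Suc i) \<le> fst w i" "snd w (Suc i) \<le> snd w i" for i
      using w by (auto simp: Thoma_def)
    thus "fst w j \<le> fst w i" "snd w j \<le> snd w i"
      using that lift_Suc_antimono_le[of "fst w"] lift_Suc_antimono_le[of "snd w"] by auto
  qed
  have "real (Suc n) * (fst w n + snd w n) = (\<Sum>i<Suc n. fst w n + snd w n)" by simp
  also have "\<dots> \<le> (\<Sum>i<Suc n. fst w i + snd w i)" using d by (intro sum_mono add_mono) auto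
  also have "\<dots> \<le> 1"
  proof -
    have "(\<Sum>i<m. fst w i + snd w i) \<le> 1" for m using w by (auto simp: Thoma_def)
    thus ?thesis .
  qed
  finally have "fst w n + snd w n \<le> inverse (real (Suc n))" by (simp add: field_simps)
  thus "fst w n \<le> inverse (real (Suc n))" "snd w n \<le> inverse (real (Suc n))"
    using T(4)[of n] T(5)[of n] by linarith+
qed

text \<open>The majorant 1/(i + 1)^2 requires k >= 2. For k = 1 the series of coordinates is not
  continuous on the simplex, because mass can spread over more and more small coordinates;
  \<open>pcirc 1\<close> is instead the constant 1.\<close>

lemma continuous_on_power_series_Thoma:
  fixes f :: "nat \<Rightarrow> thoma \<Rightarrow> real"
  assumes c: "\<And>i. continuous_on Thoma (f i)"
    and f: "\<And>i w. w \<in> Thoma \<Longrightarrow> 0 \<le> f i w \<and> f i w \<le> inverse (real (Suc i))"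
    and k: "k \<ge> 2"
  shows "continuous_on Thoma (\<lambda>w. \<Sum>i. f i w ^ k)"
proof (rule uniform_limit_theorem)
  show "\<forall>\<^sub>F n in sequentially. continuous_on Thoma (\<lambda>w. \<Sum>i<n. f i w ^ k)"
    by (intro always_eventually allI continuous_on_sum continuous_on_power c)
  show "uniform_limit Thoma (\<lambda>n w. \<Sum>i<n. f i w ^ k) (\<lambda>w. \<Sum>i. f i w ^ k) sequentially"
  proof (rule Weierstrass_m_test)
    fix i w assume w: "w \<in> Thoma"
    have "inverse (real (Suc i)) \<le> 1" by (simp add: field_simps)
    hence "f i w ^ k \<le> f i w ^ 2"
      using f[OF w, of i] k by (intro power_decreasing) auto
    also have "\<dots> \<le> inverse (real (Suc i)) ^ 2" using f[OF w, of i] by (intro power_mono) auto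
    finally show "norm (f i w ^ k) \<le> inverse (real (Suc i)) ^ 2" using f[OF w, of i] by simp
  next
    have "summable (\<lambda>i. inverse (real i ^ 2))" by (rule inverse_power_summable) simp
    thus "summable (\<lambda>i. inverse (real (Suc i)) ^ 2)"
      by (subst (asm) summable_Suc_iff[symmetric]) (simp only: power_inverse)
  qed
qed simp

lemma continuous_on_pcirc:
  assumes "k \<ge> 1" shows "continuous_on Thoma (pcirc k)"
proof (cases "k = 1")
  case False
  hence k: "k \<ge> 2" using assms by simp
  have "continuous_on Thoma (\<lambda>w. (\<Sum>i. fst w i ^ k) + (-1) ^ (k - 1) * (\<Sum>i. snd w i ^ k))"
    using Thoma_coord_le Thoma_summable(4,5) k
    by (intro continuous_on_add continuous_on_mult continuous_on_const
        continuous_on_power_series_Thoma continuous_on_thoma_coord) auto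
  thus ?thesis using False by (simp add: pcirc_def[abs_def])
qed (simp add: pcirc_def[abs_def])

lemma continuous_on_hcirc: "continuous_on Thoma (hcirc r)"
proof -
  have "continuous_on Thoma (\<lambda>w. \<Prod>k\<leftarrow>l. pcirc k w)" if "0 \<notin> set l" for l
    using that by (induction l) (auto intro!: continuous_on_mult continuous_on_pcirc simp: Suc_le_eq)
  moreover have "zcent l \<noteq> 0" if "l \<in> YD r" for l
    using zM_pos[of "mset l"] that by (auto simp: zcent_eq_zM YD_def is_partition_def)
  ultimately show ?thesis unfolding hcirc_def[abs_def]
    by (intro continuous_on_sum continuous_on_divide continuous_on_const) (auto simp: YD_def is_partition_def)
qed

lemma continuous_on_scirc: "continuous_on Thoma (scirc m)"
proof -
  have "continuous_on Thoma (hcirc_int e)" for e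
    by (cases "e < 0") (simp_all add: hcirc_int_def[abs_def] continuous_on_hcirc)
  hence "continuous_on Thoma (\<lambda>w. \<Sum>s | s permutes {..<length m}. of_int (sign s) *
        (\<Prod>i<length m. hcirc_int (int (m ! i) - int i + int (s i)) w))"
    by (intro continuous_on_sum continuous_on_mult continuous_on_const continuous_on_prod)
  thus ?thesis by (rule continuous_on_eq) (simp add: scirc_def)
qed

lemma scirc_bounded: "\<exists>K. \<forall>w. \<bar>scirc m w\<bar> \<le> K"
proof -
  have "bounded (scirc m ` Thoma)" using ulb_approx_s[of m] by (simp add: ulb_def)
  then obtain K where K: "\<And>w. w \<in> Thoma \<Longrightarrow> \<bar>scirc m w\<bar> \<le> K" by (auto simp: bounded_iff)
  have "\<bar>scirc m w\<bar> \<le> max K 0" for w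
    using K[of w] by (cases "w \<in> Thoma") (auto simp: scirc_def)
  thus ?thesis by blast
qed

lemma scirc_mult_bounded: "\<exists>K. \<forall>w. \<bar>scirc a w * scirc b w\<bar> \<le> K"
proof -
  obtain K K' where K: "\<And>w. \<bar>scirc a w\<bar> \<le> K" and K': "\<And>w. \<bar>scirc b w\<bar> \<le> K'" using scirc_bounded by metis
  have "\<bar>scirc a w * scirc b w\<bar> \<le> K * K'" for w
    unfolding abs_mult by (rule mult_mono'[OF K K']) simp_all
  thus ?thesis by blast
qed

lemma scirc_measurable [measurable]: "scirc m \<in> borel_measurable borel"
proof -
  have "(\<lambda>w. indicator Thoma w *\<^sub>R scirc m w) \<in> borel_measurable borel"
    using closed_Thoma continuous_on_scirc by (intro borel_measurable_continuous_on_indicator) auto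
  moreover have "(\<lambda>w. indicator Thoma w *\<^sub>R scirc m w) = scirc m"
    by (auto simp: fun_eq_iff indicator_def scirc_def)
  ultimately show ?thesis by simp
qed

section \<open>The z-measure for admissible parameters\<close>

locale zparam =
  fixes z z' :: complex and u t :: real
  assumes adm: "admissible z z'"
  defines "u \<equiv> Re (z + z')" and "t \<equiv> Re (z * z')"
begin

lemma sum_prod_real: "z + z' = of_real u" "z * z' = of_real t"
  using adm unfolding admissible_def u_def t_def
  by (auto simp: complex_eq_iff complex_is_Real_iff)

lemma box_weight: "(z + of_int c) * (z' + of_int c) = of_real (wt u t (of_int c))"
proof -
  have "(z + of_int c) * (z' + of_int c) = of_int c ^ 2 + (z + z') * of_int c + z * z'"
    by (simp add: algebra_simps power2_eq_square)
  thus ?thesis unfolding sum_prod_real by (simp add: wt_def)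
qed

lemma wt_pos: "wt u t (of_int c) > 0"
proof -
  have "wt u t (of_int c) = Re ((z + of_int c) * (z' + of_int c))"
    unfolding box_weight by simp
  also have "\<dots> > 0"
    using adm unfolding admissible_def
  proof (elim disjE conjE exE)
    assume "z \<notin> \<real>" "z' = cnj z"
    hence "z + of_int c \<noteq> 0" by (auto simp: complex_is_Real_iff complex_eq_iff)
    moreover have "(z + of_int c) * (z' + of_int c) = of_real (norm (z + of_int c) ^ 2)"
      using complex_norm_square[of "z + of_int c"] \<open>z' = cnj z\<close> by simp
    ultimately show ?thesis by simp
  next
    fix N :: int
    assume r: "z \<in> \<real>" "z' \<in> \<real>" and b: "of_int N < Re z" "Re z < of_int N + 1" "of_int N < Re z'" "Re z' < of_int N + 1"
    have "Re ((z + of_int c) * (z' + of_int c)) = (Re z + of_int c) * (Re z' + of_int c)"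
      using r by (simp add: complex_is_Real_iff)
    \<comment> \<open>In the complementary series both factors lie in one open interval between
      consecutive integers, so they have the same sign.\<close>
    moreover have "N + c \<ge> 0 \<or> N + c + 1 \<le> 0" by linarith
    moreover have "real_of_int (N + c) \<ge> 0 \<Longrightarrow> (Re z + of_int c) * (Re z' + of_int c) > 0"
      using b by (intro mult_pos_pos) auto
    moreover have "real_of_int (N + c + 1) \<le> 0 \<Longrightarrow> (Re z + of_int c) * (Re z' + of_int c) > 0"
      using b by (intro mult_neg_neg) auto
    ultimately show ?thesis by linarith
  qed
  finally show ?thesis .
qed

lemma t_pos: "t > 0"
  using wt_pos[of 0] by (simp add: wt_def)

lemma gpoch_mult: "gpoch z B * gpoch z' B = of_real (bw u t B)"
proof -
  have "gpoch z B * gpoch z' B = (\<Prod>x\<in>B. of_real (wt u t (real (snd x) - real (fst x))))"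
    unfolding gpoch_def prod.distrib[symmetric] case_prod_unfold
  proof (intro prod.cong refl)
    fix x :: "nat \<times> nat"
    show "(z + of_int (int (snd x) - int (fst x))) * (z' + of_int (int (snd x) - int (fst x))) =
        of_real (wt u t (real (snd x) - real (fst x)))"
      by (subst box_weight) simp
  qed
  thus ?thesis by (simp add: bw_def case_prod_unfold)
qed

lemma bw_pos: "bw u t B > 0"
  unfolding bw_def
proof (rule prod_pos, clarify)
  fix i j :: nat
  show "0 < wt u t (real j - real i)" using wt_pos[of "int j - int i"] by simp
qed

lemma zmeasure_eq: "zmeasure z z' n l = bw u t (boxes l) * real (dimY l) ^ 2 / (pochhammer t n * fact n)"
  unfolding zmeasure_def gpoch_mult sum_prod_real
  by (simp add: pochhammer_of_real flip: of_real_divide)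

lemma zmeasure_nonneg: "zmeasure z z' n l \<ge> 0"
  unfolding zmeasure_eq using bw_pos[of "boxes l"] pochhammer_pos[OF t_pos, of n]
  by (auto intro!: divide_nonneg_pos mult_nonneg_nonneg)

end

locale boundary_zmeasure = zparam +
  fixes P :: "thoma measure"
  assumes P: "is_boundary_zmeasure z z' P"
begin

sublocale prob_space P
  using P by (simp add: is_boundary_zmeasure_def)

lemma sets_P [measurable_cong]: "sets P = sets borel"
  using P by (simp add: is_boundary_zmeasure_def)

lemma weak_limit:
  fixes f :: "thoma \<Rightarrow> real"
  assumes "continuous_on UNIV f" "bounded (range f)"
  shows "(\<lambda>n. \<Sum>l\<in>YD n. zmeasure z z' n l * f (embed n l)) \<longlonglongrightarrow> integral\<^sup>L P f"
  using P assms by (simp add: is_boundary_zmeasure_def)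

lemma total_mass: "(\<lambda>n. \<Sum>l\<in>YD n. zmeasure z z' n l) \<longlonglongrightarrow> 1"
  using weak_limit[of "\<lambda>_. 1"] by (simp add: prob_space image_constant_conv)

text \<open>\<open>P\<close> is a measure on all pairs of sequences, so its support has to be
  located. The bounded continuous function min(1, distance to the simplex) vanishes at every
  embedded diagram, hence its integral is 0.\<close>

lemma AE_Thoma: "AE w in P. w \<in> Thoma"
proof -
  let ?f = "\<lambda>w. min 1 (infdist w Thoma)"
  have ne: "Thoma \<noteq> {}" using embed_in_Thoma[of "[]" 0] by (auto simp: YD_def is_partition_def)
  have c: "continuous_on UNIV ?f" by (intro continuous_intros)
  have b: "\<bar>?f w\<bar> \<le> 1" "?f w \<ge> 0" for w using infdist_nonneg[of w Thoma] by auto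
  have "bounded (range ?f)" unfolding bounded_iff using b(1) by (intro exI[of _ 1]) auto
  hence "(\<lambda>n. \<Sum>l\<in>YD n. zmeasure z z' n l * ?f (embed n l)) \<longlonglongrightarrow> integral\<^sup>L P ?f"
    using c by (intro weak_limit)
  moreover have "(\<Sum>l\<in>YD n. zmeasure z z' n l * ?f (embed n l)) = 0" for n
    using embed_in_Thoma by (intro sum.neutral) auto
  ultimately have 0: "integral\<^sup>L P ?f = 0" by (simp add: LIMSEQ_const_iff)
  have m: "?f \<in> borel_measurable P"
    using borel_measurable_continuous_onI[OF c] by (simp add: measurable_cong_sets[OF sets_P refl])
  have "integrable P ?f" using b(1) m by (intro integrable_const_bound[of _ 1]) auto
  hence "AE w in P. ?f w = 0"
    using 0 b(2) by (subst (asm) integral_nonneg_eq_0_iff_AE) auto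
  thus ?thesis
  proof eventually_elim
    case (elim w)
    hence "infdist w Thoma = 0" by (auto simp: min_def split: if_splits)
    thus ?case using in_closed_iff_infdist_zero[OF closed_Thoma ne] by simp
  qed
qed

lemma integrable_scirc_mult: "integrable P (\<lambda>w. scirc a w * scirc b w)"
proof -
  obtain K where K: "\<And>w. \<bar>scirc a w * scirc b w\<bar> \<le> K" using scirc_mult_bounded by metis
  show ?thesis
  proof (rule integrable_const_bound[of _ K])
    show "AE w in P. norm (scirc a w * scirc b w) \<le> K" using K by (intro AE_I2) (simp only: real_norm_def)
  qed measurable
qed

text \<open>The Schur functions are cut off outside the simplex and are known to be continuous only
  on it. A bounded Tietze extension of the product is a legitimate test function and agrees with it
  wherever the measures live.\<close>

lemma scirc_weak_limit:
  "(\<lambda>n. \<Sum>l\<in>YD n. zmeasure z z' n l * (scirc a (embed n l) * scirc b (embed n l)))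
     \<longlonglongrightarrow> (\<integral>w. scirc a w * scirc b w \<partial>P)"
proof -
  let ?f = "\<lambda>w. scirc a w * scirc b w"
  obtain K where B: "\<And>w. \<bar>?f w\<bar> \<le> K" using scirc_mult_bounded by metis
  hence "K \<ge> 0" by (meson abs_ge_zero order.trans)
  moreover have "continuous_on Thoma ?f" by (intro continuous_on_mult continuous_on_scirc)
  ultimately obtain g where g: "continuous_on UNIV g" "\<And>w. w \<in> Thoma \<Longrightarrow> g w = ?f w"
     "\<And>w. norm (g w) \<le> K"
    using Tietze[of Thoma ?f UNIV K] closed_Thoma B by auto
  have "bounded (range g)" unfolding bounded_iff using g(3) by (intro exI[of _ K]) auto
  hence "(\<lambda>n. \<Sum>l\<in>YD n. zmeasure z z' n l * g (embed n l)) \<longlonglongrightarrow> integral\<^sup>L P g"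
    using g(1) by (intro weak_limit)
  moreover have "(\<Sum>l\<in>YD n. zmeasure z z' n l * g (embed n l)) = (\<Sum>l\<in>YD n. zmeasure z z' n l * ?f (embed n l))" for n
    using g(2) embed_in_Thoma by (intro sum.cong) auto
  moreover have "integral\<^sup>L P g = (\<integral>w. ?f w \<partial>P)"
  proof (rule integral_cong_AE)
    show "g \<in> borel_measurable P"
      using borel_measurable_continuous_onI[OF g(1)] by (simp add: measurable_cong_sets[OF sets_P refl])
    show "AE w in P. g w = ?f w" using AE_Thoma by eventually_elim (rule g(2))
  qed measurable
  ultimately show ?thesis by simp
qed

definition rsum :: "nat list \<Rightarrow> nat list \<Rightarrow> nat \<Rightarrow> real" where
  "rsum a b n = (\<Sum>l\<in>YD n. zmeasure z z' n l * (rdim (n + 2) a l * rdim (n + 2) b l))"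

lemma rsum_tendsto:
  assumes a: "is_partition a" and b: "is_partition b"
  shows "rsum a b \<longlonglongrightarrow> (\<integral>w. scirc a w * scirc b w \<partial>P)"
proof -
  let ?s = "\<lambda>n l. scirc a (embed n l) * scirc b (embed n l)"
  let ?M = "\<lambda>n. \<Sum>l\<in>YD n. zmeasure z z' n l"
  have "(\<lambda>n. rsum a b n - (\<Sum>l\<in>YD n. zmeasure z z' n l * ?s n l)) \<longlonglongrightarrow> 0"
    unfolding tendsto_iff
  proof (intro allI impI)
    \<comment> \<open>The weak limit for the constant 1 shows that the total mass tends to 1, so it
      is eventually below 2; a uniform error of e/2 then suffices.\<close>
    fix e :: real assume e: "e > 0"
    have "\<forall>\<^sub>F n in sequentially. ?M n < 2"
      using total_mass by (rule order_tendstoD) simp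
    moreover have "\<forall>\<^sub>F n in sequentially. \<forall>l\<in>YD n. \<bar>rdim (n + 2) a l * rdim (n + 2) b l - ?s n l\<bar> < e / 2"
      using e by (intro rdim_asymptotics a b) simp
    ultimately show "\<forall>\<^sub>F n in sequentially. dist (rsum a b n - (\<Sum>l\<in>YD n. zmeasure z z' n l * ?s n l)) 0 < e"
    proof eventually_elim
      case (elim n)
      have "\<bar>rsum a b n - (\<Sum>l\<in>YD n. zmeasure z z' n l * ?s n l)\<bar> =
         \<bar>\<Sum>l\<in>YD n. zmeasure z z' n l * (rdim (n + 2) a l * rdim (n + 2) b l - ?s n l)\<bar>"
        by (simp add: rsum_def sum_subtractf right_diff_distrib)
      also have "\<dots> \<le> (\<Sum>l\<in>YD n. zmeasure z z' n l * (e / 2))"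
      proof (intro order.trans[OF sum_abs] sum_mono)
        fix l assume "l \<in> YD n"
        hence "\<bar>rdim (n + 2) a l * rdim (n + 2) b l - ?s n l\<bar> \<le> e / 2" using elim(2) less_imp_le by blast
        thus "\<bar>zmeasure z z' n l * (rdim (n + 2) a l * rdim (n + 2) b l - ?s n l)\<bar> \<le> zmeasure z z' n l * (e / 2)"
          unfolding abs_mult[of "zmeasure z z' n l"] abs_of_nonneg[OF zmeasure_nonneg]
          using zmeasure_nonneg by (intro mult_left_mono)
      qed
      also have "\<dots> = ?M n * (e / 2)" by (simp add: sum_distrib_right)
      also have "\<dots> < 2 * (e / 2)" using elim(1) e by (intro mult_strict_right_mono) auto
      finally show ?case by (simp add: dist_real_def)
    qed
  qed
  from tendsto_add[OF this scirc_weak_limit[of a b]] show ?thesis by simp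
qed

text \<open>The prescribed value of the operator on a Schur function, kept apart from
  \<open>A\<close> so that symmetry becomes a statement about the measure alone.\<close>

definition Asc :: "nat list \<Rightarrow> thoma \<Rightarrow> real" where
  "Asc m w = - sigma z z' (sum_list m) * scirc m w +
     (\<Sum>k | covered_by k m. bw u t (boxes m - boxes k) * scirc k w)"

text \<open>Once n reaches the sizes of \<open>a\<close> and \<open>b\<close>, the level n analogues
  \<open>Jn\<close> are symmetric by \<open>rdim_symmetric\<close>; they converge to the two
  integrals.\<close>

lemma Asc_symmetric:
  assumes a: "is_partition a" and b: "is_partition b"
  shows "(\<integral>w. Asc a w * scirc b w \<partial>P) = (\<integral>w. scirc a w * Asc b w \<partial>P)"
proof -
  define I where "I a b = (\<integral>w. scirc a w * scirc b w \<partial>P)" for a b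
  define J where "J a b = - sigma z z' (sum_list a) * I a b + (\<Sum>k | covered_by k a. bw u t (boxes a - boxes k) * I k b)" for a b
  define Jn where "Jn a b n = - sigma z z' (sum_list a) * rsum a b n + (\<Sum>k | covered_by k a. bw u t (boxes a - boxes k) * rsum k b n)" for a b n
  have Jn_lim: "Jn a b \<longlonglongrightarrow> J a b" if "is_partition a" "is_partition b" for a b
    unfolding Jn_def[abs_def] J_def I_def
    by (intro tendsto_add tendsto_mult tendsto_sum tendsto_const rsum_tendsto) (use that in \<open>auto simp: covered_by_def\<close>)
  have Jn_eq: "Jn a b n = (\<Sum>l\<in>YD n. bw u t (boxes l) * real (dimY l) ^ 2 * (Ardim u t (n + 2) a l * rdim (n + 2) b l)) / (pochhammer t n * fact n)" for a b n
  proof -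
    have "Jn a b n = (\<Sum>l\<in>YD n. zmeasure z z' n l * (Ardim u t (n + 2) a l * rdim (n + 2) b l))"
    proof -
      have "(\<Sum>k | covered_by k a. bw u t (boxes a - boxes k) * rsum k b n) =
        (\<Sum>l\<in>YD n. zmeasure z z' n l * ((\<Sum>k | covered_by k a. bw u t (boxes a - boxes k) * rdim (n + 2) k l) * rdim (n + 2) b l))"
        unfolding rsum_def sum_distrib_left sum_distrib_right
        by (subst sum.swap) (simp only: mult_ac)
      thus ?thesis
        unfolding Jn_def Ardim_def
        by (simp add: rsum_def sigma_def t_def sum_distrib_left algebra_simps flip: sum.distrib)
    qed
    also have "\<dots> = (\<Sum>l\<in>YD n. bw u t (boxes l) * real (dimY l) ^ 2 * (Ardim u t (n + 2) a l * rdim (n + 2) b l)) / (pochhammer t n * fact n)"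
      unfolding zmeasure_eq by (simp add: sum_divide_distrib)
    finally show ?thesis .
  qed
  have "\<forall>\<^sub>F n in sequentially. Jn a b n = Jn b a n"
    using eventually_ge_at_top[of "sum_list a"] eventually_ge_at_top[of "sum_list b"]
  proof eventually_elim
    case (elim n)
    show ?case unfolding Jn_eq using rdim_symmetric[OF a(1) elim(1) b elim(2), of "n + 2" u t] by simp
  qed
  hence "Jn a b \<longlonglongrightarrow> J b a"
    using Jn_lim[OF b a] by (simp add: tendsto_cong)
  hence "J a b = J b a" using Jn_lim[OF a b] LIMSEQ_unique by blast
  moreover have int: "(\<integral>w. Asc a w * scirc b w \<partial>P) = J a b" for a b
  proof -
    have "(\<lambda>w. Asc a w * scirc b w) = (\<lambda>w. - sigma z z' (sum_list a) * (scirc a w * scirc b w) +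
       (\<Sum>k | covered_by k a. bw u t (boxes a - boxes k) * (scirc k w * scirc b w)))"
      by (rule ext) (simp only: Asc_def distrib_right sum_distrib_right mult.assoc)
    moreover have "integral\<^sup>L P \<dots> = J a b"
      unfolding J_def I_def
      by (subst Bochner_Integration.integral_add)
        (auto intro!: integrable_mult_right Bochner_Integration.integrable_sum integrable_scirc_mult
          simp: Bochner_Integration.integral_sum integrable_scirc_mult simp del: mult_minus_left)
    ultimately show ?thesis by simp
  qed
  ultimately show ?thesis
    using int[of a b] int[of b a] by (simp add: mult.commute)
qed

end

section \<open>Schur functions and power sums\<close>

interpretation fs: vector_space fscale
  by unfold_locales (auto simp: fscale_def fun_eq_iff algebra_simps)

lemma sum_fun_apply: "(\<Sum>x\<in>A. f x :: 'b \<Rightarrow> 'c :: comm_monoid_add) w = (\<Sum>x\<in>A. f x w)"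
  by (induction A rule: infinite_finite_induct) auto

lemma sum_fscale_apply: "(\<Sum>x\<in>A. fscale (c x) (f x)) = (\<lambda>w. \<Sum>x\<in>A. c x * f x w)"
  by (rule ext) (simp add: sum_fun_apply fscale_def)

lemma LamC_eq_span: "LamC = fs.span (scirc ` {m. is_partition m})"
proof (intro equalityI subsetI)
  fix f assume "f \<in> LamC"
  then obtain S c where "finite S" "\<forall>mu\<in>S. is_partition mu" "f = (\<lambda>w. \<Sum>mu\<in>S. c mu * scirc mu w)"
    by (auto simp: LamC_def)
  hence "f = (\<Sum>mu\<in>S. fscale (c mu) (scirc mu))" "\<And>mu. mu \<in> S \<Longrightarrow> is_partition mu"
    by (auto simp: sum_fscale_apply)
  thus "f \<in> fs.span (scirc ` {m. is_partition m})"
    by (simp only:) (intro fs.span_sum fs.span_scale fs.span_base; simp)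
next
  have "fs.subspace LamC"
  proof (rule fs.subspaceI)
    show "0 \<in> LamC" unfolding LamC_def by (auto intro!: exI[of _ "{}"] simp: zero_fun_def)
    fix f g assume "f \<in> LamC" "g \<in> LamC"
    then obtain S T c d where S: "finite S" "\<forall>mu\<in>S. is_partition mu" "f = (\<lambda>w. \<Sum>mu\<in>S. c mu * scirc mu w)"
      and T: "finite T" "\<forall>mu\<in>T. is_partition mu" "g = (\<lambda>w. \<Sum>mu\<in>T. d mu * scirc mu w)"
      unfolding LamC_def mem_Collect_eq by (elim exE conjE)
    define e where "e mu = (if mu \<in> S then c mu else 0) + (if mu \<in> T then d mu else 0)" for mu
    have "f w = (\<Sum>mu\<in>S \<union> T. (if mu \<in> S then c mu else 0) * scirc mu w)" for w
      unfolding S(3) using S(1) T(1) by (intro sum.mono_neutral_cong_left) auto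
    moreover have "g w = (\<Sum>mu\<in>S \<union> T. (if mu \<in> T then d mu else 0) * scirc mu w)" for w
      unfolding T(3) using S(1) T(1) by (intro sum.mono_neutral_cong_left) auto
    ultimately have "f + g = (\<lambda>w. \<Sum>mu\<in>S \<union> T. e mu * scirc mu w)"
      by (intro ext) (simp add: e_def distrib_right sum.distrib)
    thus "f + g \<in> LamC" unfolding LamC_def using S T by blast
  next
    fix c f assume "f \<in> LamC"
    then obtain S d where S: "finite S" "\<forall>mu\<in>S. is_partition mu" "f = (\<lambda>w. \<Sum>mu\<in>S. d mu * scirc mu w)"
      unfolding LamC_def mem_Collect_eq by (elim exE conjE)
    hence "fscale c f = (\<lambda>w. \<Sum>mu\<in>S. (c * d mu) * scirc mu w)"
      by (intro ext) (simp add: fscale_def sum_distrib_left mult.assoc)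
    thus "fscale c f \<in> LamC" unfolding LamC_def using S by (auto intro!: exI[of _ S])
  qed
  moreover have "scirc m \<in> LamC" if "is_partition m" for m
    unfolding LamC_def using that by (auto intro!: exI[of _ "{m}"] exI[of _ "\<lambda>_. 1"])
  ultimately show "f \<in> LamC" if "f \<in> fs.span (scirc ` {m. is_partition m})" for f
    using that fs.span_minimal[of "scirc ` {m. is_partition m}" LamC] by blast
qed

text \<open>Cut off outside the simplex like \<open>scirc\<close>, so that identities between the
  families hold as functions on the whole type.\<close>

definition rfun :: "(nat \<Rightarrow> thoma \<Rightarrow> real) \<Rightarrow> nat multiset \<Rightarrow> thoma \<Rightarrow> real" where
  "rfun q M w = (if w \<in> Thoma then \<Prod>k\<in>#M. q k w else 0)"

abbreviation "pfun \<equiv> rfun pcirc"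
abbreviation "hfun \<equiv> rfun hcirc"

lemma rfun_mult: "rfun q M * rfun q M' = rfun q (M + M')"
  by (auto simp: rfun_def fun_eq_iff)

lemma span_mult:
  assumes AB: "\<And>x y. x \<in> A \<Longrightarrow> y \<in> B \<Longrightarrow> x * y \<in> fs.span C"
    and f: "f \<in> fs.span A" and g: "g \<in> fs.span B"
  shows "f * g \<in> fs.span C"
proof -
  have z: "x * 0 = 0" "0 * x = 0" for x :: "thoma \<Rightarrow> real"
    by (rule ext, simp)+
  have 1: "x * g \<in> fs.span C" if "x \<in> A" for x
    using g
  proof (induction rule: fs.span_induct_alt)
    case base show ?case unfolding z by (rule fs.span_zero)
  next
    case (step c y z)
    have "x * (fscale c y + z) = fscale c (x * y) + x * z"
      by (rule ext) (simp add: fscale_def algebra_simps)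
    moreover have "\<dots> \<in> fs.span C"
      using step AB[OF that] by (intro fs.span_add fs.span_scale)
    ultimately show ?case by (simp only:)
  qed
  show ?thesis using f
  proof (induction rule: fs.span_induct_alt)
    case base show ?case unfolding z by (rule fs.span_zero)
  next
    case (step c y z)
    have "(fscale c y + z) * g = fscale c (y * g) + z * g"
      by (rule ext) (simp add: fscale_def algebra_simps)
    moreover have "\<dots> \<in> fs.span C"
      using step 1 by (intro fs.span_add fs.span_scale)
    ultimately show ?case by (simp only:)
  qed
qed

lemma span_rfun_mult:
  assumes "f \<in> fs.span (rfun q ` MP a)" "g \<in> fs.span (rfun q ` MP b)"
  shows "f * g \<in> fs.span (rfun q ` MP (a + b))"
  using assms by (rule span_mult[rotated]) (auto simp: rfun_mult MP_def intro!: fs.span_base)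

lemma hfun_in_span_pfun:
  assumes "0 \<notin># M" shows "hfun M \<in> fs.span (pfun ` MP (sum_mset M))"
  using assms
proof (induction M)
  case empty
  have "hfun {#} = pfun {#}" by (simp add: rfun_def fun_eq_iff)
  thus ?case by (auto simp: MP_def intro!: fs.span_base)
next
  case (add r M)
  have "hfun {#r#} = (\<Sum>K\<in>MP r. fscale (1 / zM K) (pfun K))"
    unfolding sum_fscale_apply by (rule ext) (auto simp: rfun_def hcirc_eq_hpow hpow_def)
  hence "hfun {#r#} \<in> fs.span (pfun ` MP r)"
    by (simp only:) (intro fs.span_sum fs.span_scale fs.span_base; simp)
  from span_rfun_mult[OF this add.IH] add.prems show ?case by (simp add: rfun_mult)
qed

text \<open>Newton's identity solved for p_r: it involves h_r and the products p_k h_(r-k) with k <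
  r.\<close>

lemma pfun_in_span_hfun:
  assumes "0 \<notin># M" shows "pfun M \<in> fs.span (hfun ` MP (sum_mset M))"
  using assms
proof (induction M)
  case empty
  have "pfun {#} = hfun {#}" by (simp add: rfun_def fun_eq_iff)
  thus ?case by (auto simp: MP_def intro!: fs.span_base)
next
  case (add r M)
  have h: "hfun {#r#} \<in> fs.span (hfun ` MP r)" if "r \<ge> 1" for r
    using that by (auto simp: MP_def intro!: fs.span_base)
  have "pfun {#r#} \<in> fs.span (hfun ` MP r)" if "r \<ge> 1" for r
    using that
  proof (induction r rule: less_induct)
    case (less r)
    have "pfun {#r#} = fscale (real r) (hfun {#r#}) - (\<Sum>k=1..<r. pfun {#k#} * hfun {#r - k#})"
    proof (rule ext)
      fix w
      have "{1..r} = insert r {1..<r}" using less.prems by auto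
      hence "real r * hcirc r w = pcirc r w + (\<Sum>k=1..<r. pcirc k w * hcirc (r - k) w)"
        using hpow_newton[of r "\<lambda>k. pcirc k w"] by (simp add: hcirc_eq_hpow)
      thus "pfun {#r#} w = (fscale (real r) (hfun {#r#}) - (\<Sum>k=1..<r. pfun {#k#} * hfun {#r - k#})) w"
        by (simp add: rfun_def fscale_def sum_fun_apply)
    qed
    moreover have "pfun {#k#} * hfun {#r - k#} \<in> fs.span (hfun ` MP r)" if "k \<in> {1..<r}" for k
      using span_rfun_mult[OF less.IH[of k] h[of "r - k"]] that by (simp add: Suc_le_eq)
    ultimately show ?case
      using h[OF less.prems] by (simp only:) (intro fs.span_diff fs.span_sum fs.span_scale; simp)
  qed
  from span_rfun_mult[OF this[of r] add.IH] add.prems show ?case by (simp add: rfun_mult Suc_le_eq)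
qed

section \<open>Jacobi-Trudi expansions and the change of basis\<close>

definition JT :: "nat list \<Rightarrow> (nat \<Rightarrow> nat) \<Rightarrow> nat multiset" where
  "JT m p = filter_mset (\<lambda>k. k > 0) (image_mset (\<lambda>i. nat (int (m ! i) - int i + int (p i))) (mset_set {..<length m}))"

lemma prod_mset_filter_pos:
  fixes f :: "nat \<Rightarrow> 'a :: comm_monoid_mult"
  assumes "f 0 = 1"
  shows "(\<Prod>k\<in>#filter_mset (\<lambda>k. k > 0) M. f k) = (\<Prod>k\<in>#M. f k)"
  using assms by (induction M) auto

lemma sum_mset_filter_pos:
  fixes f :: "nat \<Rightarrow> 'a :: comm_monoid_add"
  assumes "f 0 = 0"
  shows "(\<Sum>k\<in>#filter_mset (\<lambda>k. k > 0) M. f k) = (\<Sum>k\<in>#M. f k)"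
  using assms by (induction M) auto

lemma hcirc_0 [simp]: "hcirc 0 w = 1"
  by (simp add: hcirc_eq_hpow)

text \<open>\<open>JT\<close> discards the zero indices in order to be a partition; as h_0 = 1, the
  product is unchanged.\<close>

lemma prod_hcirc_int_eq:
  assumes "\<And>i. i < length m \<Longrightarrow> 0 \<le> int (m ! i) - int i + int (p i)" "w \<in> Thoma"
  shows "(\<Prod>i<length m. hcirc_int (int (m ! i) - int i + int (p i)) w) = hfun (JT m p) w"
proof -
  have "(\<Prod>i<length m. hcirc_int (int (m ! i) - int i + int (p i)) w) =
      (\<Prod>i<length m. hcirc (nat (int (m ! i) - int i + int (p i))) w)"
    using assms(1) by (intro prod.cong) (auto simp: hcirc_int_def not_less)
  also have "\<dots> = (\<Prod>k\<in>#image_mset (\<lambda>i. nat (int (m ! i) - int i + int (p i))) (mset_set {..<length m}). hcirc k w)"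
    by (simp add: prod_unfold_prod_mset multiset.map_comp o_def)
  also have "\<dots> = hfun (JT m p) w"
    unfolding JT_def rfun_def using assms(2) by (simp add: prod_mset_filter_pos)
  finally show ?thesis .
qed

lemma JT_in_MP:
  assumes p: "p permutes {..<length m}"
    and nn: "\<And>i. i < length m \<Longrightarrow> 0 \<le> int (m ! i) - int i + int (p i)"
  shows "JT m p \<in> MP (sum_list m)"
proof -
  let ?L = "length m"
  have "int (\<Sum>i<?L. nat (int (m ! i) - int i + int (p i))) = (\<Sum>i<?L. int (m ! i) - int i + int (p i))"
    unfolding of_nat_sum using nn by (intro sum.cong) auto
  also have "\<dots> = (\<Sum>i<?L. int (m ! i)) - (\<Sum>i<?L. int i) + (\<Sum>i<?L. int (p i))"
    by (simp add: sum.distrib sum_subtractf)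
  also have "(\<Sum>i<?L. int (p i)) = (\<Sum>i<?L. int i)"
    using sum.permute[OF p, of int] by (simp add: o_def)
  also have "(\<Sum>i<?L. int (m ! i)) = int (sum_list m)"
    by (simp add: sum_list_sum_nth atLeast0LessThan)
  finally have "(\<Sum>i<?L. nat (int (m ! i) - int i + int (p i))) = sum_list m"
    by (simp only: diff_add_cancel of_nat_eq_iff)
  hence "sum_mset (JT m p) = sum_list m"
    using sum_mset_filter_pos[of "\<lambda>k. k" "image_mset (\<lambda>i. nat (int (m ! i) - int i + int (p i))) (mset_set {..<?L})"]
    unfolding JT_def by (simp add: sum_unfold_sum_mset)
  thus ?thesis by (simp add: MP_def JT_def)
qed

definition phi :: "nat \<Rightarrow> nat multiset \<Rightarrow> nat" where
  "phi B M = (\<Sum>k\<in>#M. if k = 0 then 0 else B ^ k)"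

text \<open>The weights \<open>B ^ k\<close> make \<open>phi\<close> order multisets of parts lexicographically from the largest part,
  so the diagonal term of the Jacobi--Trudi determinant is the strictly smallest one.\<close>
lemma phi_JT_less:
  assumes m: "is_partition m" and p: "p permutes {..<length m}" "p \<noteq> id"
    and nn: "\<And>i. i < length m \<Longrightarrow> 0 \<le> int (m ! i) - int i + int (p i)"
    and B: "length m < B"
  shows "phi B (mset m) < phi B (JT m p)"
proof -
  let ?L = "length m"
  let ?e = "\<lambda>i. nat (int (m ! i) - int i + int (p i))"
  let ?f = "\<lambda>k. if k = 0 then 0 else B ^ k"
  have ex: "\<exists>i. p i \<noteq> i" using p(2) by (auto simp: fun_eq_iff)
  \<comment> \<open>At the first moved row the index grows, so its summand is at least B^(m ! j +
    1). This beats the diagonal summands from row \<open>j\<close> on: there are at most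
    \<open>length m\<close> < B of them, each at most B^(m ! j).\<close>
  define j where "j = (LEAST i. p i \<noteq> i)"
  have j: "p j \<noteq> j" unfolding j_def by (rule LeastI_ex[OF ex])
  have lt: "p i = i" if "i < j" for i using not_less_Least[OF that[unfolded j_def]] by simp
  have jL: "j < ?L" using j permutes_not_in[OF p(1), of j] by auto
  have pj: "p j > j"
  proof (rule ccontr)
    assume "\<not> p j > j"
    hence "p j < j" using j by simp
    hence "p (p j) = p j" by (rule lt)
    thus False using j permutes_inj[OF p(1)] by (auto dest: injD)
  qed
  have mpos: "m ! i > 0" if "i < ?L" for i
    using m that by (auto simp: is_partition_def in_set_conv_nth intro!: gr0I)
  have mdec: "m ! i \<le> m ! j" if "j \<le> i" "i < ?L" for i
    using m that by (cases "i = j") (auto simp: is_partition_def sorted_wrt_iff_nth_less)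
  have split: "{..<?L} = {..<j} \<union> {j..<?L}" using jL by auto
  have "phi B (mset m) = (\<Sum>i<?L. ?f (m ! i))"
    unfolding phi_def by (simp add: sum_mset_sum_list sum_list_sum_nth atLeast0LessThan flip: mset_map)
  also have "\<dots> = (\<Sum>i<j. ?f (m ! i)) + (\<Sum>i=j..<?L. ?f (m ! i))"
    unfolding split by (rule sum.union_disjoint) auto
  also have "(\<Sum>i=j..<?L. ?f (m ! i)) \<le> (\<Sum>i=j..<?L. B ^ (m ! j))"
    using mdec B by (intro sum_mono) (auto intro!: power_increasing)
  also have "\<dots> \<le> ?L * B ^ (m ! j)" by simp
  also have "\<dots> < B * B ^ (m ! j)" using B by simp
  also have "\<dots> = B ^ Suc (m ! j)" by simp
  also have "\<dots> \<le> B ^ ?e j" using B pj by (intro power_increasing) auto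
  also have "\<dots> = ?f (?e j)" using pj by auto
  also have "\<dots> \<le> (\<Sum>i=j..<?L. ?f (?e i))" using jL by (intro member_le_sum) auto
  also have "(\<Sum>i<j. ?f (m ! i)) = (\<Sum>i<j. ?f (?e i))" using lt by (intro sum.cong) auto
  also have "(\<Sum>i<j. ?f (?e i)) + (\<Sum>i=j..<?L. ?f (?e i)) = (\<Sum>i<?L. ?f (?e i))"
    unfolding split by (rule sum.union_disjoint[symmetric]) auto
  also have "\<dots> = phi B (JT m p)"
  proof -
    have "phi B (JT m p) = (\<Sum>k\<in>#image_mset ?e (mset_set {..<?L}). ?f k)"
      unfolding phi_def JT_def by (rule sum_mset_filter_pos) simp
    thus ?thesis by (simp add: sum_unfold_sum_mset multiset.map_comp o_def)
  qed
  finally show ?thesis by simp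
qed

text \<open>The upper bound makes the growth of \<open>phi\<close> usable for induction.\<close>

lemma phi_le:
  assumes "M \<in> MP d" shows "phi (Suc d) M \<le> d * Suc d ^ d"
proof -
  have "phi (Suc d) M \<le> (\<Sum>k\<in>#M. k * Suc d ^ d)"
    unfolding phi_def
  proof (rule sum_mset_mono)
    fix k assume k: "k \<in># M"
    have "k \<le> sum_mset M" using k by (simp add: sum_mset.remove)
    hence "k \<le> d" using assms by (simp add: MP_def)
    hence "Suc d ^ k \<le> Suc d ^ d" by (intro power_increasing) auto
    thus "(if k = 0 then 0 else Suc d ^ k) \<le> k * Suc d ^ d"
      by (cases k) (auto intro: order.trans)
  qed
  also have "\<dots> = d * Suc d ^ d"
    using assms by (simp add: MP_def sum_mset_distrib_right[symmetric] image_mset.identity)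
  finally show ?thesis .
qed

lemma scirc_expand:
  assumes "is_partition m"
  shows "scirc m = (\<Sum>p | p permutes {..<length m}.
     fscale (if \<forall>i<length m. 0 \<le> int (m ! i) - int i + int (p i) then of_int (sign p) else 0) (hfun (JT m p)))"
  unfolding sum_fscale_apply
proof (rule ext)
  fix w
  show "scirc m w = (\<Sum>p | p permutes {..<length m}.
     (if \<forall>i<length m. 0 \<le> int (m ! i) - int i + int (p i) then of_int (sign p) else 0) * hfun (JT m p) w)"
  proof (cases "w \<in> Thoma")
    case True
    have "of_int (sign p) * (\<Prod>i<length m. hcirc_int (int (m ! i) - int i + int (p i)) w) =
      (if \<forall>i<length m. 0 \<le> int (m ! i) - int i + int (p i) then of_int (sign p) else 0) * hfun (JT m p) w" for p
    proof (cases "\<forall>i<length m. 0 \<le> int (m ! i) - int i + int (p i)")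
      case True
      thus ?thesis using prod_hcirc_int_eq[of m p w] \<open>w \<in> Thoma\<close> by simp
    next
      case False
      then obtain i where "i < length m" "int (m ! i) - int i + int (p i) < 0" by (auto simp: not_le)
      hence "(\<Prod>i<length m. hcirc_int (int (m ! i) - int i + int (p i)) w) = 0"
        by (intro prod_zero) (auto simp: hcirc_int_def)
      thus ?thesis using False by (simp only: mult_zero_right mult_zero_left if_False)
    qed
    thus ?thesis using True by (simp only: scirc_def if_True)
  qed (simp add: scirc_def rfun_def)
qed

lemma scirc_in_span_hfun:
  assumes "is_partition m" shows "scirc m \<in> fs.span (hfun ` MP (sum_list m))"
  unfolding scirc_expand[OF assms]
proof (intro fs.span_sum)
  fix p assume "p \<in> {p. p permutes {..<length m}}"
  thus "fscale (if \<forall>i<length m. 0 \<le> int (m ! i) - int i + int (p i) then of_int (sign p) else 0) (hfun (JT m p))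
     \<in> fs.span (hfun ` MP (sum_list m))"
    by (cases "\<forall>i<length m. 0 \<le> int (m ! i) - int i + int (p i)")
      (auto intro: fs.span_scale[OF fs.span_base] JT_in_MP simp: fs.span_zero)
qed

lemma JT_id: "0 \<notin> set m \<Longrightarrow> JT m id = mset m"
proof -
  assume z: "0 \<notin> set m"
  have "image_mset (\<lambda>i. m ! i) (mset_set {..<length m}) = mset m"
    by (metis atLeast_upt map_nth mset_map mset_set_set distinct_upt mset_upt atLeast0LessThan set_upt)
  hence "JT m id = filter_mset (\<lambda>k. k > 0) (mset m)" by (simp add: JT_def)
  also have "\<dots> = mset m" using z by (simp add: filter_mset_eq_conv) (metis gr0I)
  finally show ?thesis .
qed

text \<open>The expansion of Schur functions is unitriangular for \<open>phi\<close>: the identity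
  permutation contributes the product of h over the parts of \<open>m\<close>, and all other
  surviving terms have larger \<open>phi\<close>, so they are covered by induction on the distance
  to the bound of \<open>phi_le\<close>.\<close>

lemma hfun_in_span_scirc:
  assumes "M \<in> MP d" shows "hfun M \<in> fs.span (scirc ` YD d)"
  using assms
proof (induction "d * Suc d ^ d - phi (Suc d) M" arbitrary: M rule: less_induct)
  case less
  obtain m where m: "m \<in> YD d" "M = mset m"
    using bij_betw_mset_YD[of d] less.prems by (auto simp: bij_betw_def)
  have mp: "is_partition m" "sum_list m = d" using m by (auto simp: YD_def)
  have L: "length m < Suc d" using length_le_sum_list[OF mp(1)] mp by simp
  let ?S = "{p. p permutes {..<length m}}"
  let ?t = "\<lambda>p. fscale (if \<forall>i<length m. 0 \<le> int (m ! i) - int i + int (p i) then of_int (sign p) else 0) (hfun (JT m p))"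
  have "?t p \<in> fs.span (scirc ` YD d)" if p: "p \<in> ?S - {id}" for p
  proof (cases "\<forall>i<length m. 0 \<le> int (m ! i) - int i + int (p i)")
    case True
    have MP: "JT m p \<in> MP d" using JT_in_MP[of p m] p True mp by auto
    have "phi (Suc d) M < phi (Suc d) (JT m p)"
      unfolding m(2) using p True L by (intro phi_JT_less[OF mp(1)]) auto
    hence "d * Suc d ^ d - phi (Suc d) (JT m p) < d * Suc d ^ d - phi (Suc d) M"
      using phi_le[OF MP] by linarith
    from less.hyps[OF this MP] show ?thesis by (rule fs.span_scale)
  next
    case False
    hence "?t p = 0" by (simp only: if_False fs.scale_zero_left)
    thus ?thesis by (simp only: fs.span_zero)
  qed
  hence rest: "(\<Sum>p\<in>?S - {id}. ?t p) \<in> fs.span (scirc ` YD d)" by (rule fs.span_sum)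
  have "scirc m = ?t id + (\<Sum>p\<in>?S - {id}. ?t p)"
    unfolding scirc_expand[OF mp(1)]
  proof (rule sum.remove)
    show "id \<in> ?S" using permutes_id by blast
  qed (simp add: finite_permutations)
  moreover have "?t id = hfun M"
    using JT_id[of m] mp by (simp add: sign_id m is_partition_def)
  ultimately have "hfun M = scirc m - (\<Sum>p\<in>?S - {id}. ?t p)" by simp
  moreover have "scirc m \<in> fs.span (scirc ` YD d)" using m by (intro fs.span_base) blast
  ultimately show ?case using fs.span_diff[OF _ rest] by (simp only:)
qed

text \<open>Indexes the monomials in p_2, p_3, ... of degree at most \<open>k\<close>. An inequality
  is natural here because p_1 = 1 lowers degrees, leaving a filtration in place of the
  grading.\<close>

definition NO :: "nat \<Rightarrow> nat multiset set" where
  "NO k = {M. 0 \<notin># M \<and> 1 \<notin># M \<and> sum_mset M \<le> k}"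

lemma pfun_remove_ones: "pfun M = pfun (filter_mset (\<lambda>k. k \<noteq> 1) M)"
proof -
  have "(\<Prod>k\<in>#filter_mset (\<lambda>k. k \<noteq> 1) M. pcirc k w) = (\<Prod>k\<in>#M. pcirc k w)" for w
    by (induction M) (auto simp: pcirc_def)
  thus ?thesis by (auto simp: rfun_def fun_eq_iff)
qed

lemma span_scirc_eq_span_pfun:
  "fs.span (scirc ` {m. is_partition m \<and> sum_list m \<le> k}) = fs.span (pfun ` NO k)"
proof (rule fs.span_eq[THEN iffD2], intro conjI subsetI)
  fix f assume "f \<in> scirc ` {m. is_partition m \<and> sum_list m \<le> k}"
  then obtain m where m: "is_partition m" "sum_list m \<le> k" "f = scirc m" by blast
  have "hfun M \<in> fs.span (pfun ` NO k)" if "M \<in> MP (sum_list m)" for M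
  proof -
    have "pfun K \<in> fs.span (pfun ` NO k)" if K: "K \<in> MP (sum_list m)" for K
    proof -
      have "sum_mset (filter_mset (\<lambda>k. k \<noteq> 1) K) \<le> sum_mset K"
        by (induction K) auto
      hence "filter_mset (\<lambda>k. k \<noteq> 1) K \<in> NO k" using K m(2) by (auto simp: MP_def NO_def)
      thus ?thesis by (subst pfun_remove_ones) (auto intro: fs.span_base)
    qed
    hence "fs.span (pfun ` MP (sum_list m)) \<subseteq> fs.span (pfun ` NO k)"
      by (intro fs.span_minimal) auto
    thus ?thesis using hfun_in_span_pfun[of M] that by (auto simp: MP_def)
  qed
  hence "fs.span (hfun ` MP (sum_list m)) \<subseteq> fs.span (pfun ` NO k)"
    by (intro fs.span_minimal) auto
  thus "f \<in> fs.span (pfun ` NO k)" using scirc_in_span_hfun[OF m(1)] m(3) by blast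
next
  fix f assume "f \<in> pfun ` NO k"
  then obtain M where M: "M \<in> NO k" "f = pfun M" by blast
  let ?S = "scirc ` {m. is_partition m \<and> sum_list m \<le> k}"
  have "hfun K \<in> fs.span ?S" if "K \<in> MP (sum_mset M)" for K
  proof -
    have "fs.span (scirc ` YD (sum_mset M)) \<subseteq> fs.span ?S"
      using M by (intro fs.span_mono) (auto simp: YD_def NO_def)
    thus ?thesis using hfun_in_span_scirc[OF that] by blast
  qed
  hence "fs.span (hfun ` MP (sum_mset M)) \<subseteq> fs.span ?S"
    by (intro fs.span_minimal) auto
  thus "f \<in> fs.span ?S" using pfun_in_span_hfun[of M] M by (auto simp: NO_def)
qed

section \<open>Algebraic independence of the power sums\<close>

text \<open>A polynomial in free variables \<open>v k\<close>, separated from the values that the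
  power sums take on the simplex.\<close>

definition peval :: "nat multiset set \<Rightarrow> (nat multiset \<Rightarrow> real) \<Rightarrow> (nat \<Rightarrow> real) \<Rightarrow> real" where
  "peval F c v = (\<Sum>M\<in>F. c M * (\<Prod>k\<in>#M. v k))"

lemma peval_cong:
  "(\<And>M k. M \<in> F \<Longrightarrow> k \<in># M \<Longrightarrow> v k = v' k) \<Longrightarrow> peval F c v = peval F c v'"
  unfolding peval_def by (intro sum.cong refl arg_cong2[of _ _ _ _ times]) (auto intro!: arg_cong[of _ _ prod_mset] image_mset_cong)

lemma poly_prod_mset: "poly (\<Prod>k\<in>#M. R k) t = (\<Prod>k\<in>#M. poly (R k) t)"
  by (induction M) auto

lemma peval_poly_vanish:
  fixes R :: "nat \<Rightarrow> real poly"
  assumes "infinite {t. peval F c (\<lambda>k. poly (R k) t) = 0}"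
  shows "peval F c (\<lambda>k. poly (R k) t) = 0"
proof -
  define Q where "Q = (\<Sum>M\<in>F. Polynomial.smult (c M) (\<Prod>k\<in>#M. R k))"
  have Q: "peval F c (\<lambda>k. poly (R k) t) = poly Q t" for t
    by (simp add: Q_def peval_def poly_sum poly_prod_mset)
  have "Q = 0"
  proof (rule ccontr)
    assume "Q \<noteq> 0"
    thus False using assms poly_roots_finite[of Q] by (simp add: Q)
  qed
  thus ?thesis by (simp add: Q)
qed

text \<open>After sorting and scaling by a small \<open>s\<close>, the list is a point of the
  simplex. Scaling multiplies the k-th power sum by s^k, so the relation is a polynomial in
  \<open>s\<close> that vanishes on an interval, hence also at s = 1. Only k >= 2 occurs, so the
  convention for p_1 does not interfere.\<close>

lemma peval_vanish_lists:
  assumes F: "\<And>M k. M \<in> F \<Longrightarrow> k \<in># M \<Longrightarrow> k \<ge> 2"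
    and van: "\<And>w. w \<in> Thoma \<Longrightarrow> peval F c (\<lambda>k. pcirc k w) = 0"
    and X: "\<forall>x\<in>set X. x \<ge> 0"
  shows "peval F c (\<lambda>k. \<Sum>x\<leftarrow>X. x ^ k) = 0"
proof -
  define Y where "Y = rev (sort X)"
  define q where "q k = (\<Sum>x\<leftarrow>X. x ^ k)" for k
  have q: "q k = (\<Sum>i<length Y. (Y ! i) ^ k)" for k
  proof -
    have "q k = sum_mset (image_mset (\<lambda>x. x ^ k) (mset X))"
      unfolding q_def by (simp flip: sum_mset_sum_list)
    also have "mset X = mset Y" by (simp add: Y_def)
    also have "sum_mset (image_mset (\<lambda>x. x ^ k) (mset Y)) = (\<Sum>x\<leftarrow>Y. x ^ k)"
      by (simp flip: sum_mset_sum_list)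
    finally show ?thesis by (simp add: sum_list_sum_nth atLeast0LessThan)
  qed
  have Y: "sorted_wrt (\<ge>) Y" "\<forall>x\<in>set Y. x \<ge> 0" using X by (auto simp: Y_def sorted_wrt_rev)
  have q1: "q 1 \<ge> 0" unfolding q using Y(2) by (intro sum_nonneg) auto
  have small: "peval F c (\<lambda>k. s ^ k * q k) = 0" if s: "s \<ge> 0" "s * q 1 \<le> 1" for s
  proof -
    define a where "a i = (if i < length Y then s * Y ! i else 0)" for i
    let ?w = "(a, \<lambda>_. 0) :: thoma"
    have nn: "a i \<ge> 0" for i using s Y(2) by (auto simp: a_def)
    have "(\<Sum>i<n. a i) \<le> 1" for n
    proof -
      have "(\<Sum>i<n. a i) \<le> (\<Sum>i<max n (length Y). a i)" using nn by (intro sum_mono2) auto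
      also have "\<dots> = (\<Sum>i<length Y. s * Y ! i)"
        by (rule sum.mono_neutral_cong_right) (auto simp: a_def)
      also have "\<dots> = s * q 1" by (simp add: q sum_distrib_left)
      finally show ?thesis using s by simp
    qed
    moreover have "a (Suc i) \<le> a i" for i
      using Y s by (auto simp: a_def sorted_wrt_iff_nth_less intro!: mult_left_mono)
    ultimately have w: "?w \<in> Thoma" using nn by (simp add: Thoma_def)
    have "pcirc k ?w = s ^ k * q k" if "k \<ge> 2" for k
    proof -
      have "(\<Sum>i. a i ^ k) = (\<Sum>i<length Y. a i ^ k)"
        using that by (intro suminf_finite) (auto simp: a_def)
      also have "\<dots> = s ^ k * q k"
        unfolding q sum_distrib_left by (intro sum.cong) (auto simp: a_def power_mult_distrib)
      finally show ?thesis using that by (simp add: pcirc_def power_0_left)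
    qed
    hence "peval F c (\<lambda>k. pcirc k ?w) = peval F c (\<lambda>k. s ^ k * q k)"
      using F by (intro peval_cong) blast
    thus ?thesis using van[OF w] by simp
  qed
  have eq: "peval F c (\<lambda>k. poly (Polynomial.monom (q k) k) s) = peval F c (\<lambda>k. s ^ k * q k)" for s
    by (simp add: poly_monom mult.commute)
  have "peval F c (\<lambda>k. poly (Polynomial.monom (q k) k) 1) = 0"
  proof (rule peval_poly_vanish)
    \<comment> \<open>On this interval s * q 1 <= 1, and adding 1 in the denominator covers the case
      q 1 = 0.\<close>
    have "{0..1 / (q 1 + 1)} \<subseteq> {t. peval F c (\<lambda>k. poly (Polynomial.monom (q k) k) t) = 0}"
    proof
      fix s assume s: "s \<in> {0..1 / (q 1 + 1)}"
      hence "s * q 1 \<le> 1 / (q 1 + 1) * q 1" using q1 by (intro mult_right_mono) auto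
      also have "\<dots> \<le> 1" using q1 by (simp add: field_simps)
      finally show "s \<in> {t. peval F c (\<lambda>k. poly (Polynomial.monom (q k) k) t) = 0}"
        using small[of s] s by (simp add: eq)
    qed
    moreover have "infinite {0..1 / (q 1 + 1)}" using q1 by (intro infinite_Icc) simp
    ultimately show "infinite {t. peval F c (\<lambda>k. poly (Polynomial.monom (q k) k) t) = 0}"
      using finite_subset by blast
  qed
  thus ?thesis unfolding eq by (simp add: q_def)
qed

text \<open>Natural multiplicities come from repeating the entry i + 1 in a list. They are replaced
  by real ones one coordinate at a time, because a polynomial vanishing at all naturals is
  zero.\<close>

lemma peval_vanish_weights:
  fixes N :: "nat \<Rightarrow> real"
  assumes van: "\<And>X. \<forall>x\<in>set X. x \<ge> 0 \<Longrightarrow> peval F c (\<lambda>k. \<Sum>x\<leftarrow>X. x ^ k) = 0"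
  shows "peval F c (\<lambda>k. \<Sum>i<r. N i * (real i + 1) ^ k) = 0"
proof -
  have nat: "peval F c (\<lambda>k. \<Sum>i<r. real (n i) * (real i + 1) ^ k) = 0" for n :: "nat \<Rightarrow> nat"
  proof -
    let ?X = "concat (map (\<lambda>i. replicate (n i) (real i + 1)) [0..<r])"
    have "(\<Sum>x\<leftarrow>?X. x ^ k) = (\<Sum>i<r. real (n i) * (real i + 1) ^ k)" for k
      by (induction r) (auto simp: sum_list_replicate)
    moreover have "\<forall>x\<in>set ?X. x \<ge> 0" by auto
    ultimately show ?thesis using van[of ?X] by simp
  qed
  \<comment> \<open>Here \<open>j\<close> is the number of leading coordinates that may already be
    arbitrary reals.\<close>
  have "peval F c (\<lambda>k. \<Sum>i<r. N i * (real i + 1) ^ k) = 0" if "\<And>i. j \<le> i \<Longrightarrow> N i \<in> \<nat>" for j and N :: "nat \<Rightarrow> real"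
    using that
  proof (induction j arbitrary: N)
    case 0
    hence "\<And>i. \<exists>n. N i = real n" by (auto elim!: Nats_cases)
    then obtain n where "N = (\<lambda>i. real (n i))" by metis
    thus ?case using nat by simp
  next
    case (Suc j)
    show ?case
    proof (cases "j < r")
      case False
      have "peval F c (\<lambda>k. \<Sum>i<r. (N(j := 0)) i * (real i + 1) ^ k) = 0"
        using Suc.prems by (intro Suc.IH) auto
      moreover have "(\<Sum>i<r. (N(j := 0)) i * (real i + 1) ^ k) = (\<Sum>i<r. N i * (real i + 1) ^ k)" for k
        using False by (intro sum.cong) auto
      ultimately show ?thesis by simp
    next
      case True
      define R where "R k = [:\<Sum>i\<in>{..<r} - {j}. N i * (real i + 1) ^ k, (real j + 1) ^ k:]" for k
      have R: "(\<Sum>i<r. (N(j := t)) i * (real i + 1) ^ k) = poly (R k) t" for t k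
      proof -
        have "(\<Sum>i<r. (N(j := t)) i * (real i + 1) ^ k) =
            t * (real j + 1) ^ k + (\<Sum>i\<in>{..<r} - {j}. (N(j := t)) i * (real i + 1) ^ k)"
          using True by (subst sum.remove[of _ j]) auto
        also have "(\<Sum>i\<in>{..<r} - {j}. (N(j := t)) i * (real i + 1) ^ k) = (\<Sum>i\<in>{..<r} - {j}. N i * (real i + 1) ^ k)"
          by (intro sum.cong) auto
        finally show ?thesis by (simp add: R_def)
      qed
      have "peval F c (\<lambda>k. poly (R k) (N j)) = 0"
      proof (rule peval_poly_vanish)
        have "\<nat> \<subseteq> {t. peval F c (\<lambda>k. poly (R k) t) = 0}"
        proof
          fix t :: real assume "t \<in> \<nat>"
          hence "peval F c (\<lambda>k. \<Sum>i<r. (N(j := t)) i * (real i + 1) ^ k) = 0"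
            using Suc.prems by (intro Suc.IH) auto
          thus "t \<in> {t. peval F c (\<lambda>k. poly (R k) t) = 0}" by (simp only: R mem_Collect_eq)
        qed
        moreover have "infinite (\<nat> :: real set)"
          unfolding Nats_def by (rule range_inj_infinite) (simp add: inj_on_def)
        ultimately show "infinite {t. peval F c (\<lambda>k. poly (R k) t) = 0}" using finite_subset by blast
      qed
      thus ?thesis using R[of "N j"] by simp
    qed
  qed
  note * = this
  have "peval F c (\<lambda>k. \<Sum>i<r. (if i < r then N i else 0) * (real i + 1) ^ k) = 0"
    by (rule *[of r]) auto
  moreover have "(\<Sum>i<r. (if i < r then N i else 0) * (real i + 1) ^ k) = (\<Sum>i<r. N i * (real i + 1) ^ k)" for k
    by (intro sum.cong) auto
  ultimately show ?thesis by simp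
qed

text \<open>Solvability of the Vandermonde system at the nodes 1, ..., r, obtained from the Lagrange
  basis.\<close>

lemma ex_weights_moments:
  fixes v :: "nat \<Rightarrow> real"
  shows "\<exists>N. \<forall>k<r. (\<Sum>i<r. N i * (real i + 1) ^ k) = v k"
proof -
  let ?x = "\<lambda>i. real i + 1"
  define l where "l i = Polynomial.smult (1 / (\<Prod>q\<in>{..<r} - {i}. ?x i - ?x q)) (\<Prod>q\<in>{..<r} - {i}. [:- ?x q, 1:])" for i
  have deg: "Polynomial.degree (l i) \<le> r - 1" if "i < r" for i
  proof -
    have "Polynomial.degree (\<Prod>q\<in>{..<r} - {i}. [:- ?x q, 1:]) \<le> sum (Polynomial.degree \<circ> (\<lambda>q. [:- ?x q, 1:])) ({..<r} - {i})"
      by (rule degree_prod_sum_le) simp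
    also have "\<dots> = r - 1" using that by simp
    finally show ?thesis unfolding l_def using degree_smult_le order.trans by blast
  qed
  have leval: "poly (l i) (?x j) = (if i = j then 1 else 0)" if "i < r" "j < r" for i j
  proof (cases "i = j")
    case True
    have "(\<Prod>q\<in>{..<r} - {j}. ?x j - ?x q) \<noteq> 0" by auto
    thus ?thesis using True by (simp add: l_def poly_prod)
  next
    case False
    have "(\<Prod>q\<in>{..<r} - {i}. ?x j - ?x q) = 0"
      using that False by (intro prod_zero) auto
    hence "poly (\<Prod>q\<in>{..<r} - {i}. [:- ?x q, 1:]) (?x j) = 0"
      by (simp add: poly_prod)
    thus ?thesis using False by (simp only: l_def poly_smult mult_zero_right if_False)
  qed
  have interp: "(\<Sum>i<r. Polynomial.smult (?x i ^ k) (l i)) = Polynomial.monom 1 k" if k: "k < r" for k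
  proof (rule poly_eqI_degree[where A = "?x ` {..<r}"])
    have c: "card (?x ` {..<r}) = r" by (subst card_image) (auto simp: inj_on_def)
    have "Polynomial.degree (\<Sum>i<r. Polynomial.smult (?x i ^ k) (l i)) \<le> r - 1"
      using deg by (intro degree_sum_le) (auto intro: le_trans[OF degree_smult_le])
    thus "Polynomial.degree (\<Sum>i<r. Polynomial.smult (?x i ^ k) (l i)) < card (?x ` {..<r})" using c k by simp
    show "Polynomial.degree (Polynomial.monom 1 k :: real poly) < card (?x ` {..<r})"
      using c k by (simp add: degree_monom_eq)
    fix y assume "y \<in> ?x ` {..<r}"
    then obtain j where j: "j < r" "y = ?x j" by auto
    have "poly (\<Sum>i<r. Polynomial.smult (?x i ^ k) (l i)) y = (\<Sum>i<r. ?x i ^ k * (if i = j then 1 else 0))"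
      unfolding poly_sum j(2) by (intro sum.cong refl) (use j leval in \<open>simp only: poly_smult lessThan_iff\<close>)
    also have "\<dots> = ?x j ^ k" using j by (simp add: if_distrib cong: if_cong)
    finally show "poly (\<Sum>i<r. Polynomial.smult (?x i ^ k) (l i)) y = poly (Polynomial.monom 1 k) y"
      by (simp add: poly_monom j)
  qed
  \<comment> \<open>\<open>N i\<close> is the value at the Lagrange polynomial \<open>l i\<close> of
    the linear functional sending x^j to \<open>v j\<close>.\<close>
  define N where "N i = (\<Sum>j<r. poly.coeff (l i) j * v j)" for i
  have "(\<Sum>i<r. N i * ?x i ^ k) = v k" if k: "k < r" for k
  proof -
    have "(\<Sum>i<r. N i * ?x i ^ k) = (\<Sum>j<r. v j * (\<Sum>i<r. ?x i ^ k * poly.coeff (l i) j))"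
      unfolding N_def sum_distrib_left sum_distrib_right by (subst sum.swap) (simp only: mult_ac)
    also have "\<dots> = (\<Sum>j<r. v j * poly.coeff (\<Sum>i<r. Polynomial.smult (?x i ^ k) (l i)) j)"
      by (simp add: coeff_sum)
    also have "\<dots> = (\<Sum>j<r. v j * (if k = j then 1 else 0))" by (simp only: interp[OF k] coeff_monom)
    also have "\<dots> = v k" using k by (simp add: if_distrib cong: if_cong)
    finally show ?thesis .
  qed
  thus ?thesis by blast
qed

lemma digits_lt: "(\<And>k. a k < B) \<Longrightarrow> (\<Sum>k<K. a k * B ^ k) < (B::nat) ^ K"
proof (induction K)
  case (Suc K)
  have "Suc (a K) * B ^ K \<le> B * B ^ K" using Suc.prems[of K] by (intro mult_right_mono) auto
  thus ?case using Suc by simp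
qed simp

lemma digits_unique:
  assumes "\<And>k. a k < B" "\<And>k. b k < B" "(\<Sum>k<K. a k * B ^ k) = (\<Sum>k<K. b k * (B::nat) ^ k)" "k < K"
  shows "a k = b k"
  using assms
proof (induction K)
  case (Suc K)
  have Bp: "B ^ K > 0" using Suc.prems(1)[of 0] by simp
  have d: "(\<Sum>k<Suc K. c k * B ^ k) div B ^ K = c K" if "\<And>k. c k < B" for c
    using digits_lt[of c B K, OF that] Bp by simp
  have "a K = b K" using d[of a] d[of b] Suc.prems by metis
  moreover from this have "(\<Sum>k<K. a k * B ^ k) = (\<Sum>k<K. b k * B ^ k)" using Suc.prems(3) by simp
  ultimately show ?case using Suc by (cases "k = K") auto
qed simp

lemma sum_mset_count:
  fixes f :: "nat \<Rightarrow> nat"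
  assumes "\<And>k. k \<in># M \<Longrightarrow> k < K"
  shows "(\<Sum>k\<in>#M. f k) = (\<Sum>k<K. count M k * f k)"
proof -
  obtain xs where xs: "M = mset xs" using ex_mset by metis
  have "(\<Sum>k\<in>#M. f k) = (\<Sum>k\<in>set xs. count M k * f k)"
    using sum_list_map_eq_sum_count[of f xs] by (simp add: xs sum_mset_sum_list count_mset flip: mset_map)
  also have "\<dots> = (\<Sum>k<K. count M k * f k)"
    using assms by (intro sum.mono_neutral_left) (auto simp: xs count_mset count_list_0_iff)
  finally show ?thesis .
qed

text \<open>A polynomial relation vanishing on the Thoma simplex also vanishes when the power sums are
  replaced by \<open>\<Sum>i. N i * x i ^ k\<close> with real multiplicities \<open>N i\<close>, hence for arbitrary values of
  the power sums.\<close>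
lemma pfun_independent:
  assumes F: "finite F" "\<And>M. M \<in> F \<Longrightarrow> 0 \<notin># M \<and> 1 \<notin># M"
    and 0: "(\<Sum>M\<in>F. fscale (c M) (pfun M)) = 0" and M0: "M0 \<in> F"
  shows "c M0 = 0"
proof -
  have F2: "k \<ge> 2" if "M \<in> F" "k \<in># M" for M k
    using F(2)[OF that(1)] that(2) by (cases "k = 0 \<or> k = 1") auto
  have van: "peval F c (\<lambda>k. pcirc k w) = 0" if "w \<in> Thoma" for w
    using fun_cong[OF 0, of w] that by (simp add: sum_fscale_apply rfun_def peval_def)
  define B where "B = Suc (\<Sum>M\<in>F. size M)"
  define K where "K = Suc (\<Sum>M\<in>F. sum_mset M)"
  have Bc: "count M k < B" if "M \<in> F" for M k
  proof -
    have "count M k \<le> size M" by (rule count_le_size)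
    also have "\<dots> \<le> (\<Sum>M\<in>F. size M)" using F(1) that by (intro member_le_sum) auto
    finally show ?thesis by (simp add: B_def)
  qed
  have Kc: "k < K" if "M \<in> F" "k \<in># M" for M k
  proof -
    have "k \<le> sum_mset M" using that by (simp add: sum_mset.remove)
    also have "\<dots> \<le> (\<Sum>M\<in>F. sum_mset M)" using F(1) that by (intro member_le_sum) auto
    finally show ?thesis by (simp add: K_def)
  qed
  have all: "peval F c v = 0" for v
  proof -
    obtain N where N: "\<forall>k<K. (\<Sum>i<K. N i * (real i + 1) ^ k) = v k" using ex_weights_moments by blast
    have "peval F c (\<lambda>k. \<Sum>i<K. N i * (real i + 1) ^ k) = 0"
      by (intro peval_vanish_weights peval_vanish_lists[OF F2 van])
    moreover have "peval F c (\<lambda>k. \<Sum>i<K. N i * (real i + 1) ^ k) = peval F c v"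
      using N Kc by (intro peval_cong) auto
    ultimately show ?thesis by simp
  qed
  \<comment> \<open>Kronecker substitution: v k = x^(B^k) sends the monomial of \<open>M\<close> to
    x^(e M). The multiplicities are the base \<open>B\<close> digits of \<open>e M\<close>, so
    distinct monomials keep distinct exponents.\<close>
  define e where "e M = (\<Sum>k\<in>#M. B ^ k)" for M
  have e_inj: "M = M0" if "M \<in> F" "e M = e M0" for M
  proof (rule multiset_eqI)
    fix k
    have eM: "e M = (\<Sum>k<K. count M k * B ^ k)" if "M \<in> F" for M
      unfolding e_def using Kc that by (intro sum_mset_count) auto
    show "count M k = count M0 k"
    proof (cases "k < K")
      case True
      show ?thesis
        by (rule digits_unique[of "count M" B "count M0" K]) (use Bc M0 that eM True in auto)
    next
      case False
      hence "k \<notin># M" "k \<notin># M0" using Kc that M0 by blast+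
      thus ?thesis by (simp add: not_in_iff)
    qed
  qed
  define Q where "Q = (\<Sum>M\<in>F. Polynomial.monom (c M) (e M))"
  have pw: "(\<Prod>k\<in>#M. x ^ (B ^ k)) = x ^ e M" for M and x :: real
    unfolding e_def by (induction M) (auto simp: power_add)
  have "poly Q x = peval F c (\<lambda>k. x ^ (B ^ k))" for x
    by (simp add: Q_def peval_def poly_sum poly_monom pw)
  hence "poly Q = poly 0" using all by (auto simp: fun_eq_iff)
  hence "Q = 0" by (simp only: poly_eq_poly_eq_iff)
  hence "0 = poly.coeff Q (e M0)" by simp
  also have "\<dots> = (\<Sum>M\<in>F. if M = M0 then c M else 0)"
    unfolding Q_def coeff_sum using e_inj by (intro sum.cong) auto
  also have "\<dots> = c M0" using F(1) M0 by simp
  finally show ?thesis by simp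
qed

section \<open>Triangular operators\<close>

text \<open>\<open>A\<close> acts on the k-th layer of the filtration as the scalar
  \<open>- \<tau> k\<close>, and these scalars are distinct, so the eigenspace of
  \<open>- \<tau> k\<close> will have the dimension of that layer. The empty level 0 is the base of
  the inductions, with layers numbered from 1.\<close>

locale triangular_operator = vector_space scale
  for scale :: "'a::field \<Rightarrow> 'b::ab_group_add \<Rightarrow> 'b" (infixr \<open>*s\<close> 75) +
  fixes A :: "'b \<Rightarrow> 'b" and b :: "'i \<Rightarrow> 'b" and I :: "nat \<Rightarrow> 'i set" and \<tau> :: "nat \<Rightarrow> 'a"
    and V :: "'b set"
  assumes V_span: "V = (\<Union>k. span (b ` I k))"
    and I_0: "I 0 = {}" and I_Suc: "I k \<subseteq> I (Suc k)" and finite_I: "finite (I k)"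
    and indep: "\<And>k c i. (\<Sum>i\<in>I k. c i *s b i) = 0 \<Longrightarrow> i \<in> I k \<Longrightarrow> c i = 0"
    and A_add: "\<And>x y. x \<in> V \<Longrightarrow> y \<in> V \<Longrightarrow> A (x + y) = A x + A y"
    and A_scale: "\<And>x c. x \<in> V \<Longrightarrow> A (c *s x) = c *s A x"
    and A_tri: "\<And>x k. x \<in> span (b ` I (Suc k)) \<Longrightarrow> A x + \<tau> (Suc k) *s x \<in> span (b ` I k)"
    and \<tau>_inj: "inj_on \<tau> {1..}"
begin

definition W :: "nat \<Rightarrow> 'b set" where
  "W k = span (b ` I k)"

lemma V_eq: "V = (\<Union>k. W k)"
  by (simp add: V_span W_def)

lemma tri: "x \<in> W (Suc k) \<Longrightarrow> A x + \<tau> (Suc k) *s x \<in> W k"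
  unfolding W_def by (rule A_tri)

definition Eig :: "'a \<Rightarrow> 'b set" where
  "Eig c = {x \<in> V. A x = c *s x}"

lemma W_subspace: "subspace (W k)"
  unfolding W_def by (rule subspace_span)

lemma W_V: "W k \<subseteq> V"
  by (auto simp: V_eq)

lemma W_mono: "j \<le> k \<Longrightarrow> W j \<subseteq> W k"
  unfolding W_def using lift_Suc_mono_le[of I, OF I_Suc] by (intro span_mono) blast

lemma W_0: "W 0 = {0}"
  by (simp add: W_def I_0)

lemma V_subspace: "subspace V"
proof (rule subspaceI)
  show "0 \<in> V" using W_0 by (auto simp: V_eq)
  fix x y assume "x \<in> V" "y \<in> V"
  then obtain j k where "x \<in> W j" "y \<in> W k" by (auto simp: V_eq)
  hence "x \<in> W (max j k)" "y \<in> W (max j k)" using W_mono[of j "max j k"] W_mono[of k "max j k"] by auto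
  hence "x + y \<in> W (max j k)" using W_subspace subspace_add by blast
  thus "x + y \<in> V" using W_V by blast
next
  fix c x assume "x \<in> V"
  then obtain k where "x \<in> W k" by (auto simp: V_eq)
  hence "c *s x \<in> W k" by (rule subspace_scale[OF W_subspace])
  thus "c *s x \<in> V" using W_V by blast
qed

lemma A_diff: "x \<in> V \<Longrightarrow> y \<in> V \<Longrightarrow> A (x - y) = A x - A y"
  using A_add[of x "- 1 *s y"] A_scale[of y "- 1"] subspace_scale[OF V_subspace, of y "- 1"]
  by simp

lemma A_zero: "A 0 = 0"
  using A_scale[of 0 0] subspace_0[OF V_subspace] by simp

lemma Eig_subspace: "subspace (Eig c)"
  unfolding Eig_def
  by (rule subspaceI) (use V_subspace in \<open>auto simp: A_zero A_add A_scale subspace_0 subspace_add subspace_scale scale_right_distrib scale_left_commute\<close>)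

text \<open>\<open>A - c\<close> acts on each layer up to \<open>k\<close> as a nonzero scalar:
  solve on the top layer by dividing, then correct the remainder one level below.\<close>

lemma shifted_surj:
  assumes "\<And>j. 1 \<le> j \<Longrightarrow> j \<le> k \<Longrightarrow> \<tau> j + c \<noteq> 0" "x \<in> W k"
  shows "\<exists>y\<in>W k. A y - c *s y = x"
  using assms
proof (induction k arbitrary: x)
  case 0
  hence "x = 0" by (simp add: W_0)
  thus ?case by (auto simp: W_0 A_zero)
next
  case (Suc k)
  let ?d = "\<tau> (Suc k) + c"
  have d: "?d \<noteq> 0" using Suc.prems(1)[of "Suc k"] by simp
  define y where "y = (- inverse ?d) *s x"
  have y: "y \<in> W (Suc k)" unfolding y_def using Suc.prems W_subspace subspace_scale by blast
  have dy: "?d *s y = - x" using d by (simp add: y_def)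
  define r where "r = A y + \<tau> (Suc k) *s y"
  have "r \<in> W k" unfolding r_def by (rule tri[OF y])
  then obtain y' where y': "y' \<in> W k" "A y' - c *s y' = r" using Suc by force
  have y'S: "y' \<in> W (Suc k)" using y' W_mono[of k "Suc k"] by auto
  have "A (y - y') - c *s (y - y') = (A y - c *s y) - (A y' - c *s y')"
    using A_diff[of y y'] y y'S W_V by (auto simp: scale_right_diff_distrib algebra_simps)
  also have "A y - c *s y = r - ?d *s y" by (simp add: r_def scale_left_distrib)
  finally have "A (y - y') - c *s (y - y') = x" using y' dy by simp
  moreover have "y - y' \<in> W (Suc k)" using y y'S W_subspace subspace_diff by blast
  ultimately show ?case by blast
qed

text \<open>Triangularity puts \<open>\<tau> (Suc k) + c\<close> times the eigenvector into
  \<open>W k\<close>; a nonzero factor therefore moves it down one level.\<close>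

lemma Eig_reduce:
  assumes "x \<in> W k" "A x = c *s x" "j \<le> k" "\<And>i. j < i \<Longrightarrow> i \<le> k \<Longrightarrow> \<tau> i + c \<noteq> 0"
  shows "x \<in> W j"
  using assms(3,1,4)
proof (induction k rule: dec_induct)
  case (step k)
  have "A x + \<tau> (Suc k) *s x \<in> W k" using step by (intro tri)
  hence "(\<tau> (Suc k) + c) *s x \<in> W k" using assms(2) by (simp add: scale_left_distrib add.commute)
  hence "inverse (\<tau> (Suc k) + c) *s ((\<tau> (Suc k) + c) *s x) \<in> W k"
    using W_subspace subspace_scale by blast
  moreover have "\<tau> (Suc k) + c \<noteq> 0" using step by auto
  ultimately have "x \<in> W k" by simp
  thus ?case using step by auto
qed simp

lemma \<tau>_neq: "1 \<le> i \<Longrightarrow> 1 \<le> j \<Longrightarrow> i \<noteq> j \<Longrightarrow> \<tau> i + - \<tau> j \<noteq> 0"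
  using \<tau>_inj by (auto simp: inj_on_def)

lemma Eig_tau_W:
  assumes "k \<ge> 1" shows "Eig (- \<tau> k) \<subseteq> W k"
proof
  fix x assume "x \<in> Eig (- \<tau> k)"
  hence "x \<in> V" and Ax: "A x = - \<tau> k *s x" by (auto simp: Eig_def)
  then obtain j where xj: "x \<in> W j" by (auto simp: V_eq)
  note x = xj Ax
  show "x \<in> W k"
  proof (cases "j \<le> k")
    case True thus ?thesis using x W_mono by blast
  next
    case False
    thus ?thesis using x \<tau>_neq[of _ k] assms by (intro Eig_reduce[OF x]) auto
  qed
qed

lemma Eig_tau_Int:
  assumes "k \<ge> 1" "x \<in> Eig (- \<tau> k)" "x \<in> W (k - 1)" shows "x = 0"
proof -
  have "x \<in> W 0"
  proof (rule Eig_reduce[OF assms(3)])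
    show "A x = - \<tau> k *s x" using assms(2) unfolding Eig_def by blast
    show "\<tau> i + - \<tau> k \<noteq> 0" if "0 < i" "i \<le> k - 1" for i
      using that assms(1) by (intro \<tau>_neq) linarith+
  qed simp
  thus ?thesis by (simp add: W_0)
qed

lemma Eig_trivial:
  assumes "\<And>k. k \<ge> 1 \<Longrightarrow> c \<noteq> - \<tau> k" shows "Eig c = {0}"
proof -
  have "x = 0" if x: "x \<in> Eig c" for x
  proof -
    have "x \<in> V" and Ax: "A x = c *s x" using x by (auto simp: Eig_def)
    then obtain k where xk: "x \<in> W k" by (auto simp: V_eq)
    note k = xk Ax
    have "x \<in> W 0" using assms by (intro Eig_reduce[OF k]) (auto simp: add_eq_0_iff)
    thus ?thesis by (simp add: W_0)
  qed
  thus ?thesis using subspace_0[OF Eig_subspace] by blast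
qed

text \<open>\<open>A + \<tau> k\<close> maps \<open>x\<close> into \<open>W (k - 1)\<close> and is
  surjective on that space, so changing \<open>x\<close> below level \<open>k\<close> turns it into
  an eigenvector.\<close>

lemma eigen_correction:
  assumes k: "k \<ge> 1" and x: "x \<in> W k"
  shows "\<exists>e\<in>Eig (- \<tau> k). x - e \<in> W (k - 1)"
proof -
  obtain k' where k': "k = Suc k'" using k by (cases k) auto
  have "A x + \<tau> k *s x \<in> W k'" using tri[of x k'] x k' by simp
  moreover have "\<tau> j + - \<tau> k \<noteq> 0" if "1 \<le> j" "j \<le> k'" for j using \<tau>_neq[of j k] that k' by auto
  ultimately obtain g where g: "g \<in> W k'" "A g - (- \<tau> k) *s g = A x + \<tau> k *s x"
    using shifted_surj[of k' "- \<tau> k" "A x + \<tau> k *s x"] by blast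
  have V: "x \<in> V" "g \<in> V" using x g W_V by blast+
  have "A (x - g) = - \<tau> k *s (x - g)"
  proof -
    have "A x = (A g + \<tau> k *s g) - \<tau> k *s x" using g(2) by simp
    thus ?thesis using A_diff[OF V] by (simp add: scale_right_diff_distrib)
  qed
  hence "x - g \<in> Eig (- \<tau> k)" using V V_subspace by (simp add: Eig_def subspace_diff)
  moreover have "x - (x - g) \<in> W (k - 1)" using g k' by simp
  ultimately show ?thesis by blast
qed

lemma V_eq_span_Eig: "V = span (\<Union>c. Eig c)"
proof
  show "span (\<Union>c. Eig c) \<subseteq> V"
    using V_subspace by (intro span_minimal) (auto simp: Eig_def)
  have "W k \<subseteq> span (\<Union>c. Eig c)" for k
  proof (induction k)
    case 0 thus ?case by (simp add: W_0 span_zero)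
  next
    case (Suc k)
    show ?case
    proof
      fix x assume "x \<in> W (Suc k)"
      then obtain e where e: "e \<in> Eig (- \<tau> (Suc k))" "x - e \<in> W k" using eigen_correction[of "Suc k" x] by auto
      hence "e + (x - e) \<in> span (\<Union>c. Eig c)" using Suc by (intro span_add) (auto intro: span_base)
      thus "x \<in> span (\<Union>c. Eig c)" by simp
    qed
  qed
  thus "V \<subseteq> span (\<Union>c. Eig c)" by (auto simp: V_eq)
qed

lemma span_finite_family:
  assumes "finite J" "x \<in> span (b ` J)"
  shows "\<exists>d. x = (\<Sum>j\<in>J. d j *s b j)"
proof -
  let ?T = "{\<Sum>j\<in>J. d j *s b j | d. True}"
  have "subspace ?T"
  proof (rule subspaceI)
    show "0 \<in> ?T" by (intro CollectI exI[of _ "\<lambda>_. 0"]) simp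
    fix x y assume "x \<in> ?T" "y \<in> ?T"
    then obtain d d' where "x = (\<Sum>j\<in>J. d j *s b j)" "y = (\<Sum>j\<in>J. d' j *s b j)" by blast
    hence "x + y = (\<Sum>j\<in>J. (d j + d' j) *s b j)" by (simp add: scale_left_distrib sum.distrib)
    thus "x + y \<in> ?T" by (intro CollectI exI[of _ "\<lambda>j. d j + d' j"]) simp
  next
    fix c x assume "x \<in> ?T"
    then obtain d where "x = (\<Sum>j\<in>J. d j *s b j)" by blast
    hence "c *s x = (\<Sum>j\<in>J. (c * d j) *s b j)" by (simp add: scale_sum_right)
    thus "c *s x \<in> ?T" by (intro CollectI exI[of _ "\<lambda>j. c * d j"]) simp
  qed
  moreover have "b ` J \<subseteq> ?T"
  proof clarify
    fix i assume i: "i \<in> J"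
    have "(\<Sum>j\<in>J. (if j = i then 1 else 0) *s b j) = (\<Sum>j\<in>J. if j = i then b j else 0)"
      by (intro sum.cong) auto
    also have "\<dots> = b i" using assms(1) i by simp
    finally show "\<exists>d. b i = (\<Sum>j\<in>J. d j *s b j) \<and> True" by metis
  qed
  ultimately have "span (b ` J) \<subseteq> ?T" by (intro span_minimal)
  thus ?thesis using assms(2) by blast
qed

text \<open>Correcting the basis vectors of the k-th layer gives a basis of the eigenspace.
  Independence is inherited modulo \<open>W (k - 1)\<close>; spanning holds because an eigenvector
  for \<open>- \<tau> k\<close> inside \<open>W (k - 1)\<close> is zero.\<close>

lemma dim_Eig:
  assumes k: "k \<ge> 1"
  shows "dim (Eig (- \<tau> k)) = card (I k - I (k - 1))"
proof -
  let ?D = "I k - I (k - 1)"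
  have sub: "I (k - 1) \<subseteq> I k" using I_Suc[of "k - 1"] k by simp
  have fin: "finite ?D" using finite_I by simp
  have "\<exists>e. e \<in> Eig (- \<tau> k) \<and> b i - e \<in> W (k - 1)" if "i \<in> ?D" for i
    using eigen_correction[OF k, of "b i"] that by (auto simp: W_def intro: span_base)
  then obtain e where e: "\<And>i. i \<in> ?D \<Longrightarrow> e i \<in> Eig (- \<tau> k)" "\<And>i. i \<in> ?D \<Longrightarrow> b i - e i \<in> W (k - 1)"
    by metis
  have rest: "(\<Sum>i\<in>?D. u i *s (b i - e i)) \<in> W (k - 1)" for u
    using e(2) W_subspace by (intro subspace_sum subspace_scale) auto
  have ind: "u i = 0" if u: "(\<Sum>i\<in>?D. u i *s e i) = 0" and i: "i \<in> ?D" for u i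
  proof -
    have "(\<Sum>i\<in>?D. u i *s b i) = (\<Sum>i\<in>?D. u i *s (b i - e i))"
      using u by (simp add: scale_right_diff_distrib sum_subtractf)
    hence "(\<Sum>i\<in>?D. u i *s b i) \<in> span (b ` I (k - 1))" using rest[of u] by (simp add: W_def)
    then obtain d where d: "(\<Sum>i\<in>?D. u i *s b i) = (\<Sum>j\<in>I (k - 1). d j *s b j)"
      using span_finite_family finite_I by blast
    define c where "c i = (if i \<in> I (k - 1) then - d i else u i)" for i
    have "(\<Sum>i\<in>I k. c i *s b i) = (\<Sum>i\<in>?D. c i *s b i) + (\<Sum>i\<in>I (k - 1). c i *s b i)"
      by (rule sum.subset_diff[OF sub finite_I])
    also have "(\<Sum>i\<in>?D. c i *s b i) = (\<Sum>i\<in>?D. u i *s b i)" by (intro sum.cong) (auto simp: c_def)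
    also have "(\<Sum>i\<in>I (k - 1). c i *s b i) = - (\<Sum>j\<in>I (k - 1). d j *s b j)"
      unfolding sum_negf[symmetric] by (intro sum.cong) (auto simp: c_def)
    finally have "(\<Sum>i\<in>I k. c i *s b i) = 0" using d by simp
    hence "c i = 0" using i by (intro indep[of c k i]) auto
    thus ?thesis using i by (simp add: c_def)
  qed
  have inj: "inj_on e ?D"
  proof (rule inj_onI, rule ccontr)
    fix i j assume ij: "i \<in> ?D" "j \<in> ?D" "e i = e j" "i \<noteq> j"
    \<comment> \<open>If two corrected vectors coincided, the difference of the two indicator
      functions would be a relation of the family; excluding this lets the family be treated as a
      set.\<close>
    define u where "u l = (if l = i then 1 else 0) - (if l = j then 1 else 0 :: 'a)" for l
    have "(\<Sum>l\<in>?D. u l *s e l) = (\<Sum>l\<in>?D. if l = i then e l else 0) - (\<Sum>l\<in>?D. if l = j then e l else 0)"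
      unfolding sum_subtractf[symmetric] by (intro sum.cong) (auto simp: u_def)
    also have "\<dots> = 0" using fin ij by (simp del: Diff_iff)
    finally have "u i = 0" using ij by (intro ind[of u i])
    thus False using ij by (simp add: u_def)
  qed
  have "independent (e ` ?D)"
  proof (rule independent_if_scalars_zero)
    show "finite (e ` ?D)" using fin by simp
    fix f x assume f: "(\<Sum>x\<in>e ` ?D. f x *s x) = 0" and "x \<in> e ` ?D"
    then obtain i where i: "i \<in> ?D" "x = e i" by blast
    have "(\<Sum>i\<in>?D. f (e i) *s e i) = 0" using f unfolding sum.reindex[OF inj] o_def .
    from ind[OF this i(1)] show "f x = 0" by (simp add: i)
  qed
  moreover have "span (e ` ?D) = span (Eig (- \<tau> k))"
  proof (rule span_eq[THEN iffD2], intro conjI subsetI)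
    fix x assume "x \<in> e ` ?D" thus "x \<in> span (Eig (- \<tau> k))" using e(1) by (auto intro: span_base)
  next
    fix x assume x: "x \<in> Eig (- \<tau> k)"
    hence "x \<in> span (b ` I k)" using Eig_tau_W[OF k] by (auto simp: W_def)
    then obtain d where d: "x = (\<Sum>j\<in>I k. d j *s b j)" using span_finite_family finite_I by blast
    define y where "y = (\<Sum>i\<in>?D. d i *s e i)"
    have y: "y \<in> Eig (- \<tau> k)" unfolding y_def using e(1) Eig_subspace by (intro subspace_sum subspace_scale) auto
    have "x = (\<Sum>i\<in>?D. d i *s b i) + (\<Sum>i\<in>I (k - 1). d i *s b i)"
      unfolding d by (rule sum.subset_diff[OF sub finite_I])
    hence "x - y = (\<Sum>i\<in>?D. d i *s (b i - e i)) + (\<Sum>i\<in>I (k - 1). d i *s b i)"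
      by (simp add: y_def scale_right_diff_distrib sum_subtractf)
    moreover have "(\<Sum>i\<in>I (k - 1). d i *s b i) \<in> W (k - 1)"
      unfolding W_def by (intro span_sum span_scale span_base) auto
    ultimately have "x - y \<in> W (k - 1)" using rest[of d] W_subspace subspace_add by metis
    moreover have "x - y \<in> Eig (- \<tau> k)" using x y Eig_subspace subspace_diff by blast
    ultimately have "x = y" using Eig_tau_Int[OF k, of "x - y"] by simp
    thus "x \<in> span (e ` ?D)" by (simp only: y_def) (intro span_sum span_scale span_base imageI; simp)
  qed
  ultimately have "dim (Eig (- \<tau> k)) = card (e ` ?D)" by (intro dim_eq_card)
  thus ?thesis unfolding card_image[OF inj] .
qed

end

section \<open>Partitions without parts equal to 1\<close>

lemma finite_NO [simp]: "finite (NO k)"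
proof (rule finite_subset)
  show "NO k \<subseteq> (\<Union>j\<le>k. MP j)" by (auto simp: NO_def MP_def)
qed simp

lemma NO_one: "NO 1 = {{#}}"
proof -
  have "M = {#}" if "M \<in> NO 1" for M
  proof (rule ccontr)
    assume "M \<noteq> {#}"
    then obtain x where x: "x \<in># M" by blast
    hence "x \<le> 1" using that by (auto simp: NO_def sum_mset.remove)
    hence "x = 0 \<or> x = 1" by linarith
    thus False using x that by (auto simp: NO_def)
  qed
  thus ?thesis by (auto simp: NO_def)
qed

lemma NO_diff: "k \<ge> 1 \<Longrightarrow> NO k - NO (k - 1) = {M \<in> MP k. 1 \<notin># M}"
  by (auto simp: NO_def MP_def)

lemma card_no_ones: "card {M \<in> MP k. 1 \<notin># M} = partitions_no_ones k"
proof -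
  have "bij_betw mset {l \<in> YD k. 1 \<notin> set l} {M \<in> MP k. 1 \<notin># M}"
  proof -
    have "inj_on mset {l \<in> YD k. 1 \<notin> set l}"
      using bij_betw_mset_YD[of k] unfolding bij_betw_def by (auto intro: inj_on_subset)
    moreover have "mset ` {l \<in> YD k. 1 \<notin> set l} = {M \<in> mset ` YD k. 1 \<notin># M}" by auto
    ultimately show ?thesis using bij_betw_mset_YD[of k] by (simp add: bij_betw_def)
  qed
  thus ?thesis unfolding partitions_no_ones_def by (simp add: bij_betw_same_card)
qed

section \<open>The spectrum of \<open>A\<close>\<close>

locale zoperator = zparam +
  fixes A :: "(thoma \<Rightarrow> real) \<Rightarrow> (thoma \<Rightarrow> real)"
  assumes A: "is_Aop z z' A"
begin

lemma A_linear: "f \<in> LamC \<Longrightarrow> g \<in> LamC \<Longrightarrow> A (\<lambda>w. a * f w + b * g w) = (\<lambda>w. a * A f w + b * A g w)"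
  using A unfolding is_Aop_def by blast

lemma A_plus: "f \<in> LamC \<Longrightarrow> g \<in> LamC \<Longrightarrow> A (f + g) = A f + A g"
  using A_linear[of f g 1 1] by (simp add: plus_fun_def)

lemma A_fscale: "f \<in> LamC \<Longrightarrow> A (fscale c f) = fscale c (A f)"
  using A_linear[of f f c 0] by (simp add: fscale_def)

lemma A_scirc:
  assumes "is_partition m"
  shows "A (scirc m) = fscale (- sigma z z' (sum_list m)) (scirc m) +
     (\<Sum>k | covered_by k m. fscale (bw u t (boxes m - boxes k)) (scirc k))"
proof -
  have "A (scirc m) = (\<lambda>w. - sigma z z' (sum_list m) * scirc m w +
     (\<Sum>k | covered_by k m. bw u t (boxes m - boxes k) * scirc k w))"
    using A assms unfolding is_Aop_def gpoch_mult Re_complex_of_real by blast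
  thus ?thesis by (simp only: sum_fscale_apply) (simp add: fscale_def plus_fun_def)
qed

text \<open>Constants are placed at level 1, with level 0 empty. No separate level for degree 0 is
  lost, because \<open>NO 0\<close> and \<open>NO 1\<close> both contain only the empty
  multiset.\<close>

definition I :: "nat \<Rightarrow> nat multiset set" where
  "I k = (if k = 0 then {} else NO k)"

text \<open>Level 1 consists of the constants, which \<open>A\<close> annihilates, so its scalar is
  0 and not the positive number \<open>sigma z z' 1\<close>.\<close>

definition tau :: "nat \<Rightarrow> real" where
  "tau k = (if k = 1 then 0 else sigma z z' k)"

definition U :: "nat \<Rightarrow> (thoma \<Rightarrow> real) set" where
  "U k = fs.span (pfun ` I k)"

lemma U_eq: "k \<ge> 1 \<Longrightarrow> U k = fs.span (scirc ` {m. is_partition m \<and> sum_list m \<le> k})"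
  by (simp add: U_def I_def span_scirc_eq_span_pfun)

lemma LamC_subspace: "fs.subspace LamC"
  unfolding LamC_eq_span by (rule fs.subspace_span)

lemma LamC_eq_U: "LamC = (\<Union>k. U k)"
proof (intro equalityI subsetI)
  fix f assume "f \<in> (\<Union>k. U k)"
  then obtain k where k: "f \<in> U k" by blast
  have "f \<in> U (max k 1)"
  proof (cases "k = 0")
    case True
    hence "f = 0" using k by (simp add: U_def I_def)
    thus ?thesis unfolding U_def using fs.span_zero by blast
  next
    case False
    hence "max k 1 = k" by simp
    thus ?thesis using k by simp
  qed
  moreover have "U (max k 1) \<subseteq> LamC"
  proof -
    have "U (max k 1) = fs.span (scirc ` {m. is_partition m \<and> sum_list m \<le> max k 1})"
      by (rule U_eq) simp
    thus ?thesis unfolding LamC_eq_span by (simp only:) (intro fs.span_mono, auto)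
  qed
  ultimately show "f \<in> LamC" by blast
next
  fix f assume "f \<in> LamC"
  then obtain S c where S: "finite S" "\<forall>mu\<in>S. is_partition mu" "f = (\<lambda>w. \<Sum>mu\<in>S. c mu * scirc mu w)"
    unfolding LamC_def mem_Collect_eq by (elim exE conjE)
  define k where "k = Suc (\<Sum>mu\<in>S. sum_list mu)"
  have "f = (\<Sum>mu\<in>S. fscale (c mu) (scirc mu))" by (simp add: S sum_fscale_apply)
  moreover have "scirc mu \<in> U k" if "mu \<in> S" for mu
  proof -
    have "sum_list mu \<le> (\<Sum>mu\<in>S. sum_list mu)" using S(1) that by (intro member_le_sum) auto
    thus ?thesis using that S(2) by (subst U_eq) (auto simp: k_def intro!: fs.span_base)
  qed
  ultimately have "f \<in> U k"
    by (simp only: U_def) (intro fs.span_sum fs.span_scale; simp)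
  thus "f \<in> (\<Union>k. U k)" by blast
qed

lemma scirc_U: "is_partition m \<Longrightarrow> sum_list m \<le> k \<Longrightarrow> k \<ge> 1 \<Longrightarrow> scirc m \<in> U k"
  by (subst U_eq) (auto intro!: fs.span_base)

text \<open>On a Schur function of size k + 1 the added multiple cancels the diagonal term of
  \<open>A\<close>; smaller Schur functions and the terms of lower degree already lie in
  \<open>U k\<close>. Level 1 is treated separately because there the scalar is 0.\<close>

lemma tri: assumes f: "f \<in> U (Suc k)" shows "A f + fscale (tau (Suc k)) f \<in> U k"
proof (cases "k = 0")
  case True
  \<comment> \<open>Both sides are the constant 1 on the simplex, so level 1 is spanned by the Schur
    function of the empty diagram.\<close>
  have one: "pfun {#} = scirc []"
    by (rule ext) (simp add: rfun_def scirc_def sign_id)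
  have "{k. covered_by k []} = {}" by (auto simp: covered_by_iff rowlen_def fun_eq_iff)
  hence A1: "A (scirc []) = 0"
    using A_scirc[of "[]"] by (simp add: is_partition_def sigma_def)
  have "f \<in> fs.span {scirc []}" using f True by (simp add: U_def I_def NO_one[simplified] one)
  then obtain c where "f = fscale c (scirc [])" by (auto simp: fs.span_singleton)
  moreover have "scirc [] \<in> LamC" unfolding LamC_eq_span by (auto simp: is_partition_def intro!: fs.span_base)
  ultimately have "A f = 0" using A_fscale[of "scirc []" c] A1 by simp
  thus ?thesis using True by (simp add: tau_def U_def fs.span_zero)
next
  case False
  hence k: "k \<ge> 1" by simp
  have tau: "tau (Suc k) = sigma z z' (Suc k)" using False by (simp add: tau_def)
  have Us: "fs.subspace (U k)" unfolding U_def by (rule fs.subspace_span)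
  let ?S = "{f \<in> LamC. A f + fscale (tau (Suc k)) f \<in> U k}"
  have "fs.subspace ?S"
  proof (rule fs.subspaceI)
    have "A 0 = 0" using A_fscale[of 0 0] fs.subspace_0[OF LamC_subspace] by simp
    thus "0 \<in> ?S" using fs.subspace_0[OF LamC_subspace] fs.subspace_0[OF Us] by simp
  next
    fix f g assume "f \<in> ?S" "g \<in> ?S"
    moreover from this have "A (f + g) + fscale (tau (Suc k)) (f + g) =
       (A f + fscale (tau (Suc k)) f) + (A g + fscale (tau (Suc k)) g)"
      by (simp add: A_plus fs.scale_right_distrib)
    ultimately show "f + g \<in> ?S"
      using fs.subspace_add[OF LamC_subspace] fs.subspace_add[OF Us] by simp
  next
    fix c f assume "f \<in> ?S"
    moreover from this have "A (fscale c f) + fscale (tau (Suc k)) (fscale c f) = fscale c (A f + fscale (tau (Suc k)) f)"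
      by (simp add: A_fscale fs.scale_right_distrib fs.scale_left_commute)
    ultimately show "fscale c f \<in> ?S"
      using fs.subspace_scale[OF LamC_subspace] fs.subspace_scale[OF Us] by simp
  qed
  moreover have "scirc m \<in> ?S" if m: "is_partition m" "sum_list m \<le> Suc k" for m
  proof -
    have "A (scirc m) + fscale (tau (Suc k)) (scirc m) =
      fscale (sigma z z' (Suc k) - sigma z z' (sum_list m)) (scirc m) +
      (\<Sum>k | covered_by k m. fscale (bw u t (boxes m - boxes k)) (scirc k))"
      unfolding A_scirc[OF m(1)] tau by (simp add: fs.scale_left_diff_distrib algebra_simps)
    moreover have "fscale (sigma z z' (Suc k) - sigma z z' (sum_list m)) (scirc m) \<in> U k"
    proof (cases "sum_list m = Suc k")
      case True thus ?thesis using fs.subspace_0[OF Us] by simp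
    next
      case False thus ?thesis using m k by (intro fs.subspace_scale[OF Us] scirc_U) auto
    qed
    moreover have "(\<Sum>k | covered_by k m. fscale (bw u t (boxes m - boxes k)) (scirc k)) \<in> U k"
      using m k by (intro fs.subspace_sum[OF Us] fs.subspace_scale[OF Us] scirc_U)
        (auto simp: sum_list_covered covered_by_def)
    ultimately have "A (scirc m) + fscale (tau (Suc k)) (scirc m) \<in> U k"
      using fs.subspace_add[OF Us] by simp
    moreover have "scirc m \<in> LamC" unfolding LamC_eq_span using m by (auto intro!: fs.span_base)
    ultimately show ?thesis by simp
  qed
  ultimately have "fs.span (scirc ` {m. is_partition m \<and> sum_list m \<le> Suc k}) \<subseteq> ?S"
    by (intro fs.span_minimal) auto
  thus ?thesis using f U_eq[of "Suc k"] by auto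
qed

lemma sigma_less: "1 \<le> i \<Longrightarrow> i < j \<Longrightarrow> sigma z z' i < sigma z z' j"
proof -
  assume ij: "1 \<le> i" "i < j"
  have "real i * (real i - 1 + t) < real j * (real j - 1 + t)"
    using ij t_pos by (intro mult_strict_mono) auto
  thus ?thesis by (simp add: sigma_def t_def)
qed

lemma sigma_pos: "1 \<le> i \<Longrightarrow> sigma z z' i > 0"
  using t_pos unfolding sigma_def t_def by (intro mult_pos_pos) auto

lemma tau_inj: "inj_on tau {1..}"
proof (rule linorder_inj_onI)
  fix i j :: nat assume ij: "i \<in> {1..}" "j \<in> {1..}" "i < j"
  thus "tau i \<noteq> tau j" using sigma_less[of i j] sigma_pos[of j] by (auto simp: tau_def)
qed auto

sublocale T: triangular_operator fscale A pfun I tau LamC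
proof (unfold_locales)
  show "LamC = (\<Union>k. fs.span (pfun ` I k))" by (simp add: LamC_eq_U U_def)
  show "I 0 = {}" by (simp add: I_def)
  show "I k \<subseteq> I (Suc k)" for k by (auto simp: I_def NO_def)
  show "finite (I k)" for k by (simp add: I_def)
  show "c i = 0" if "(\<Sum>i\<in>I k. fscale (c i) (pfun i)) = 0" "i \<in> I k" for k c i
  proof (rule pfun_independent[of "I k" c i])
    show "finite (I k)" by (simp add: I_def)
    show "0 \<notin># M \<and> 1 \<notin># M" if "M \<in> I k" for M
      using that by (auto simp: I_def NO_def split: if_splits)
  qed (use that in auto)
  show "A (x + y) = A x + A y" if "x \<in> LamC" "y \<in> LamC" for x y using that by (rule A_plus)
  show "A (fscale c x) = fscale c (A x)" if "x \<in> LamC" for x c using that by (rule A_fscale)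
  show "A x + fscale (tau (Suc k)) x \<in> fs.span (pfun ` I k)" if "x \<in> fs.span (pfun ` I (Suc k))" for x k
    using that tri[of x k] by (simp add: U_def)
  show "inj_on tau {1..}" by (rule tau_inj)
qed

lemma eigenspace_eq: "eigenspace A c = T.Eig c"
  by (simp add: eigenspace_def T.Eig_def)

lemma dim_eigenspace:
  "fs.dim (eigenspace A 0) = 1" "m \<ge> 2 \<Longrightarrow> fs.dim (eigenspace A (- sigma z z' m)) = partitions_no_ones m"
proof -
  show "fs.dim (eigenspace A 0) = 1"
    using T.dim_Eig[of 1] by (simp add: eigenspace_eq tau_def I_def NO_one[simplified])
next
  assume m: "m \<ge> 2"
  have "I m - I (m - 1) = {M \<in> MP m. 1 \<notin># M}" using m NO_diff[of m] by (simp add: I_def)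
  thus "fs.dim (eigenspace A (- sigma z z' m)) = partitions_no_ones m"
    using T.dim_Eig[of m] m card_no_ones[of m] by (simp add: eigenspace_eq tau_def)
qed

lemma partitions_no_ones_pos: "m \<ge> 2 \<Longrightarrow> partitions_no_ones m > 0"
proof -
  assume m: "m \<ge> 2"
  have "[m] \<in> {l \<in> YD m. 1 \<notin> set l}" using m by (auto simp: YD_def is_partition_def)
  thus ?thesis unfolding partitions_no_ones_def by (subst card_gt_0_iff) auto
qed

lemma eigenvalues: "{c. eigenspace A c \<noteq> {0}} = {0} \<union> {- sigma z z' m | m. m \<ge> 2}"
proof -
  have nz: "eigenspace A c \<noteq> {0}" if "fs.dim (eigenspace A c) > 0" for c
  proof
    assume "eigenspace A c = {0}"
    hence "fs.dim (eigenspace A c) = 0"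
      using fs.dim_eq_card[of "{}" "{0}"] by (simp add: fs.span_insert_0 fs.independent_empty)
    thus False using that by simp
  qed
  have "c \<in> {0} \<union> {- sigma z z' m | m. m \<ge> 2}" if c: "eigenspace A c \<noteq> {0}" for c
  proof -
    obtain k where "k \<ge> 1" "c = - tau k" using c T.Eig_trivial[of c] unfolding eigenspace_eq by blast
    thus ?thesis by (cases "k = 1") (auto simp: tau_def)
  qed
  moreover have "eigenspace A 0 \<noteq> {0}" using dim_eigenspace(1) by (intro nz) simp
  moreover have "eigenspace A (- sigma z z' m) \<noteq> {0}" if "m \<ge> 2" for m
    using dim_eigenspace(2)[OF that] partitions_no_ones_pos[OF that] by (intro nz) simp
  ultimately show ?thesis by blast
qed

end

locale zoperator_boundary = zoperator z z' u t A + boundary_zmeasure z z' u t P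
  for z z' u t A P
begin

text \<open>By bilinearity this reduces to \<open>Asc_symmetric\<close>. The representation of a
  function by Schur functions is not unique, but any one of them computes \<open>A\<close> on
  it.\<close>

lemma A_symmetric:
  assumes f: "f \<in> LamC" and g: "g \<in> LamC"
  shows "(\<integral>w. A f w * g w \<partial>P) = (\<integral>w. f w * A g w \<partial>P)"
proof -
  have AS: "A (scirc m) = Asc m" if "is_partition m" for m
    unfolding A_scirc[OF that] sum_fscale_apply by (rule ext) (simp add: Asc_def fscale_def)
  have As: "\<exists>S c. finite S \<and> (\<forall>mu\<in>S. is_partition mu) \<and> h = (\<Sum>mu\<in>S. fscale (c mu) (scirc mu)) \<and>
      A h = (\<Sum>mu\<in>S. fscale (c mu) (Asc mu))" if h: "h \<in> LamC" for h
  proof -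
    obtain S c where S: "finite S" "\<forall>mu\<in>S. is_partition mu" "h = (\<lambda>w. \<Sum>mu\<in>S. c mu * scirc mu w)"
      using h unfolding LamC_def mem_Collect_eq by (elim exE conjE)
    have "A (\<Sum>mu\<in>S. fscale (c mu) (scirc mu)) = (\<Sum>mu\<in>S. fscale (c mu) (Asc mu))"
      using S(1,2)
    proof (induction S)
      case empty show ?case by (simp only: sum.empty T.A_zero)
    next
      case (insert m S)
      have s: "scirc mu \<in> LamC" if "is_partition mu" for mu
        unfolding LamC_eq_span using that by (auto intro!: fs.span_base)
      have "fscale (c m) (scirc m) \<in> LamC" using insert s fs.subspace_scale[OF LamC_subspace] by auto
      moreover have "(\<Sum>mu\<in>S. fscale (c mu) (scirc mu)) \<in> LamC"
        using insert s by (intro fs.subspace_sum[OF LamC_subspace] fs.subspace_scale[OF LamC_subspace]) auto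
      ultimately have "A (fscale (c m) (scirc m) + (\<Sum>mu\<in>S. fscale (c mu) (scirc mu))) =
          fscale (c m) (A (scirc m)) + A (\<Sum>mu\<in>S. fscale (c mu) (scirc mu))"
        using insert.prems s by (subst A_plus) (simp_all add: A_fscale)
      moreover have "A (\<Sum>mu\<in>S. fscale (c mu) (scirc mu)) = (\<Sum>mu\<in>S. fscale (c mu) (Asc mu))"
        "A (scirc m) = Asc m" using insert.IH insert.prems AS by blast+
      ultimately show ?case by (simp only: sum.insert[OF insert.hyps])
    qed
    moreover have "h = (\<Sum>mu\<in>S. fscale (c mu) (scirc mu))" by (simp add: S sum_fscale_apply)
    ultimately show ?thesis using S(1,2) by blast
  qed
  obtain S c where S: "\<forall>mu\<in>S. is_partition mu" "f = (\<Sum>mu\<in>S. fscale (c mu) (scirc mu))"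
      "A f = (\<Sum>mu\<in>S. fscale (c mu) (Asc mu))" using As[OF f] by blast
  obtain S' d where S': "\<forall>mu\<in>S'. is_partition mu" "g = (\<Sum>mu\<in>S'. fscale (d mu) (scirc mu))"
      "A g = (\<Sum>mu\<in>S'. fscale (d mu) (Asc mu))" using As[OF g] by blast
  have int: "integrable P (\<lambda>w. Asc a w * scirc b w)" for a b
  proof -
    have "(\<lambda>w. Asc a w * scirc b w) = (\<lambda>w. - sigma z z' (sum_list a) * (scirc a w * scirc b w) +
       (\<Sum>k | covered_by k a. bw u t (boxes a - boxes k) * (scirc k w * scirc b w)))"
      by (rule ext) (simp only: Asc_def distrib_right sum_distrib_right mult.assoc)
    thus ?thesis
      by (simp only:) (intro Bochner_Integration.integrable_add Bochner_Integration.integrable_sum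
          integrable_mult_right integrable_scirc_mult)
  qed
  have int': "integrable P (\<lambda>w. scirc a w * Asc b w)" for a b
    using int[of b a] by (simp only: mult.commute)
  have "(\<integral>w. A f w * g w \<partial>P) = (\<integral>w. (\<Sum>a\<in>S. \<Sum>b\<in>S'. c a * d b * (Asc a w * scirc b w)) \<partial>P)"
    unfolding S(3) S'(2) sum_fscale_apply sum_product by (simp only: mult_ac)
  also have "\<dots> = (\<Sum>a\<in>S. \<Sum>b\<in>S'. c a * d b * (\<integral>w. Asc a w * scirc b w \<partial>P))"
    using int by (simp add: Bochner_Integration.integral_sum)
  also have "\<dots> = (\<Sum>a\<in>S. \<Sum>b\<in>S'. c a * d b * (\<integral>w. scirc a w * Asc b w \<partial>P))"
    using S(1) S'(1) Asc_symmetric by (intro sum.cong) auto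
  also have "\<dots> = (\<integral>w. (\<Sum>a\<in>S. \<Sum>b\<in>S'. c a * d b * (scirc a w * Asc b w)) \<partial>P)"
    using int' by (simp add: Bochner_Integration.integral_sum)
  also have "\<dots> = (\<integral>w. f w * A g w \<partial>P)"
    unfolding S(2) S'(3) sum_fscale_apply sum_product by (simp only: mult_ac)
  finally show ?thesis .
qed

lemma eigenspaces_orthogonal:
  assumes "a \<noteq> b" "f \<in> eigenspace A a" "g \<in> eigenspace A b"
  shows "(\<integral>w. f w * g w \<partial>P) = 0"
proof -
  have "(\<integral>w. A f w * g w \<partial>P) = a * (\<integral>w. f w * g w \<partial>P)"
    using assms(2) by (simp add: eigenspace_def fscale_def mult.assoc)
  moreover have "(\<integral>w. f w * A g w \<partial>P) = b * (\<integral>w. f w * g w \<partial>P)"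
    using assms(3) by (simp add: eigenspace_def fscale_def mult.left_commute)
  ultimately have "(a - b) * (\<integral>w. f w * g w \<partial>P) = 0"
    using A_symmetric[of f g] assms by (simp add: eigenspace_def algebra_simps)
  thus ?thesis using assms(1) by simp
qed

end

theorem theorem7p2:
  fixes z z' :: complex
    and P :: "thoma measure"
    and A :: "(thoma \<Rightarrow> real) \<Rightarrow> (thoma \<Rightarrow> real)"
  assumes adm: "admissible z z'"
    and P: "is_boundary_zmeasure z z' P"
    and A: "is_Aop z z' A"
  shows "LamC = module.span fscale (\<Union>c. eigenspace A c)
     \<and> (\<forall>c d f g. c \<noteq> d \<and> f \<in> eigenspace A c \<and> g \<in> eigenspace A d \<longrightarrow>
            (\<integral>w. f w * g w \<partial>P) = 0)
     \<and> {c. eigenspace A c \<noteq> {0}} = {0} \<union> {- sigma z z' m | m. m \<ge> 2}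
     \<and> vector_space.dim fscale (eigenspace A 0) = 1
     \<and> (\<forall>m\<ge>2. vector_space.dim fscale (eigenspace A (- sigma z z' m)) = partitions_no_ones m)"
proof -
  interpret zoperator_boundary z z' "Re (z + z')" "Re (z * z')" A P
    by unfold_locales (rule adm A P)+
  have "LamC = module.span fscale (\<Union>c. eigenspace A c)"
    using T.V_eq_span_Eig by (simp add: eigenspace_eq)
  thus ?thesis
    using eigenspaces_orthogonal eigenvalues dim_eigenspace by blast
qed

end
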